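(* Let $A,T\in\mathcal{B}(\mathcal{H})$, where $\mathcal{H}$ is a complex Hilbert space and $A$ is a positive invertible operator, and let $\mathcal{S}\subseteq C(\mathbb{T})$ be the operator system $$\mathcal{S}=\{p(e^{i\theta})+\overline{q(e^{i\theta})}:\ p,q\text{ polynomials}\}.$$ Then the map $\varphi_A:\mathcal{S}\to\mathcal{B}(\mathcal{H})$ defined by $$\varphi_A\big(p(e^{i\theta})+\overline{q(e^{i\theta})}\big)=p(T)+q(T)^*+\big(p(0)+\overline{q(0)}\big)(A-I)$$ is a positive map if and only if $T$ is in the $\mathcal{C}_A$-class.
   Context: $C(\mathbb{T})$ is the C*-algebra of continuous functions on the unit circle. A linear map on $\mathcal{S}$ is positive if it sends functions $f\in\mathcal{S}$ with $f\ge0$ on $\mathbb{T}$ to positive operators. An operator $T\in\mathcal{B}(\mathcal{H})$ is in the $\mathcal{C}_A$-class if there is a unitary operator $U$ on some Hilbert space $\mathcal{K}\supseteq\mathcal{H}$ such that $A^{-1/2}T^nA^{-1/2}=P_{\mathcal{H}}U^n|_{\mathcal{H}}$ for all $n\ge1$, where $P_{\mathcal{H}}$ is the orthogonal projection of $\mathcal{K}$ onto $\mathcal{H}$. *)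

theory Defs
  imports "HOL-Analysis.Analysis" "HOL-Library.Function_Algebras" "HOL-Library.FuncSet"
begin

section \<open>Complex Hilbert spaces\<close>

text \<open>
  A Hilbert space is carried by a linear subspace of an ambient complex vector space type, with an
  inner product that is only meaningful on the carrier (linear in the first argument). The carrier
  is explicit because the dilation space of an operator has to be quantified over in a formula,
  which is impossible for spaces that are types. Operators are functions on the ambient type of
  which only the values on the carrier matter.
\<close>

record 'a hspace =
  vecs :: "'a set"
  hscale :: "complex \<Rightarrow> 'a \<Rightarrow> 'a"
  hinner :: "'a \<Rightarrow> 'a \<Rightarrow> complex"

definition hnorm :: "'a hspace \<Rightarrow> 'a \<Rightarrow> real" where
  "hnorm H x = sqrt (Re (hinner H x x))"

locale complex_hilbert_space = vector_space "hscale H"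
  for H :: "'a::ab_group_add hspace" +
  assumes subspace_vecs: "subspace (vecs H)"
    and inner_add: "\<lbrakk>x \<in> vecs H; y \<in> vecs H; z \<in> vecs H\<rbrakk>
          \<Longrightarrow> hinner H (x + y) z = hinner H x z + hinner H y z"
    and inner_scale: "\<lbrakk>x \<in> vecs H; y \<in> vecs H\<rbrakk>
          \<Longrightarrow> hinner H (hscale H c x) y = c * hinner H x y"
    and inner_cnj: "\<lbrakk>x \<in> vecs H; y \<in> vecs H\<rbrakk> \<Longrightarrow> hinner H x y = cnj (hinner H y x)"
    and inner_nonneg: "x \<in> vecs H \<Longrightarrow> hinner H x x \<in> \<real>\<^sub>\<ge>\<^sub>0"
    and inner_definite: "\<lbrakk>x \<in> vecs H; hinner H x x = 0\<rbrakk> \<Longrightarrow> x = 0"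
    and complete: "\<lbrakk>\<And>n::nat. X n \<in> vecs H;
             \<And>e. e > 0 \<Longrightarrow> \<exists>N. \<forall>m\<ge>N. \<forall>n\<ge>N. hnorm H (X m - X n) < e\<rbrakk>
          \<Longrightarrow> \<exists>l\<in>vecs H. (\<lambda>n. hnorm H (X n - l)) \<longlonglongrightarrow> 0"


section \<open>Operators\<close>

text \<open>
  Adjoint, inverse, positive square root and orthogonal projection are chosen with \<open>SOME\<close>: their
  defining property determines them uniquely on the carrier, but not as functions on the ambient type.
\<close>

definition bounded_op :: "'a::ab_group_add hspace \<Rightarrow> ('a \<Rightarrow> 'a) \<Rightarrow> bool" where
  "bounded_op H T \<longleftrightarrow>
     (\<forall>x\<in>vecs H. T x \<in> vecs H) \<and>
     (\<forall>x\<in>vecs H. \<forall>y\<in>vecs H. T (x + y) = T x + T y) \<and>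
     (\<forall>c. \<forall>x\<in>vecs H. T (hscale H c x) = hscale H c (T x)) \<and>
     (\<exists>C. \<forall>x\<in>vecs H. hnorm H (T x) \<le> C * hnorm H x)"

definition hadj :: "'a::ab_group_add hspace \<Rightarrow> ('a \<Rightarrow> 'a) \<Rightarrow> 'a \<Rightarrow> 'a" where
  "hadj H T y = (SOME z. z \<in> vecs H \<and> (\<forall>x\<in>vecs H. hinner H (T x) y = hinner H x z))"

definition positive_op :: "'a::ab_group_add hspace \<Rightarrow> ('a \<Rightarrow> 'a) \<Rightarrow> bool" where
  "positive_op H T \<longleftrightarrow> bounded_op H T \<and> (\<forall>x\<in>vecs H. hinner H (T x) x \<in> \<real>\<^sub>\<ge>\<^sub>0)"

definition is_inverse_op :: "'a::ab_group_add hspace \<Rightarrow> ('a \<Rightarrow> 'a) \<Rightarrow> ('a \<Rightarrow> 'a) \<Rightarrow> bool" where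
  "is_inverse_op H T R \<longleftrightarrow> bounded_op H R \<and> (\<forall>x\<in>vecs H. T (R x) = x \<and> R (T x) = x)"

definition invertible_op :: "'a::ab_group_add hspace \<Rightarrow> ('a \<Rightarrow> 'a) \<Rightarrow> bool" where
  "invertible_op H T \<longleftrightarrow> bounded_op H T \<and> (\<exists>R. is_inverse_op H T R)"

definition inverse_op :: "'a::ab_group_add hspace \<Rightarrow> ('a \<Rightarrow> 'a) \<Rightarrow> 'a \<Rightarrow> 'a" where
  "inverse_op H T = (SOME R. is_inverse_op H T R)"

definition sqrt_op :: "'a::ab_group_add hspace \<Rightarrow> ('a \<Rightarrow> 'a) \<Rightarrow> 'a \<Rightarrow> 'a" where
  "sqrt_op H T = (SOME R. positive_op H R \<and> (\<forall>x\<in>vecs H. R (R x) = T x))"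

definition unitary_op :: "'a::ab_group_add hspace \<Rightarrow> ('a \<Rightarrow> 'a) \<Rightarrow> bool" where
  "unitary_op H U \<longleftrightarrow>
     bounded_op H U \<and> (\<forall>x\<in>vecs H. hadj H U (U x) = x \<and> U (hadj H U x) = x)"

definition poly_op :: "'a::ab_group_add hspace \<Rightarrow> complex poly \<Rightarrow> ('a \<Rightarrow> 'a) \<Rightarrow> 'a \<Rightarrow> 'a" where
  "poly_op H p T x = (\<Sum>i\<le>degree p. hscale H (coeff p i) ((T ^^ i) x))"

definition orth_proj :: "'a::ab_group_add hspace \<Rightarrow> 'a set \<Rightarrow> 'a \<Rightarrow> 'a" where
  "orth_proj H M y = (SOME m. m \<in> M \<and> (\<forall>w\<in>M. hinner H (y - m) w = 0))"

definition isometric_embedding ::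
  "'a::ab_group_add hspace \<Rightarrow> 'k::ab_group_add hspace \<Rightarrow> ('a \<Rightarrow> 'k) \<Rightarrow> bool" where
  "isometric_embedding H K J \<longleftrightarrow>
     (\<forall>x\<in>vecs H. J x \<in> vecs K) \<and>
     (\<forall>x\<in>vecs H. \<forall>y\<in>vecs H. J (x + y) = J x + J y) \<and>
     (\<forall>c. \<forall>x\<in>vecs H. J (hscale H c x) = hscale K c (J x)) \<and>
     (\<forall>x\<in>vecs H. \<forall>y\<in>vecs H. hinner K (J x) (J y) = hinner H x y)"


section \<open>The class of operators with a unitary \<open>A\<close>-dilation\<close>

text \<open>
  The inclusion of \<open>H\<close> in the larger space \<open>K\<close> is an isometric linear embedding \<open>J\<close>. The type
  argument names the type whose vectors the dilation space may consist of. For \<open>H\<close> over \<open>'a\<close>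
  the type \<open>int \<Rightarrow> 'a\<close> is always large enough: if \<open>U\<close> on \<open>K\<close> is a dilation, so is its restriction
  to the smallest closed subspace that contains \<open>J H\<close> and reduces \<open>U\<close>, and \<open>k\<close> in this subspace is
  determined by the function sending an integer \<open>n\<close> to \<open>J\<^sup>* U\<^sup>n k\<close>.
\<close>

definition C_A_class ::
  "'k::ab_group_add itself \<Rightarrow> 'a::ab_group_add hspace \<Rightarrow> ('a \<Rightarrow> 'a) \<Rightarrow> ('a \<Rightarrow> 'a) \<Rightarrow> bool" where
  "C_A_class (_ :: 'k itself) H A T \<longleftrightarrow>
     (\<exists>(K :: 'k hspace) J U.
        complex_hilbert_space K \<and> isometric_embedding H K J \<and> unitary_op K U \<and>
        (let A' = sqrt_op H (inverse_op H A) in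
         \<forall>n\<ge>1. \<forall>x\<in>vecs H.
           J (A' ((T ^^ n) (A' x))) = orth_proj K (J ` vecs H) ((U ^^ n) (J x))))"


section \<open>The operator system and the map\<close>

text \<open>Functions on the unit circle are extended by \<^const>\<open>undefined\<close> outside of it.\<close>

abbreviation circle :: "complex set" where
  "circle \<equiv> sphere 0 1"

definition C_circle :: "(complex \<Rightarrow> complex) set" where
  "C_circle = {f \<in> extensional circle. continuous_on circle f}"

definition trig_fun :: "complex poly \<Rightarrow> complex poly \<Rightarrow> complex \<Rightarrow> complex" where
  "trig_fun p q = (\<lambda>z\<in>circle. poly p z + cnj (poly q z))"

definition trig_system :: "(complex \<Rightarrow> complex) set" where
  "trig_system = {trig_fun p q | p q. True}"

lemma trig_system_subset_C_circle: "trig_system \<subseteq> C_circle"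
proof
  fix f assume "f \<in> trig_system"
  then obtain p q where f: "f = trig_fun p q" by (auto simp: trig_system_def)
  have "continuous_on circle (\<lambda>z. poly p z + cnj (poly q z))"
    by (intro continuous_intros)
  then have "continuous_on circle f"
    by (rule continuous_on_eq) (simp add: f trig_fun_def)
  then show "f \<in> C_circle" by (simp add: C_circle_def f trig_fun_def)
qed

definition op_linear_on ::
  "(complex \<Rightarrow> complex) set \<Rightarrow> 'a::ab_group_add hspace \<Rightarrow> ((complex \<Rightarrow> complex) \<Rightarrow> 'a \<Rightarrow> 'a) \<Rightarrow> bool"
  where
  "op_linear_on S H \<phi> \<longleftrightarrow>
     (\<forall>f\<in>S. bounded_op H (\<phi> f)) \<and>
     (\<forall>f\<in>S. \<forall>g\<in>S. \<forall>x\<in>vecs H. \<phi> (\<lambda>z\<in>circle. f z + g z) x = \<phi> f x + \<phi> g x) \<and>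
     (\<forall>c. \<forall>f\<in>S. \<forall>x\<in>vecs H. \<phi> (\<lambda>z\<in>circle. c * f z) x = hscale H c (\<phi> f x))"

definition positive_map ::
  "(complex \<Rightarrow> complex) set \<Rightarrow> 'a::ab_group_add hspace \<Rightarrow> ((complex \<Rightarrow> complex) \<Rightarrow> 'a \<Rightarrow> 'a) \<Rightarrow> bool"
  where
  "positive_map S H \<phi> \<longleftrightarrow>
     op_linear_on S H \<phi> \<and>
     (\<forall>f\<in>S. (\<forall>z\<in>circle. f z \<in> \<real>\<^sub>\<ge>\<^sub>0) \<longrightarrow> positive_op H (\<phi> f))"

definition phi_value :: "'a::ab_group_add hspace \<Rightarrow> ('a \<Rightarrow> 'a) \<Rightarrow> ('a \<Rightarrow> 'a) \<Rightarrow>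
    complex poly \<Rightarrow> complex poly \<Rightarrow> 'a \<Rightarrow> 'a" where
  "phi_value H A T p q x =
     poly_op H p T x + hadj H (poly_op H q T) x
       + hscale H (poly p 0 + cnj (poly q 0)) (A x - x)"

text \<open>
  The polynomials representing an element of \<^const>\<open>trig_system\<close> are not unique; the value does
  not depend on the choice, see \<open>phi_A_trig_fun\<close> below.
\<close>

definition phi_A :: "'a::ab_group_add hspace \<Rightarrow> ('a \<Rightarrow> 'a) \<Rightarrow> ('a \<Rightarrow> 'a) \<Rightarrow>
    (complex \<Rightarrow> complex) \<Rightarrow> 'a \<Rightarrow> 'a" where
  "phi_A H A T f = (case (SOME (p, q). f = trig_fun p q) of (p, q) \<Rightarrow> phi_value H A T p q)"


section \<open>The map is well defined\<close>

lemma poly_eq_const_if_eq_on_circle: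
  fixes p :: "complex poly"
  assumes "\<And>z. z \<in> circle \<Longrightarrow> poly p z = c"
  shows "p = [:c:]"
proof (rule ccontr)
  assume "p \<noteq> [:c:]"
  then have "finite {z. poly (p - [:c:]) z = 0}" by (intro poly_roots_finite) simp
  moreover have "circle \<subseteq> {z. poly (p - [:c:]) z = 0}" using assms by auto
  ultimately have "finite circle" by (rule finite_subset[rotated])
  moreover have "infinite circle"
  proof -
    have "uncountable (sphere (0::complex) 1)"
      by (rule connected_uncountable[of _ 1 "-1"]) (auto intro: connected_sphere)
    then show ?thesis by (meson countable_finite)
  qed
  ultimately show False by blast
qed

lemma poly_eq_cnj_poly_on_circle:
  fixes p q :: "complex poly"
  assumes eq: "\<And>z. z \<in> circle \<Longrightarrow> poly p z = cnj (poly q z)"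
  obtains c where "p = [:c:]" "q = [:cnj c:]"
proof -
  define N where "N = degree q"
  define r where "r = (\<Sum>i\<le>N. monom (cnj (coeff q i)) (N - i))"
  have pr: "monom 1 N * p = r"
  proof -
    have "monom 1 N * p - r = [:0:]"
    proof (rule poly_eq_const_if_eq_on_circle)
      fix z :: complex assume z: "z \<in> circle"
      then have zz: "z * cnj z = 1"
        by (simp add: complex_norm_square[symmetric])
      have "poly r z = (\<Sum>i\<le>N. cnj (coeff q i) * z ^ (N - i))"
        by (simp add: r_def poly_sum poly_monom)
      also have "\<dots> = (\<Sum>i\<le>N. z ^ N * (cnj (coeff q i) * cnj z ^ i))"
      proof (rule sum.cong)
        fix i assume "i \<in> {..N}"
        then have "z ^ N = z ^ (N - i) * z ^ i" by (simp add: power_add[symmetric])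
        then have "z ^ N * cnj z ^ i = z ^ (N - i) * (z * cnj z) ^ i"
          by (simp add: power_mult_distrib)
        then show "cnj (coeff q i) * z ^ (N - i) = z ^ N * (cnj (coeff q i) * cnj z ^ i)"
          by (simp add: zz mult.left_commute)
      qed simp
      also have "\<dots> = z ^ N * cnj (poly q z)"
        by (simp add: poly_altdef N_def sum_distrib_left)
      finally show "poly (monom 1 N * p - r) z = 0"
        using eq[OF z] by (simp add: poly_monom)
    qed
    then show ?thesis by simp
  qed
  have "degree p = 0"
  proof (cases "p = 0")
    case False
    have "degree r \<le> N" unfolding r_def
      by (intro degree_sum_le) (auto intro: order_trans[OF degree_monom_le])
    moreover have "degree r = N + degree p"
      using False by (simp add: pr[symmetric] degree_mult_eq monom_eq_0_iff degree_monom_eq)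
    ultimately show ?thesis by simp
  qed simp
  then obtain c where c: "p = [:c:]" by (metis degree_eq_zeroE)
  have "q = [:cnj c:]"
    by (rule poly_eq_const_if_eq_on_circle) (use eq c in \<open>auto simp: complex_eq_iff\<close>)
  with c show thesis by (rule that)
qed

context complex_hilbert_space
begin

lemma vecs_0 [simp]: "0 \<in> vecs H"
  using subspace_vecs by (rule subspace_0)

lemma vecs_add [simp]: "x \<in> vecs H \<Longrightarrow> y \<in> vecs H \<Longrightarrow> x + y \<in> vecs H"
  using subspace_vecs by (rule subspace_add)

lemma vecs_diff [simp]: "x \<in> vecs H \<Longrightarrow> y \<in> vecs H \<Longrightarrow> x - y \<in> vecs H"
  using subspace_vecs by (rule subspace_diff)

lemma vecs_scale [simp]: "x \<in> vecs H \<Longrightarrow> hscale H c x \<in> vecs H"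
  using subspace_vecs by (rule subspace_scale)

lemma inner_diff:
  "\<lbrakk>x \<in> vecs H; y \<in> vecs H; z \<in> vecs H\<rbrakk> \<Longrightarrow> hinner H (x - y) z = hinner H x z - hinner H y z"
  using inner_add[of "x - y" y z] by simp

lemma inner_add_right:
  "\<lbrakk>x \<in> vecs H; y \<in> vecs H; z \<in> vecs H\<rbrakk> \<Longrightarrow> hinner H z (x + y) = hinner H z x + hinner H z y"
  using inner_add[of x y z] inner_cnj[of z] by (metis complex_cnj_add vecs_add)

lemma inner_diff_right:
  "\<lbrakk>x \<in> vecs H; y \<in> vecs H; z \<in> vecs H\<rbrakk> \<Longrightarrow> hinner H z (x - y) = hinner H z x - hinner H z y"
  using inner_add_right[of "x - y" y z] by simp

lemma inner_scale_right:
  "\<lbrakk>x \<in> vecs H; y \<in> vecs H\<rbrakk> \<Longrightarrow> hinner H x (hscale H c y) = cnj c * hinner H x y"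
  using inner_scale[of y x c] inner_cnj[of x] by (metis complex_cnj_mult vecs_scale)

lemma Re_inner_nonneg: "x \<in> vecs H \<Longrightarrow> 0 \<le> Re (hinner H x x)"
  using inner_nonneg[of x] by (simp add: complex_nonneg_Reals_iff)

lemma hnorm_sq: "x \<in> vecs H \<Longrightarrow> (hnorm H x)\<^sup>2 = Re (hinner H x x)"
  by (simp add: hnorm_def Re_inner_nonneg)

lemma hnorm_nonneg: "x \<in> vecs H \<Longrightarrow> 0 \<le> hnorm H x"
  by (simp add: hnorm_def Re_inner_nonneg)

lemma inner_self: "x \<in> vecs H \<Longrightarrow> hinner H x x = of_real ((hnorm H x)\<^sup>2)"
  using inner_nonneg[of x] by (simp add: hnorm_sq complex_nonneg_Reals_iff complex_eq_iff)

lemma Re_inner_commute: "x \<in> vecs H \<Longrightarrow> y \<in> vecs H \<Longrightarrow> Re (hinner H x y) = Re (hinner H y x)"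
  using inner_cnj[of x y] by simp

lemma hnorm_add_sq:
  "\<lbrakk>x \<in> vecs H; y \<in> vecs H\<rbrakk>
     \<Longrightarrow> (hnorm H (x + y))\<^sup>2 = (hnorm H x)\<^sup>2 + (hnorm H y)\<^sup>2 + 2 * Re (hinner H x y)"
  using Re_inner_commute[of x y] by (simp add: hnorm_sq inner_add inner_add_right)

lemma hnorm_diff_sq:
  "\<lbrakk>x \<in> vecs H; y \<in> vecs H\<rbrakk>
     \<Longrightarrow> (hnorm H (x - y))\<^sup>2 = (hnorm H x)\<^sup>2 + (hnorm H y)\<^sup>2 - 2 * Re (hinner H x y)"
  using Re_inner_commute[of x y] by (simp add: hnorm_sq inner_diff inner_diff_right)

lemma hnorm_scale: "x \<in> vecs H \<Longrightarrow> hnorm H (hscale H c x) = norm c * hnorm H x"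
proof -
  assume x: "x \<in> vecs H"
  have "hinner H (hscale H c x) (hscale H c x) = of_real ((norm c)\<^sup>2 * (hnorm H x)\<^sup>2)"
  proof -
    have "hinner H (hscale H c x) (hscale H c x) = (c * cnj c) * hinner H x x"
      using x by (simp add: inner_scale inner_scale_right)
    then show ?thesis using x by (simp add: inner_self[OF x] complex_norm_square[symmetric])
  qed
  then have "Re (hinner H (hscale H c x) (hscale H c x)) = (norm c * hnorm H x)\<^sup>2"
    by (simp add: power_mult_distrib)
  then show ?thesis
    using hnorm_nonneg[OF x] by (simp add: hnorm_def[of H "hscale H c x"])
qed

lemma inner_eq_imp_eq:
  assumes "y \<in> vecs H" "z \<in> vecs H" and eq: "\<And>x. x \<in> vecs H \<Longrightarrow> hinner H x y = hinner H x z"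
  shows "y = z"
  using inner_definite[of "y - z"] assms by (simp add: inner_diff_right)

lemma Re_inner_le: "\<lbrakk>x \<in> vecs H; y \<in> vecs H\<rbrakk> \<Longrightarrow> Re (hinner H x y) \<le> hnorm H x * hnorm H y"
proof -
  assume x: "x \<in> vecs H" and y: "y \<in> vecs H"
  define a b where "a = hnorm H x" and "b = hnorm H y"
  have ab: "0 \<le> a" "0 \<le> b" using x y by (auto simp: a_def b_def hnorm_nonneg)
  have key: "2 * s * t * Re (hinner H x y) \<le> s\<^sup>2 * a\<^sup>2 + t\<^sup>2 * b\<^sup>2" for s t :: real
  proof -
    have "0 \<le> (hnorm H (hscale H (of_real s) x - hscale H (of_real t) y))\<^sup>2" by simp
    also have "\<dots> = s\<^sup>2 * a\<^sup>2 + t\<^sup>2 * b\<^sup>2 - 2 * (s * t * Re (hinner H x y))"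
      using x y by (subst hnorm_diff_sq)
        (simp_all add: hnorm_scale inner_scale inner_scale_right power_mult_distrib a_def b_def)
    finally show ?thesis by simp
  qed
  show "Re (hinner H x y) \<le> a * b"
  proof (cases "a = 0 \<or> b = 0")
    case False
    with ab have "0 < a * b" by simp
    moreover have "(a * b) * (2 * Re (hinner H x y)) \<le> (a * b) * (2 * (a * b))"
      using key[of b a] by (simp add: power2_eq_square algebra_simps)
    ultimately show ?thesis by (simp add: mult_le_cancel_left_pos)
  next
    case True
    show ?thesis
    proof (rule ccontr)
      assume "\<not> ?thesis"
      with True have pos: "Re (hinner H x y) > 0" by auto
      define R where "R = Re (hinner H x y)"
      from pos have R: "R > 0" by (simp add: R_def)
      from True show False
      proof
        assume "a = 0"
        then show False using key[of "(b\<^sup>2 + 1) / (2 * R)" 1] R by (simp add: R_def[symmetric])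
      next
        assume "b = 0"
        then show False using key[of 1 "(a\<^sup>2 + 1) / (2 * R)"] R by (simp add: R_def[symmetric])
      qed
    qed
  qed
qed

lemma hnorm_triangle: "\<lbrakk>x \<in> vecs H; y \<in> vecs H\<rbrakk> \<Longrightarrow> hnorm H (x + y) \<le> hnorm H x + hnorm H y"
proof -
  assume xy: "x \<in> vecs H" "y \<in> vecs H"
  have "(hnorm H (x + y))\<^sup>2 \<le> (hnorm H x + hnorm H y)\<^sup>2"
    using hnorm_add_sq[OF xy] Re_inner_le[OF xy] by (simp add: power2_sum)
  then show ?thesis
    by (rule power2_le_imp_le) (use xy in \<open>simp add: hnorm_nonneg\<close>)
qed

theorem riesz_representation:
  assumes f_add: "\<And>x y. \<lbrakk>x \<in> vecs H; y \<in> vecs H\<rbrakk> \<Longrightarrow> f (x + y) = f x + f y"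
    and f_scale: "\<And>c x. x \<in> vecs H \<Longrightarrow> f (hscale H c x) = c * f x"
    and f_bdd: "\<And>x. x \<in> vecs H \<Longrightarrow> norm (f x) \<le> C * hnorm H x"
  shows "\<exists>z\<in>vecs H. \<forall>x\<in>vecs H. f x = hinner H x z"
proof -
  define F where "F x = (hnorm H x)\<^sup>2 - 2 * Re (f x)" for x
  define m where "m = Inf (F ` vecs H)"
  have Re_f: "Re (f x) \<le> C * hnorm H x" if "x \<in> vecs H" for x
    using f_bdd[OF that] complex_Re_le_cmod[of "f x"] by linarith
  have F_lower: "- (C\<^sup>2) \<le> F x" if "x \<in> vecs H" for x
  proof -
    have "0 \<le> (hnorm H x - C)\<^sup>2" by simp
    then show ?thesis using Re_f[OF that] by (simp add: F_def power2_diff mult_ac)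
  qed
  have bdd: "bdd_below (F ` vecs H)" using F_lower by (auto intro!: bdd_belowI)
  have m_le: "m \<le> F x" if "x \<in> vecs H" for x
    unfolding m_def using bdd that by (auto intro: cInf_lower)
  have "\<exists>x\<in>vecs H. F x < m + e" if "e > 0" for e
  proof -
    have "F ` vecs H \<noteq> {}" using vecs_0 by blast
    moreover have "Inf (F ` vecs H) < m + e" using that by (simp add: m_def)
    ultimately have "\<exists>y\<in>F ` vecs H. y < m + e" by (simp add: cInf_less_iff[OF _ bdd])
    then show ?thesis by blast
  qed
  then have "\<forall>n. \<exists>x. x \<in> vecs H \<and> F x < m + 1 / (real n + 1)" by (simp add: Bex_def)
  then obtain X where X: "\<And>n. X n \<in> vecs H" "\<And>n. F (X n) < m + 1 / (real n + 1)"
    by metis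
  have para: "(hnorm H (x - y))\<^sup>2 \<le> 2 * (F x + F y - 2 * m)"
    if xy: "x \<in> vecs H" "y \<in> vecs H" for x y
  proof -
    define w where "w = hscale H (1/2) (x + y)"
    have w: "w \<in> vecs H" using xy by (simp add: w_def)
    have hw: "(hnorm H w)\<^sup>2 = (hnorm H (x + y))\<^sup>2 / 4"
      using xy by (simp add: w_def hnorm_scale power_mult_distrib power_divide)
    have fw: "Re (f w) = (Re (f x) + Re (f y)) / 2"
      using xy by (simp add: w_def f_scale f_add)
    have "(hnorm H (x - y))\<^sup>2 = 2 * (F x + F y - 2 * F w)"
      using hnorm_add_sq[OF xy] hnorm_diff_sq[OF xy] by (simp add: F_def hw fw field_simps)
    then show ?thesis using m_le[OF w] by simp
  qed
  have "\<exists>l\<in>vecs H. (\<lambda>n. hnorm H (X n - l)) \<longlonglongrightarrow> 0"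
  proof (rule complete)
    fix e :: real assume e: "e > 0"
    obtain N where N: "inverse (real (Suc N)) < e\<^sup>2 / 4"
      using reals_Archimedean[of "e\<^sup>2 / 4"] e by auto
    have "hnorm H (X i - X j) < e" if ij: "i \<ge> N" "j \<ge> N" for i j
    proof -
      have *: "F (X k) < m + e\<^sup>2 / 4" if "k \<ge> N" for k
      proof -
        have "1 / (real k + 1) \<le> 1 / (real N + 1)"
          using that by (intro divide_left_mono) auto
        also have "\<dots> < e\<^sup>2 / 4" using N by (simp add: inverse_eq_divide add.commute)
        finally show ?thesis using X(2)[of k] by linarith
      qed
      have "(hnorm H (X i - X j))\<^sup>2 < e\<^sup>2"
      proof -
        have lin: "u < w" if "u \<le> 2 * (a + b - 2 * k)" "a < k + w / 4" "b < k + w / 4"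
          for u w a b k :: real
          using that by argo
        show ?thesis
          by (rule lin[OF para[OF X(1)[of i] X(1)[of j]] *[OF ij(1)] *[OF ij(2)]])
      qed
      then show ?thesis by (rule power2_less_imp_less) (use e in simp)
    qed
    then show "\<exists>N. \<forall>i\<ge>N. \<forall>j\<ge>N. hnorm H (X i - X j) < e" by blast
  qed (rule X(1))
  then obtain z where z: "z \<in> vecs H" and lim: "(\<lambda>n. hnorm H (X n - z)) \<longlonglongrightarrow> 0" by blast
  have Fz: "F z \<le> m"
  proof -
    let ?d = "\<lambda>n. hnorm H (X n - z)"
    have "F z \<le> m + 1 / (real n + 1) + (2 * hnorm H z + 2 * \<bar>C\<bar>) * ?d n" for n
    proof -
      have d: "X n - z \<in> vecs H" using X(1) z by simp
      have "X n = (X n - z) + z" by simp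
      then have nX: "(hnorm H (X n))\<^sup>2
          = (?d n)\<^sup>2 + (hnorm H z)\<^sup>2 + 2 * Re (hinner H (X n - z) z)"
        and fX: "f (X n) = f (X n - z) + f z"
        using hnorm_add_sq[OF d z] f_add[OF d z] by simp_all
      have m1: "- Re (hinner H (X n - z) z) \<le> hnorm H z * ?d n"
      proof -
        have "- Re (hinner H (X n - z) z) = Re (hinner H (z - X n) z)"
          using X(1) z by (simp add: inner_diff)
        also have "\<dots> \<le> hnorm H (z - X n) * hnorm H z"
          using X(1) z by (intro Re_inner_le) auto
        also have "hnorm H (z - X n) = ?d n"
          using hnorm_scale[OF d, of "-1"] by simp
        finally show ?thesis by (simp add: mult.commute)
      qed
      have m2: "Re (f (X n - z)) \<le> \<bar>C\<bar> * ?d n"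
        using Re_f[OF d] hnorm_nonneg[OF d] mult_right_mono[of C "\<bar>C\<bar>" "?d n"] by linarith
      have "F z = F (X n) - (?d n)\<^sup>2 - 2 * Re (hinner H (X n - z) z) + 2 * Re (f (X n - z))"
        by (simp add: F_def nX fX)
      moreover have lin: "u \<le> m' + v + (2 * z' + 2 * c) * d"
        if "u = w - d\<^sup>2 - 2 * a + 2 * b" "w < m' + v" "- a \<le> z' * d" "b \<le> c * d"
        for u w a b c d v z' m' :: real
      proof -
        have "(2 * z' + 2 * c) * d = 2 * (z' * d) + 2 * (c * d)" by (simp add: algebra_simps)
        then show ?thesis using that zero_le_power2[of d] by linarith
      qed
      ultimately show ?thesis
        using X(2)[of n] m1 m2 by (intro lin)
    qed
    moreover have "(\<lambda>n. m + 1 / (real n + 1) + (2 * hnorm H z + 2 * \<bar>C\<bar>) * ?d n) \<longlonglongrightarrow> m + 0 + (2 * hnorm H z + 2 * \<bar>C\<bar>) * 0"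
      using LIMSEQ_inverse_real_of_nat
      by (intro tendsto_intros lim) (simp add: inverse_eq_divide add.commute)
    ultimately show ?thesis
      by (intro LIMSEQ_le_const[where a = "F z"]) auto
  qed
  have Re_eq: "Re (f x) = Re (hinner H x z)" if x: "x \<in> vecs H" for x
  proof -
    define b where "b = Re (hinner H x z) - Re (f x)"
    have quad: "0 \<le> t\<^sup>2 * (hnorm H x)\<^sup>2 + 2 * t * b" for t :: real
    proof -
      let ?y = "hscale H (of_real t) x"
      have "F z \<le> F (z + ?y)" using Fz m_le[of "z + ?y"] x z by simp
      moreover have "F (z + ?y) = F z + t\<^sup>2 * (hnorm H x)\<^sup>2 + 2 * t * b"
        using x z Re_inner_commute[OF x z]
        by (simp add: F_def b_def hnorm_add_sq hnorm_scale power_mult_distrib inner_scale_right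
            f_add f_scale algebra_simps)
      ultimately show ?thesis by linarith
    qed
    define s where "s = (hnorm H x)\<^sup>2 + 1"
    have s: "s > 0" unfolding s_def by (simp add: add_nonneg_pos)
    have "0 \<le> (- b / s)\<^sup>2 * (hnorm H x)\<^sup>2 + 2 * (- b / s) * b" by (rule quad)
    also have "\<dots> = (b\<^sup>2 * (hnorm H x)\<^sup>2 - 2 * b\<^sup>2 * s) / s\<^sup>2"
      using s by (simp add: field_simps power2_eq_square)
    also have "\<dots> = - (b\<^sup>2) * (s + 1) / s\<^sup>2"
      by (simp add: s_def algebra_simps)
    finally have "b\<^sup>2 * (s + 1) \<le> 0"
      using s by (simp add: divide_le_0_iff)
    then have "b = 0" using s by (simp add: mult_le_0_iff)
    then show ?thesis by (simp add: b_def)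
  qed
  have "f x = hinner H x z" if x: "x \<in> vecs H" for x
  proof (rule complex_eqI)
    show "Re (f x) = Re (hinner H x z)" using Re_eq[OF x] .
    have "Re (f (hscale H \<i> x)) = Re (hinner H (hscale H \<i> x) z)" using x by (intro Re_eq) simp
    then show "Im (f x) = Im (hinner H x z)" using x z by (simp add: f_scale inner_scale)
  qed
  with z show ?thesis by blast
qed

lemma bounded_op_vecs: "bounded_op H T \<Longrightarrow> x \<in> vecs H \<Longrightarrow> T x \<in> vecs H"
  by (simp add: bounded_op_def)

lemma norm_inner_le: "\<lbrakk>x \<in> vecs H; y \<in> vecs H\<rbrakk> \<Longrightarrow> norm (hinner H x y) \<le> hnorm H x * hnorm H y"
proof -
  assume x: "x \<in> vecs H" and y: "y \<in> vecs H"
  define u where "u = cnj (sgn (hinner H x y))"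
  have "cnj (sgn w) * w = of_real (norm w)" for w :: complex
  proof (cases "w = 0")
    case False
    have "cnj (sgn w) * w = (w * cnj w) / of_real (norm w)"
      by (simp add: sgn_div_norm scaleR_conv_of_real divide_inverse mult_ac)
    then show ?thesis
      using False by (simp add: complex_norm_square[symmetric] power2_eq_square)
  qed simp
  then have "hinner H (hscale H u x) y = of_real (norm (hinner H x y))"
    using x y by (simp add: u_def inner_scale)
  then have "norm (hinner H x y) \<le> hnorm H (hscale H u x) * hnorm H y"
    using Re_inner_le[of "hscale H u x" y] x y by simp
  also have "\<dots> \<le> hnorm H x * hnorm H y"
    using x y by (intro mult_right_mono) (auto simp: hnorm_scale u_def norm_sgn hnorm_nonneg)
  finally show ?thesis .
qed

lemma hadj_spec:
  assumes T: "bounded_op H T" and y: "y \<in> vecs H"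
  shows "hadj H T y \<in> vecs H"
    and "x \<in> vecs H \<Longrightarrow> hinner H (T x) y = hinner H x (hadj H T y)"
proof -
  from T obtain C where C: "\<And>x. x \<in> vecs H \<Longrightarrow> hnorm H (T x) \<le> C * hnorm H x"
    unfolding bounded_op_def by blast
  have "\<exists>z\<in>vecs H. \<forall>x\<in>vecs H. hinner H (T x) y = hinner H x z"
  proof (rule riesz_representation)
    fix x assume x: "x \<in> vecs H"
    have "norm (hinner H (T x) y) \<le> hnorm H (T x) * hnorm H y"
      using T x y by (intro norm_inner_le) (auto simp: bounded_op_def)
    also have "\<dots> \<le> (C * hnorm H x) * hnorm H y"
      using C[OF x] y by (intro mult_right_mono) (auto simp: hnorm_nonneg)
    finally show "norm (hinner H (T x) y) \<le> (C * hnorm H y) * hnorm H x"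
      by (simp add: mult_ac)
  qed (use T y in \<open>auto simp: bounded_op_def inner_add inner_scale\<close>)
  then have "\<exists>z. z \<in> vecs H \<and> (\<forall>x\<in>vecs H. hinner H (T x) y = hinner H x z)" by blast
  from someI_ex[OF this] show "hadj H T y \<in> vecs H"
    and "x \<in> vecs H \<Longrightarrow> hinner H (T x) y = hinner H x (hadj H T y)"
    by (auto simp: hadj_def)
qed

lemma hadj_eqI:
  assumes "bounded_op H T" "y \<in> vecs H" "z \<in> vecs H"
    and "\<And>x. x \<in> vecs H \<Longrightarrow> hinner H (T x) y = hinner H x z"
  shows "hadj H T y = z"
  using assms hadj_spec[OF assms(1,2)] by (intro inner_eq_imp_eq) auto

lemma bounded_op_id: "bounded_op H (\<lambda>x. x)"
  by (auto simp: bounded_op_def intro: exI[of _ 1])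

lemma bounded_op_zero: "bounded_op H (\<lambda>x. 0)"
  using hnorm_scale[of 0 0] by (auto simp: bounded_op_def intro!: exI[of _ 0])

lemma bounded_op_compose:
  assumes S: "bounded_op H S" and T: "bounded_op H T" shows "bounded_op H (\<lambda>x. S (T x))"
proof -
  from S obtain C where C: "\<And>x. x \<in> vecs H \<Longrightarrow> hnorm H (S x) \<le> C * hnorm H x"
    unfolding bounded_op_def by blast
  from T obtain D where D: "\<And>x. x \<in> vecs H \<Longrightarrow> hnorm H (T x) \<le> D * hnorm H x"
    unfolding bounded_op_def by blast
  have "hnorm H (S (T x)) \<le> (\<bar>C\<bar> * D) * hnorm H x" if x: "x \<in> vecs H" for x
  proof -
    have Tx: "T x \<in> vecs H" using T x by (rule bounded_op_vecs)
    have "hnorm H (S (T x)) \<le> \<bar>C\<bar> * hnorm H (T x)"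
      using C[OF Tx] hnorm_nonneg[OF Tx] mult_right_mono[of C "\<bar>C\<bar>" "hnorm H (T x)"] by linarith
    also have "\<dots> \<le> \<bar>C\<bar> * (D * hnorm H x)" using D[OF x] by (intro mult_left_mono) auto
    finally show ?thesis by (simp add: mult.assoc)
  qed
  then show ?thesis using S T unfolding bounded_op_def by auto
qed

lemma bounded_op_add:
  assumes S: "bounded_op H S" and T: "bounded_op H T" shows "bounded_op H (\<lambda>x. S x + T x)"
proof -
  from S obtain C where C: "\<And>x. x \<in> vecs H \<Longrightarrow> hnorm H (S x) \<le> C * hnorm H x"
    unfolding bounded_op_def by blast
  from T obtain D where D: "\<And>x. x \<in> vecs H \<Longrightarrow> hnorm H (T x) \<le> D * hnorm H x"
    unfolding bounded_op_def by blast
  have "hnorm H (S x + T x) \<le> (C + D) * hnorm H x" if x: "x \<in> vecs H" for x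
    using hnorm_triangle[of "S x" "T x"] C[OF x] D[OF x] bounded_op_vecs[OF S x]
      bounded_op_vecs[OF T x] by (simp add: distrib_right)
  then show ?thesis using S T unfolding bounded_op_def
    by (auto simp: scale_right_distrib add_ac)
qed

lemma bounded_op_scale:
  assumes T: "bounded_op H T" shows "bounded_op H (\<lambda>x. hscale H c (T x))"
proof -
  from T obtain D where D: "\<And>x. x \<in> vecs H \<Longrightarrow> hnorm H (T x) \<le> D * hnorm H x"
    unfolding bounded_op_def by blast
  have "hnorm H (hscale H c (T x)) \<le> (norm c * D) * hnorm H x" if x: "x \<in> vecs H" for x
    using D[OF x] bounded_op_vecs[OF T x]
    by (simp add: hnorm_scale mult.assoc mult_left_mono)
  then have "\<exists>B. \<forall>x\<in>vecs H. hnorm H (hscale H c (T x)) \<le> B * hnorm H x" by blast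
  then show ?thesis using T unfolding bounded_op_def
    by (simp add: scale_right_distrib mult.commute)
qed

lemma bounded_op_funpow: "bounded_op H T \<Longrightarrow> bounded_op H (T ^^ n)"
proof (induction n)
  case 0
  show ?case using bounded_op_id by (simp add: id_def)
next
  case (Suc n)
  then show ?case using bounded_op_compose[of T "T ^^ n"] by (simp add: comp_def)
qed

lemma bounded_op_sum:
  "(\<And>i. i \<in> I \<Longrightarrow> bounded_op H (R i)) \<Longrightarrow> bounded_op H (\<lambda>x. \<Sum>i\<in>I. R i x)"
  by (induction I rule: infinite_finite_induct) (simp_all add: bounded_op_zero bounded_op_add)

lemma bounded_op_poly_op: "bounded_op H T \<Longrightarrow> bounded_op H (poly_op H p T)"
  unfolding poly_op_def
  by (intro bounded_op_sum bounded_op_scale bounded_op_funpow)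

lemma poly_op_add_const: "poly_op H (p + [:c:]) T x = poly_op H p T x + hscale H c x"
proof -
  have deg: "degree (p + [:c:]) = degree p"
    by (cases "degree p = 0") (auto simp: degree_add_eq_left elim!: degree_eq_zeroE)
  have "poly_op H (p + [:c:]) T x
      = (\<Sum>i\<le>degree p. hscale H (coeff p i) ((T ^^ i) x)
           + (if i = 0 then hscale H c x else 0))"
    unfolding poly_op_def deg
    by (intro sum.cong) (auto simp: scale_left_distrib coeff_pCons split: nat.split)
  then show ?thesis by (simp add: sum.distrib poly_op_def)
qed

lemma phi_value_unique:
  assumes T: "bounded_op H T" and x: "x \<in> vecs H" and eq: "trig_fun p q = trig_fun p' q'"
  shows "phi_value H A T p q x = phi_value H A T p' q' x"
proof -
  have "poly (p - p') z = cnj (poly (q' - q) z)" if "z \<in> circle" for z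
    using fun_cong[OF eq, of z] that by (simp add: trig_fun_def algebra_simps)
  then obtain c where c: "p - p' = [:c:]" "q' - q = [:cnj c:]"
    by (rule poly_eq_cnj_poly_on_circle)
  then have p: "p = p' + [:c:]" and q: "q' = q + [:cnj c:]" by (simp_all add: algebra_simps)
  have bq: "bounded_op H (poly_op H q T)" and bq': "bounded_op H (poly_op H q' T)"
    using T by (simp_all add: bounded_op_poly_op)
  have "hadj H (poly_op H q' T) x = hadj H (poly_op H q T) x + hscale H c x"
  proof (rule hadj_eqI[OF bq' x])
    show "hadj H (poly_op H q T) x + hscale H c x \<in> vecs H"
      using hadj_spec(1)[OF bq x] x by simp
    fix w assume w: "w \<in> vecs H"
    show "hinner H (poly_op H q' T w) x = hinner H w (hadj H (poly_op H q T) x + hscale H c x)"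
      using hadj_spec[OF bq x] w x bounded_op_vecs[OF bq w]
      by (simp add: q poly_op_add_const inner_add inner_add_right inner_scale inner_scale_right)
  qed
  moreover have "poly_op H p T x = poly_op H p' T x + hscale H c x"
    by (simp add: p poly_op_add_const)
  moreover have "poly p 0 + cnj (poly q 0) = poly p' 0 + cnj (poly q' 0)"
    by (simp add: p q)
  ultimately show ?thesis by (simp add: phi_value_def add_ac)
qed

theorem phi_A_trig_fun:
  assumes "bounded_op H T" "x \<in> vecs H"
  shows "phi_A H A T (trig_fun p q) x =
     poly_op H p T x + hadj H (poly_op H q T) x
       + hscale H (poly p 0 + cnj (poly q 0)) (A x - x)"
proof -
  obtain p' q' where pq: "(SOME (p', q'). trig_fun p q = trig_fun p' q') = (p', q')"
    by (metis surj_pair)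
  have "case (SOME (p', q'). trig_fun p q = trig_fun p' q') of
      (p', q') \<Rightarrow> trig_fun p q = trig_fun p' q'"
    by (rule someI[where x = "(p, q)"]) simp
  then have "trig_fun p q = trig_fun p' q'" by (simp add: pq)
  from phi_value_unique[OF assms this] show ?thesis
    by (simp add: phi_A_def pq phi_value_def)
qed

end

end

theory Submission
  imports Defs
begin

text \<open>
  Put \<open>S\<^sub>0 = A\<close>, \<open>S\<^sub>n = T\<^sup>n\<close> and \<open>S\<^sub>-\<^sub>n = (T\<^sup>n)\<^sup>*\<close> for \<open>n \<ge> 1\<close>, so that \<open>\<phi>\<^sub>A\<close> sends
  \<open>\<Sum> c\<^sub>n z\<^sup>n\<close> to \<open>\<Sum> c\<^sub>n S\<^sub>n\<close>. Both implications multiply by the Fejer kernel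
  \<open>\<bar>\<Sum>j<L. (z / \<omega>)\<^sup>j\<bar>\<^sup>2\<close>, average over the roots of unity \<open>\<omega>\<close> of a large order, and let \<open>L\<close>
  tend to infinity. If \<open>U\<close> is a dilation and \<open>x = A\<^sup>-\<^sup>1\<^sup>/\<^sup>2 y\<close>, then \<open>\<langle>S\<^sub>n x, x\<rangle> = \<langle>U\<^sup>n y, y\<rangle>\<close> is a
  positive definite sequence, which makes \<open>\<Sum> c\<^sub>n \<langle>S\<^sub>n x, x\<rangle>\<close> nonnegative for a nonnegative
  \<open>\<Sum> c\<^sub>n z\<^sup>n\<close>. Conversely, positivity of \<open>\<phi>\<^sub>A\<close> on the Fejer kernels makes the operator kernel
  \<open>S\<^sub>m\<^sub>-\<^sub>n\<close>, hence also \<open>A\<^sup>-\<^sup>1\<^sup>/\<^sup>2 S\<^sub>m\<^sub>-\<^sub>n A\<^sup>-\<^sup>1\<^sup>/\<^sup>2\<close>, positive definite. The latter is the identity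
  for \<open>m = n\<close>, and the bilateral shift on its reproducing kernel Hilbert space is the dilation.
\<close>

section \<open>Averages over roots of unity\<close>

text \<open>Finite averages stand in for integrals: the mean of a trigonometric polynomial over the
  M-th roots of unity is its constant coefficient once M exceeds the absolute value of every
  frequency. The averages come out as \<open>L * X - Y\<close>, with X the wanted quantity and Y
  independent of L, so nonnegativity for all large L gives X \<ge> 0 by an Archimedean argument.

  The converse is shaped by the dilation space having to consist of vectors of the fixed type
  \<open>int => 'a\<close>. Quotients by null vectors and spaces of Cauchy sequences would change
  the type. Sending a finitely supported family to its kernel function \<open>ksum\<close> removes
  the null vectors and lands in \<open>int => 'a\<close>, and completing by pointwise limits stays
  there.

  Since \<open>sqrt_op\<close> is a \<open>SOME\<close> choice, a positive square root of the
  inverse of A must first be constructed. The inverse is bounded below, so after scaling a fixed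
  point iteration converges geometrically. For the root R, the identity R A R = I normalises the
  kernel, and surjectivity of R lets every test vector be written as R y.\<close>

lemma sum_roots_of_unity_powi:
  assumes "\<bar>n\<bar> < int M"
  shows "(\<Sum>k<M. cis (2 * pi * real k / real M) powi n) = (if n = 0 then of_nat M else 0)"
proof (cases "n = 0")
  case False
  define z where "z = cis (2 * pi * real_of_int n / real M)"
  have M: "M > 0" using assms by linarith
  \<comment> \<open>\<open>z = 1\<close> would make n a multiple of M, which 0 < |n| < M excludes.
    Hence the geometric sum of the powers of the M-th root of unity z vanishes.\<close>
  have "z \<noteq> 1"
  proof
    assume "z = 1"
    then obtain m :: int where m: "2 * pi * real_of_int n / real M = of_int m * (2 * pi)"
      by (auto simp: z_def complex_eq_iff cos_one_2pi_int)
    then have "real_of_int n = of_int m * real M" using M by (simp add: field_simps)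
    then have n: "n = m * int M"
      by (metis of_int_eq_iff of_int_mult of_int_of_nat_eq)
    then have "m \<noteq> 0" using False by auto
    then have "int M \<le> \<bar>n\<bar>" using M by (simp add: n abs_mult)
    then show False using assms by simp
  qed
  moreover have "z ^ M = 1"
  proof -
    have "z ^ M = cis (2 * pi * real_of_int n)" 
      using M unfolding z_def Complex.DeMoivre by simp
    then show ?thesis by (simp add: complex_eq_iff cos_int_2pin sin_int_2pin)
  qed
  moreover have "cis (2 * pi * real k / real M) powi n = z ^ k" for k
    by (simp add: z_def Complex.DeMoivre cis_power_int mult_ac)
  ultimately show ?thesis using False by (simp add: geometric_sum)
qed simp

text \<open>The triangular Fejer weights: for fixed j the only candidate is k = j - e, and it lies
  in [0, L) together with j exactly when max e 0 \<le> j < L + min e 0.\<close>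

lemma count_differences:
  assumes "\<bar>e\<bar> \<le> int L"
  shows "(\<Sum>j<L. \<Sum>k<L. if int j - int k = e then x else 0) = of_nat (nat (int L - \<bar>e\<bar>)) * (x :: complex)"
proof -
  have "(\<Sum>j<L. \<Sum>k<L. if int j - int k = e then x else 0)
      = (\<Sum>j<L. if j \<in> {nat e..<nat (int L + min e 0)} then x else 0)"
  proof (rule sum.cong)
    fix j assume j: "j \<in> {..<L}"
    have "(\<Sum>k<L. if int j - int k = e then x else 0)
        = (\<Sum>k<L. if k = nat (int j - e) then (if int j - e \<ge> 0 then x else 0) else 0)"
      by (intro sum.cong) auto
    then show "(\<Sum>k<L. if int j - int k = e then x else 0)
        = (if j \<in> {nat e..<nat (int L + min e 0)} then x else 0)"
      using j by (auto simp: min_def split: if_splits)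
  qed simp
  also have "\<dots> = (\<Sum>j\<in>{nat e..<nat (int L + min e 0)}. x)"
    using assms by (intro sum.mono_neutral_cong_right) auto
  also have "nat (int L + min e 0) - nat e = nat (int L - \<bar>e\<bar>)" by auto
  then have "(\<Sum>j\<in>{nat e..<nat (int L + min e 0)}. x) = of_nat (nat (int L - \<bar>e\<bar>)) * x" by simp
  finally show ?thesis .
qed

lemma nonneg_Reals_sum: "(\<And>i. i \<in> I \<Longrightarrow> f i \<in> \<real>\<^sub>\<ge>\<^sub>0) \<Longrightarrow> (\<Sum>i\<in>I. f i) \<in> (\<real>\<^sub>\<ge>\<^sub>0 :: complex set)"
  by (induction I rule: infinite_finite_induct) (auto intro: nonneg_Reals_add_I)

text \<open>Averaging the hypothesis over roots of unity keeps only the terms with j - k =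
  \<open>e i\<close>, each occurring L - |\<open>e i\<close>| times. The index set is arbitrary
  because the lemma serves both directions: i is a frequency of a trigonometric polynomial in one
  and a pair of kernel indices in the other.\<close>

lemma fejer_mean_nonneg:
  fixes e :: "'i \<Rightarrow> int" and \<beta> :: "'i \<Rightarrow> int \<Rightarrow> complex"
  assumes I: "finite I"
    and pos: "\<And>L \<omega>. \<omega> \<in> circle \<Longrightarrow>
      (\<Sum>i\<in>I. \<Sum>j<L. \<Sum>k<L. \<omega> powi (e i - (int j - int k)) * \<beta> i (int j - int k)) \<in> \<real>\<^sub>\<ge>\<^sub>0"
  shows "(\<Sum>i\<in>I. \<beta> i (e i)) \<in> \<real>\<^sub>\<ge>\<^sub>0"
proof -
  define D where "D = nat (\<Sum>i\<in>I. \<bar>e i\<bar>)"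
  have D: "\<bar>e i\<bar> \<le> int D" if "i \<in> I" for i
    using member_le_sum[OF that, of "\<lambda>i. \<bar>e i\<bar>"] I by (simp add: D_def sum_nonneg)
  define X where "X = (\<Sum>i\<in>I. \<beta> i (e i))"
  define Y where "Y = (\<Sum>i\<in>I. of_int \<bar>e i\<bar> * \<beta> i (e i))"
  have mean: "of_nat L * X - Y \<in> \<real>\<^sub>\<ge>\<^sub>0" if L: "D \<le> L" for L
  proof -
    \<comment> \<open>All exponents \<open>e i - (j - k)\<close> are smaller than D + L in absolute
      value, so with this order no nonzero exponent is mistaken for 0.\<close>
    define M where "M = L + D + 1"
    define \<omega> where "\<omega> k = cis (2 * pi * real k / real M)" for k
    let ?S = "\<Sum>r<M. \<Sum>i\<in>I. \<Sum>j<L. \<Sum>k<L.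
      \<omega> r powi (e i - (int j - int k)) * \<beta> i (int j - int k)"
    have "?S = (\<Sum>i\<in>I. \<Sum>j<L. \<Sum>k<L.
        (\<Sum>r<M. \<omega> r powi (e i - (int j - int k))) * \<beta> i (int j - int k))"
      unfolding sum_distrib_right
      apply (subst sum.swap, rule sum.cong[OF refl])
      apply (subst sum.swap, rule sum.cong[OF refl])
      apply (subst sum.swap, rule sum.cong[OF refl])
      by simp
    also have "\<dots> = (\<Sum>i\<in>I. \<Sum>j<L. \<Sum>k<L.
        if int j - int k = e i then of_nat M * \<beta> i (e i) else 0)"
    proof (intro sum.cong refl)
      fix i j k assume "i \<in> I" "j \<in> {..<L}" "k \<in> {..<L}"
      then have "\<bar>e i - (int j - int k)\<bar> < int M"
        using D[of i] by (auto simp: M_def)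
      from sum_roots_of_unity_powi[OF this]
      show "(\<Sum>r<M. \<omega> r powi (e i - (int j - int k))) * \<beta> i (int j - int k)
          = (if int j - int k = e i then of_nat M * \<beta> i (e i) else 0)"
        by (auto simp: \<omega>_def)
    qed
    also have "\<dots> = (\<Sum>i\<in>I. of_nat (nat (int L - \<bar>e i\<bar>)) * (of_nat M * \<beta> i (e i)))"
    proof (intro sum.cong refl count_differences)
      fix i assume "i \<in> I"
      then show "\<bar>e i\<bar> \<le> int L" using D[of i] L by linarith
    qed
    also have "\<dots> = of_nat M * (\<Sum>i\<in>I. (of_nat L - of_int \<bar>e i\<bar>) * \<beta> i (e i))"
      unfolding sum_distrib_left
    proof (intro sum.cong refl)
      fix i assume "i \<in> I"
      then have "\<bar>e i\<bar> \<le> int L" using D[of i] L by linarith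
      then have "(of_nat (nat (int L - \<bar>e i\<bar>)) :: complex) = of_int (int L - \<bar>e i\<bar>)"
        by (subst of_nat_nat) auto
      then show "of_nat (nat (int L - \<bar>e i\<bar>)) * (of_nat M * \<beta> i (e i))
          = of_nat M * ((of_nat L - of_int \<bar>e i\<bar>) * \<beta> i (e i))"
        by (simp add: mult_ac)
    qed
    also have "\<dots> = of_nat M * (of_nat L * X - Y)"
      by (simp add: X_def Y_def left_diff_distrib sum_subtractf sum_distrib_left)
    finally have S: "?S = of_nat M * (of_nat L * X - Y)" .
    have "?S \<in> \<real>\<^sub>\<ge>\<^sub>0" by (intro nonneg_Reals_sum pos) (simp add: \<omega>_def)
    then have "of_nat M * (of_nat L * X - Y) \<in> \<real>\<^sub>\<ge>\<^sub>0" by (simp only: S)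
    then show ?thesis
      by (simp add: complex_nonneg_Reals_iff M_def zero_le_mult_iff)
  qed
  \<comment> \<open>The numbers \<open>L * X - Y\<close> are real for two consecutive values of L,
    and their difference is X.\<close>
  have im: "Im X = 0"
    using mean[of D] mean[of "D + 1"] by (simp add: complex_nonneg_Reals_iff algebra_simps)
  \<comment> \<open>A negative real part would eventually push \<open>L * Re X\<close> below
    \<open>Re Y\<close>; taking L = n + D keeps L in the range where \<open>mean\<close>
    applies.\<close>
  have "Re X \<ge> 0"
  proof (rule ccontr)
    assume "\<not> ?thesis"
    then have neg: "- Re X > 0" by simp
    obtain n :: nat where n: "real n * (- Re X) > - Re Y"
      using reals_Archimedean3[OF neg] by blast
    have "real (n + D) * Re X - Re Y \<ge> 0"
      using mean[of "n + D"] by (simp add: complex_nonneg_Reals_iff)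
    moreover have "real D * Re X \<le> 0" using neg by (simp add: mult_nonneg_nonpos)
    ultimately show False using n by (simp add: algebra_simps)
  qed
  with im show ?thesis by (simp add: complex_nonneg_Reals_iff X_def)
qed

section \<open>Semi-inner product spaces\<close>

text \<open>Definiteness and completeness are left out so that the same estimates cover the Hilbert
  space itself, the form \<langle>T x, y\<rangle> of a positive operator T, the space of finitely
  supported families, and the completion while its axioms are still being verified.\<close>

locale semi_inner_space = vector_space "hscale V"
  for V :: "'v::ab_group_add hspace" +
  assumes subspace_vecs: "subspace (vecs V)"
    and inner_add: "\<lbrakk>x \<in> vecs V; y \<in> vecs V; z \<in> vecs V\<rbrakk>
          \<Longrightarrow> hinner V (x + y) z = hinner V x z + hinner V y z"
    and inner_scale: "\<lbrakk>x \<in> vecs V; y \<in> vecs V\<rbrakk>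
          \<Longrightarrow> hinner V (hscale V c x) y = c * hinner V x y"
    and inner_cnj: "\<lbrakk>x \<in> vecs V; y \<in> vecs V\<rbrakk> \<Longrightarrow> hinner V x y = cnj (hinner V y x)"
    and inner_nonneg: "x \<in> vecs V \<Longrightarrow> hinner V x x \<in> \<real>\<^sub>\<ge>\<^sub>0"
begin

lemma vecs_0 [simp]: "0 \<in> vecs V"
  using subspace_vecs by (rule subspace_0)

lemma vecs_add [simp]: "x \<in> vecs V \<Longrightarrow> y \<in> vecs V \<Longrightarrow> x + y \<in> vecs V"
  using subspace_vecs by (rule subspace_add)

lemma vecs_diff [simp]: "x \<in> vecs V \<Longrightarrow> y \<in> vecs V \<Longrightarrow> x - y \<in> vecs V"
  using subspace_vecs by (rule subspace_diff)

lemma vecs_scale [simp]: "x \<in> vecs V \<Longrightarrow> hscale V c x \<in> vecs V"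
  using subspace_vecs by (rule subspace_scale)

lemma inner_diff:
  "\<lbrakk>x \<in> vecs V; y \<in> vecs V; z \<in> vecs V\<rbrakk> \<Longrightarrow> hinner V (x - y) z = hinner V x z - hinner V y z"
  using inner_add[of "x - y" y z] by simp

lemma inner_add_right:
  "\<lbrakk>x \<in> vecs V; y \<in> vecs V; z \<in> vecs V\<rbrakk> \<Longrightarrow> hinner V z (x + y) = hinner V z x + hinner V z y"
  using inner_add[of x y z] inner_cnj[of z] by (metis complex_cnj_add vecs_add)

lemma inner_diff_right:
  "\<lbrakk>x \<in> vecs V; y \<in> vecs V; z \<in> vecs V\<rbrakk> \<Longrightarrow> hinner V z (x - y) = hinner V z x - hinner V z y"
  using inner_add_right[of "x - y" y z] by simp

lemma inner_scale_right:
  "\<lbrakk>x \<in> vecs V; y \<in> vecs V\<rbrakk> \<Longrightarrow> hinner V x (hscale V c y) = cnj c * hinner V x y"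
  using inner_scale[of y x c] inner_cnj[of x] by (metis complex_cnj_mult vecs_scale)

lemma Re_inner_nonneg: "x \<in> vecs V \<Longrightarrow> 0 \<le> Re (hinner V x x)"
  using inner_nonneg[of x] by (simp add: complex_nonneg_Reals_iff)

lemma hnorm_sq: "x \<in> vecs V \<Longrightarrow> (hnorm V x)\<^sup>2 = Re (hinner V x x)"
  by (simp add: hnorm_def Re_inner_nonneg)

lemma hnorm_nonneg [simp]: "x \<in> vecs V \<Longrightarrow> 0 \<le> hnorm V x"
  by (simp add: hnorm_def Re_inner_nonneg)

lemma inner_self: "x \<in> vecs V \<Longrightarrow> hinner V x x = of_real ((hnorm V x)\<^sup>2)"
  using inner_nonneg[of x] by (simp add: hnorm_sq complex_nonneg_Reals_iff complex_eq_iff)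

text \<open>Cauchy-Schwarz from the nonnegativity of the form at x - t c y, where c = \<langle>x,
  y\<rangle> and t is real. The optimal t is the inverse of the squared norm of y; a null vector y
  needs a separate choice because the form may be degenerate.\<close>

lemma norm_inner_le:
  assumes x: "x \<in> vecs V" and y: "y \<in> vecs V"
  shows "norm (hinner V x y) \<le> hnorm V x * hnorm V y"
proof -
  define c where "c = hinner V x y"
  have expand: "0 \<le> (hnorm V x)\<^sup>2 - 2 * t * (norm c)\<^sup>2 + t\<^sup>2 * (norm c)\<^sup>2 * (hnorm V y)\<^sup>2" for t :: real
  proof -
    let ?w = "hscale V (of_real t * c) y"
    have yx: "hinner V y x = cnj c" using inner_cnj[OF y x] by (simp add: c_def)
    have cc: "c * cnj c = of_real ((norm c)\<^sup>2)" by (simp only: complex_norm_square)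
    have "hinner V (x - ?w) (x - ?w)
        = hinner V x x - of_real t * (c * cnj c) - of_real t * (c * cnj c)
          + of_real (t\<^sup>2) * (c * cnj c) * hinner V y y"
      using x y yx by (simp add: inner_diff inner_diff_right inner_scale inner_scale_right
          c_def[symmetric] algebra_simps power2_eq_square)
    also have "\<dots> = of_real ((hnorm V x)\<^sup>2 - 2 * t * (norm c)\<^sup>2 + t\<^sup>2 * (norm c)\<^sup>2 * (hnorm V y)\<^sup>2)"
      unfolding cc using x y by (simp add: inner_self)
    finally show ?thesis using Re_inner_nonneg[of "x - ?w"] x y by simp
  qed
  have "(norm c)\<^sup>2 \<le> (hnorm V x)\<^sup>2 * (hnorm V y)\<^sup>2"
  proof (cases "hnorm V y = 0")
    case True
    have "norm c = 0"
    proof (rule ccontr)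
      assume "norm c \<noteq> 0"
      \<comment> \<open>This t makes the right-hand side of \<open>expand\<close> equal to -1, since
        the quadratic term vanishes with the norm of y.\<close>
      then show False
        using expand[of "((hnorm V x)\<^sup>2 + 1) / (2 * (norm c)\<^sup>2)"] True by (simp add: field_simps)
    qed
    then show ?thesis using True by simp
  next
    case False
    then have p: "(hnorm V y)\<^sup>2 > 0" by simp
    have "0 \<le> (hnorm V x)\<^sup>2 - (norm c)\<^sup>2 / (hnorm V y)\<^sup>2"
      using expand[of "1 / (hnorm V y)\<^sup>2"] False by (simp add: field_simps power2_eq_square)
    then show ?thesis using p by (simp add: field_simps)
  qed
  then have "(norm c)\<^sup>2 \<le> (hnorm V x * hnorm V y)\<^sup>2" by (simp add: power_mult_distrib)
  then show ?thesis
    unfolding c_def using x y by (elim power2_le_imp_le) simp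
qed

lemma hnorm_triangle:
  assumes x: "x \<in> vecs V" and y: "y \<in> vecs V"
  shows "hnorm V (x + y) \<le> hnorm V x + hnorm V y"
proof -
  have "(hnorm V (x + y))\<^sup>2 = (hnorm V x)\<^sup>2 + (hnorm V y)\<^sup>2 + 2 * Re (hinner V x y)"
    using x y inner_cnj[OF y x] by (simp add: hnorm_sq inner_add inner_add_right)
  also have "\<dots> \<le> (hnorm V x + hnorm V y)\<^sup>2"
    using norm_inner_le[OF x y] complex_Re_le_cmod[of "hinner V x y"] by (simp add: power2_sum)
  finally show ?thesis by (rule power2_le_imp_le) (use x y in simp)
qed

lemma hnorm_scale: "x \<in> vecs V \<Longrightarrow> hnorm V (hscale V c x) = norm c * hnorm V x"
proof -
  assume x: "x \<in> vecs V"
  have "hinner V (hscale V c x) (hscale V c x) = (c * cnj c) * hinner V x x"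
    using x by (simp add: inner_scale inner_scale_right)
  then have "Re (hinner V (hscale V c x) (hscale V c x)) = (norm c)\<^sup>2 * Re (hinner V x x)"
    by (simp add: complex_norm_square[symmetric] del: of_real_power add: of_real_power[symmetric])
  then show ?thesis by (simp add: hnorm_def real_sqrt_mult)
qed

lemma hnorm_minus_commute: "x \<in> vecs V \<Longrightarrow> y \<in> vecs V \<Longrightarrow> hnorm V (x - y) = hnorm V (y - x)"
  using hnorm_scale[of "y - x" "-1"] by simp

lemma hnorm_triangle_diff:
  "\<lbrakk>x \<in> vecs V; y \<in> vecs V; z \<in> vecs V\<rbrakk> \<Longrightarrow> hnorm V (x - z) \<le> hnorm V (x - y) + hnorm V (y - z)"
  using hnorm_triangle[of "x - y" "y - z"] by simp

lemma hnorm_triangle_rev: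
  "\<lbrakk>x \<in> vecs V; y \<in> vecs V\<rbrakk> \<Longrightarrow> \<bar>hnorm V x - hnorm V y\<bar> \<le> hnorm V (x - y)"
  using hnorm_triangle[of "x - y" y] hnorm_triangle[of "y - x" x] hnorm_minus_commute[of x y] by simp

lemma inner_sum_left:
  "(\<And>i. i \<in> I \<Longrightarrow> f i \<in> vecs V) \<Longrightarrow> y \<in> vecs V
    \<Longrightarrow> hinner V (\<Sum>i\<in>I. f i) y = (\<Sum>i\<in>I. hinner V (f i) y)"
proof (induction I rule: infinite_finite_induct)
  case (insert i I)
  then show ?case using subspace_sum[OF subspace_vecs, of I f] by (simp add: inner_add)
qed (use inner_scale[of 0 _ 0] in simp_all)

lemma inner_sum_right:
  "(\<And>i. i \<in> I \<Longrightarrow> f i \<in> vecs V) \<Longrightarrow> y \<in> vecs V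
    \<Longrightarrow> hinner V y (\<Sum>i\<in>I. f i) = (\<Sum>i\<in>I. hinner V y (f i))"
  using inner_sum_left[of I f y] inner_cnj[of y "\<Sum>i\<in>I. f i"] inner_cnj[of y]
    subspace_sum[OF subspace_vecs, of I f] by simp

lemma tendsto_hnorm:
  assumes "\<And>n. X n \<in> vecs V" "l \<in> vecs V" "(\<lambda>n. hnorm V (X n - l)) \<longlonglongrightarrow> 0"
  shows "(\<lambda>n. hnorm V (X n)) \<longlonglongrightarrow> hnorm V l"
  by (rule LIM_zero_cancel, rule Lim_null_comparison[OF _ assms(3)])
    (use assms hnorm_triangle_rev in auto)

lemma tendsto_inner:
  assumes X: "\<And>n. X n \<in> vecs V" "l \<in> vecs V" "(\<lambda>n. hnorm V (X n - l)) \<longlonglongrightarrow> 0"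
    and Y: "\<And>n. Y n \<in> vecs V" "m \<in> vecs V" "(\<lambda>n. hnorm V (Y n - m)) \<longlonglongrightarrow> 0"
  shows "(\<lambda>n. hinner V (X n) (Y n)) \<longlonglongrightarrow> hinner V l m"
proof (rule LIM_zero_cancel, rule Lim_null_comparison)
  show "\<forall>\<^sub>F n in sequentially. norm (hinner V (X n) (Y n) - hinner V l m)
      \<le> hnorm V (X n - l) * hnorm V (Y n) + hnorm V l * hnorm V (Y n - m)"
  proof (intro always_eventually allI)
    fix n
    have "hinner V (X n) (Y n) - hinner V l m = hinner V (X n - l) (Y n) + hinner V l (Y n - m)"
      using X Y by (simp add: inner_diff inner_diff_right)
    also have "norm \<dots> \<le> norm (hinner V (X n - l) (Y n)) + norm (hinner V l (Y n - m))"
      by (rule norm_triangle_ineq)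
    also have "\<dots> \<le> hnorm V (X n - l) * hnorm V (Y n) + hnorm V l * hnorm V (Y n - m)"
      using X Y by (intro add_mono norm_inner_le) auto
    finally show "norm (hinner V (X n) (Y n) - hinner V l m)
      \<le> hnorm V (X n - l) * hnorm V (Y n) + hnorm V l * hnorm V (Y n - m)" .
  qed
  have "(\<lambda>n. hnorm V (X n - l) * hnorm V (Y n) + hnorm V l * hnorm V (Y n - m))
      \<longlonglongrightarrow> 0 * hnorm V m + hnorm V l * 0"
    using X Y by (intro tendsto_intros tendsto_hnorm) auto
  then show "(\<lambda>n. hnorm V (X n - l) * hnorm V (Y n) + hnorm V l * hnorm V (Y n - m)) \<longlonglongrightarrow> 0"
    by simp
qed

end

context complex_hilbert_space
begin

lemma semi_inner_space: "semi_inner_space H"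
  by unfold_locales (fact subspace_vecs inner_add inner_scale inner_cnj inner_nonneg)+

lemmas inner_sum_left = semi_inner_space.inner_sum_left[OF semi_inner_space]
  and inner_sum_right = semi_inner_space.inner_sum_right[OF semi_inner_space]
  and tendsto_inner = semi_inner_space.tendsto_inner[OF semi_inner_space]
  and tendsto_hnorm = semi_inner_space.tendsto_hnorm[OF semi_inner_space]
  and hnorm_triangle_diff = semi_inner_space.hnorm_triangle_diff[OF semi_inner_space]
  and hnorm_minus_commute = semi_inner_space.hnorm_minus_commute[OF semi_inner_space]

lemma inner_0_left [simp]: "x \<in> vecs H \<Longrightarrow> hinner H 0 x = 0"
  using inner_scale[of 0 x 0] by simp

lemma hnorm_0 [simp]: "hnorm H 0 = 0"
  by (simp add: hnorm_def)

lemma hnorm_eq_0_iff: "x \<in> vecs H \<Longrightarrow> hnorm H x = 0 \<longleftrightarrow> x = 0"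
  using inner_definite[of x] by (auto simp: inner_self)

text \<open>Telescoping bounds each tail by \<open>C * q ^ n / (1 - q)\<close>. The lemma is applied
  vector by vector in the square root iteration, because operators are plain functions here and form
  no normed space.\<close>

lemma geometric_steps_converge:
  assumes X: "\<And>n. X n \<in> vecs H" and q: "0 \<le> q" "q < 1"
    and step: "\<And>n. hnorm H (X (Suc n) - X n) \<le> C * q ^ n"
  shows "\<exists>l\<in>vecs H. (\<lambda>n. hnorm H (X n - l)) \<longlonglongrightarrow> 0"
proof (rule complete)
  have C: "0 \<le> C" using step[of 0] hnorm_nonneg[of "X (Suc 0) - X 0"] X by simp
  have tail: "hnorm H (X (n + k) - X n) \<le> C * q ^ n / (1 - q)" for n k
  proof -
    have "hnorm H (X (n + k) - X n) \<le> C * q ^ n * (\<Sum>i<k. q ^ i)"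
    proof (induction k)
      case (Suc k)
      then show ?case
        using hnorm_triangle_diff[of "X (n + Suc k)" "X (n + k)" "X n"] step[of "n + k"] X
        by (simp add: power_add algebra_simps)
    qed simp
    also have "(\<Sum>i<k. q ^ i) \<le> 1 / (1 - q)"
      using q by (simp add: sum_gp_strict divide_right_mono)
    finally show ?thesis using C q by (simp add: mult_left_mono)
  qed
  fix e :: real assume e: "e > 0"
  have "(\<lambda>n. C * q ^ n / (1 - q)) \<longlonglongrightarrow> C * 0 / (1 - q)"
    using q by (intro tendsto_intros LIMSEQ_realpow_zero) auto
  then have "\<forall>\<^sub>F n in sequentially. C * q ^ n / (1 - q) < e / 2"
    by (rule order_tendstoD(2)) (use e in simp)
  then obtain N where N: "C * q ^ N / (1 - q) < e / 2"
    by (auto simp: eventually_sequentially)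
  have near: "hnorm H (X m - X N) < e / 2" if "m \<ge> N" for m
    using order_le_less_trans[OF tail[of N "m - N"] N] that by simp
  have "hnorm H (X m - X n) < e" if "m \<ge> N" "n \<ge> N" for m n
    using near[OF that(1)] near[OF that(2)] hnorm_triangle_diff[of "X m" "X N" "X n"]
      hnorm_minus_commute[of "X N" "X n"] X by simp
  then show "\<exists>N. \<forall>m\<ge>N. \<forall>n\<ge>N. hnorm H (X m - X n) < e" by blast
qed (rule X)

end

section \<open>Positive square roots\<close>

context complex_hilbert_space
begin

lemma bounded_op_add_eq: "\<lbrakk>bounded_op H T; x \<in> vecs H; y \<in> vecs H\<rbrakk> \<Longrightarrow> T (x + y) = T x + T y"
  by (simp add: bounded_op_def)

lemma bounded_op_scale_eq: "\<lbrakk>bounded_op H T; x \<in> vecs H\<rbrakk> \<Longrightarrow> T (hscale H c x) = hscale H c (T x)"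
  by (simp add: bounded_op_def)

lemma bounded_op_diff_eq: "\<lbrakk>bounded_op H T; x \<in> vecs H; y \<in> vecs H\<rbrakk> \<Longrightarrow> T (x - y) = T x - T y"
  using bounded_op_add_eq[of T "x - y" y] by simp

lemma bounded_op_bound:
  assumes "bounded_op H T"
  obtains C where "C > 0" "\<And>x. x \<in> vecs H \<Longrightarrow> hnorm H (T x) \<le> C * hnorm H x"
proof -
  from assms obtain C where C: "\<And>x. x \<in> vecs H \<Longrightarrow> hnorm H (T x) \<le> C * hnorm H x"
    unfolding bounded_op_def by blast
  have "hnorm H (T x) \<le> (\<bar>C\<bar> + 1) * hnorm H x" if "x \<in> vecs H" for x
    using C[OF that] hnorm_nonneg[OF that] mult_right_mono[of C "\<bar>C\<bar> + 1" "hnorm H x"] by linarith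
  then show thesis by (intro that[of "\<bar>C\<bar> + 1"]) auto
qed

text \<open>Polarisation: the quadratic form is real at x + y, which fixes the imaginary parts, and
  at x + i y, which fixes the real parts.\<close>

lemma positive_op_selfadjoint:
  assumes T: "positive_op H T" and x: "x \<in> vecs H" and y: "y \<in> vecs H"
  shows "hinner H (T x) y = hinner H x (T y)"
proof -
  have b: "bounded_op H T" and real: "\<And>u. u \<in> vecs H \<Longrightarrow> Im (hinner H (T u) u) = 0"
    using T by (auto simp: positive_op_def complex_nonneg_Reals_iff)
  have Txy: "T x \<in> vecs H" "T y \<in> vecs H" using b x y by (auto intro: bounded_op_vecs)
  have "Im (hinner H (T x) y) + Im (hinner H (T y) x) = 0"
    using real[of "x + y"] real[of x] real[of y] x y Txy
    by (simp add: bounded_op_add_eq[OF b] inner_add inner_add_right)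
  moreover have "Re (hinner H (T y) x) = Re (hinner H (T x) y)"
    using real[of "x + hscale H \<i> y"] real[of x] real[of y] x y Txy
    by (simp add: bounded_op_add_eq[OF b] bounded_op_scale_eq[OF b] inner_add inner_add_right
        inner_scale inner_scale_right)
  ultimately have "hinner H (T x) y = cnj (hinner H (T y) x)" by (simp add: complex_eq_iff)
  then show ?thesis using inner_cnj[of x "T y"] x Txy by simp
qed

lemma positive_op_semi_inner_space:
  assumes "positive_op H T"
  shows "semi_inner_space (H\<lparr>hinner := \<lambda>x y. hinner H (T x) y\<rparr>)"
proof -
  have b: "bounded_op H T" using assms by (simp add: positive_op_def)
  show ?thesis
  proof
    fix x y assume "x \<in> vecs (H\<lparr>hinner := \<lambda>x y. hinner H (T x) y\<rparr>)"
      "y \<in> vecs (H\<lparr>hinner := \<lambda>x y. hinner H (T x) y\<rparr>)"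
    then show "hinner (H\<lparr>hinner := \<lambda>x y. hinner H (T x) y\<rparr>) x y
        = cnj (hinner (H\<lparr>hinner := \<lambda>x y. hinner H (T x) y\<rparr>) y x)"
      using positive_op_selfadjoint[OF assms, of x y] inner_cnj[of x "T y"] bounded_op_vecs[OF b]
      by simp
  qed (use assms b subspace_vecs in \<open>auto simp: positive_op_def bounded_op_vecs bounded_op_add_eq
      bounded_op_scale_eq inner_add inner_scale scale_right_distrib scale_left_distrib\<close>)
qed

lemma positive_op_Cauchy_Schwarz:
  assumes T: "positive_op H T" and x: "x \<in> vecs H" and y: "y \<in> vecs H"
  shows "(norm (hinner H (T x) y))\<^sup>2 \<le> Re (hinner H (T x) x) * Re (hinner H (T y) y)"
proof -
  have nonneg: "0 \<le> Re (hinner H (T u) u)" if "u \<in> vecs H" for u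
    using T that by (auto simp: positive_op_def complex_nonneg_Reals_iff)
  have "norm (hinner H (T x) y) \<le> sqrt (Re (hinner H (T x) x)) * sqrt (Re (hinner H (T y) y))"
    using semi_inner_space.norm_inner_le[OF positive_op_semi_inner_space[OF T], of x y] x y
    by (simp add: hnorm_def)
  then have "(norm (hinner H (T x) y))\<^sup>2
      \<le> (sqrt (Re (hinner H (T x) x)) * sqrt (Re (hinner H (T y) y)))\<^sup>2"
    by (rule power_mono) simp
  then show ?thesis using nonneg x y by (simp add: power_mult_distrib)
qed

text \<open>Cauchy-Schwarz for the form of T at the vectors x and T x bounds the fourth power of the
  norm of T x by q |x|^2 times q |T x|^2, and two factors cancel.\<close>

lemma positive_op_norm_le:
  assumes T: "positive_op H T" and x: "x \<in> vecs H"
    and q: "\<And>u. u \<in> vecs H \<Longrightarrow> Re (hinner H (T u) u) \<le> q * (hnorm H u)\<^sup>2"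
  shows "hnorm H (T x) \<le> q * hnorm H x"
proof -
  have Tx: "T x \<in> vecs H" using T x by (auto simp: positive_op_def bounded_op_vecs)
  have nonneg: "0 \<le> Re (hinner H (T u) u)" if "u \<in> vecs H" for u
    using T that by (auto simp: positive_op_def complex_nonneg_Reals_iff)
  let ?n = "hnorm H (T x)"
  have "(?n\<^sup>2)\<^sup>2 = (norm (hinner H (T x) (T x)))\<^sup>2"
    using Tx by (simp add: inner_self norm_power)
  also have "\<dots> \<le> Re (hinner H (T x) x) * Re (hinner H (T (T x)) (T x))"
    using T x Tx by (rule positive_op_Cauchy_Schwarz)
  also have "\<dots> \<le> (q * (hnorm H x)\<^sup>2) * (q * ?n\<^sup>2)"
    using q[OF x] q[OF Tx] nonneg[OF x] nonneg[OF Tx] by (intro mult_mono) auto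
  finally have *: "?n\<^sup>2 * ?n\<^sup>2 \<le> (q * hnorm H x)\<^sup>2 * ?n\<^sup>2"
    by (simp add: power2_eq_square mult_ac)
  show ?thesis
  proof (cases "x = 0 \<or> ?n = 0")
    case True
    have "0 \<le> q * hnorm H x"
    proof (cases "x = 0")
      case False
      have "0 \<le> q * (hnorm H x)\<^sup>2" using q[OF x] nonneg[OF x] by linarith
      moreover have "0 < hnorm H x" using False hnorm_eq_0_iff[OF x] hnorm_nonneg[OF x] by linarith
      ultimately show ?thesis by (simp add: zero_le_mult_iff)
    qed simp
    moreover have "T 0 = 0" using bounded_op_scale_eq[of T 0 0] T by (simp add: positive_op_def)
    ultimately show ?thesis using True by auto
  next
    case False
    then have "?n\<^sup>2 > 0" by simp
    with * have "?n\<^sup>2 \<le> (q * hnorm H x)\<^sup>2" by (rule mult_right_le_imp_le)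
    moreover have "0 \<le> q * hnorm H x"
    proof -
      have "0 \<le> q * (hnorm H x)\<^sup>2" using q[OF x] nonneg[OF x] by linarith
      moreover have "0 < hnorm H x" using False hnorm_eq_0_iff[OF x] hnorm_nonneg[OF x] by auto
      ultimately show ?thesis by (simp add: zero_le_mult_iff)
    qed
    ultimately show ?thesis by (rule power2_le_imp_le)
  qed
qed

text \<open>\<open>I - Y\<close> is the positive square root of \<open>I - B\<close>; the map sending \<open>Y\<close> to \<open>(B + Y\<^sup>2) / 2\<close> is a
  contraction of the operators of norm at most \<open>q\<close>.\<close>

lemma sqrt_iteration:
  assumes B: "bounded_op H B"
    and sa: "\<And>x y. \<lbrakk>x \<in> vecs H; y \<in> vecs H\<rbrakk> \<Longrightarrow> hinner H (B x) y = hinner H x (B y)"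
    and q: "0 \<le> q" "q < 1" and Bq: "\<And>x. x \<in> vecs H \<Longrightarrow> hnorm H (B x) \<le> q * hnorm H x"
  obtains Y where "bounded_op H Y"
    and "\<And>x y. \<lbrakk>x \<in> vecs H; y \<in> vecs H\<rbrakk> \<Longrightarrow> hinner H (Y x) y = hinner H x (Y y)"
    and "\<And>x. x \<in> vecs H \<Longrightarrow> hnorm H (Y x) \<le> q * hnorm H x"
    and "\<And>x. x \<in> vecs H \<Longrightarrow> hscale H 2 (Y x) = B x + Y (Y x)"
proof -
  define F where "F = rec_nat (\<lambda>x. 0) (\<lambda>n Y x. hscale H (1/2) (B x + Y (Y x)))"
  have F0: "F 0 = (\<lambda>x. 0)" and FS: "F (Suc n) = (\<lambda>x. hscale H (1/2) (B x + F n (F n x)))" for n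
    by (simp_all add: F_def)
  have Fb: "bounded_op H (F n)" for n
  proof (induction n)
    case 0
    then show ?case by (simp add: F0 bounded_op_zero)
  next
    case (Suc n)
    from bounded_op_scale[OF bounded_op_add[OF B bounded_op_compose[OF Suc Suc]]]
    show ?case unfolding FS .
  qed
  note Fv = bounded_op_vecs[OF Fb] and Bv = bounded_op_vecs[OF B]
  have Fq: "hnorm H (F n x) \<le> q * hnorm H x" if "x \<in> vecs H" for n x
    using that
  proof (induction n arbitrary: x)
    case 0
    then show ?case using q by (simp add: F0 hnorm_nonneg)
  next
    case (Suc n)
    have "hnorm H (F n (F n x)) \<le> q * (q * hnorm H x)"
      using Suc.IH[OF Suc.prems] Suc.IH[OF Fv[OF Suc.prems]] q by (meson mult_left_mono order_trans)
    also have "\<dots> \<le> q * hnorm H x"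
      using q hnorm_nonneg[OF Suc.prems] by (intro mult_left_le_one_le) simp_all
    finally have "hnorm H (B x + F n (F n x)) \<le> 2 * (q * hnorm H x)"
      using hnorm_triangle[of "B x" "F n (F n x)"] Bq[OF Suc.prems] Suc.prems Bv Fv by simp
    then show ?case using Suc.prems Bv Fv by (simp add: FS hnorm_scale)
  qed
  have Fsa: "hinner H (F n x) y = hinner H x (F n y)" if "x \<in> vecs H" "y \<in> vecs H" for n x y
    using that
  proof (induction n arbitrary: x y)
    case 0
    then show ?case using inner_cnj[of x 0] by (simp add: F0)
  next
    case (Suc n)
    then show ?case using sa Bv Fv by (simp add: FS inner_scale inner_scale_right inner_add inner_add_right)
  qed
  \<comment> \<open>With G = F (n+1) and F = F n, the difference of squares is G (G - F) + (G - F)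
    F. Each summand gains a factor q from the norm bound, and the factor 1/2 of the iteration
    absorbs that there are two of them.\<close>
  have step: "hnorm H (F (Suc n) x - F n x) \<le> q ^ Suc n * hnorm H x" if "x \<in> vecs H" for n x
    using that
  proof (induction n arbitrary: x)
    case 0
    have "hnorm H (F (Suc 0) x - F 0 x) = hnorm H (B x) / 2"
      using 0 Bv by (simp add: FS F0 hnorm_scale)
    also have "\<dots> \<le> q * hnorm H x"
      using Bq[OF 0] hnorm_nonneg[of "B x"] Bv[OF 0] by simp
    finally show ?case by simp
  next
    case (Suc n)
    note x = Suc.prems
    let ?d = "F (Suc n) x - F n x"
    have d: "?d \<in> vecs H" using x Fv by simp
    have "F (Suc (Suc n)) x - F (Suc n) x
        = hscale H (1/2) ((F (Suc n) (F (Suc n) x)) - F n (F n x))"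
      unfolding FS[of "Suc n"] by (subst (2) FS) (simp add: scale_right_diff_distrib[symmetric])
    also have "F (Suc n) (F (Suc n) x) - F n (F n x)
        = F (Suc n) ?d + (F (Suc n) (F n x) - F n (F n x))"
      using x Fv by (simp add: bounded_op_diff_eq[OF Fb])
    finally have "hnorm H (F (Suc (Suc n)) x - F (Suc n) x)
        = hnorm H (F (Suc n) ?d + (F (Suc n) (F n x) - F n (F n x))) / 2"
      using x d Fv by (simp add: hnorm_scale)
    also have "\<dots> \<le> (hnorm H (F (Suc n) ?d) + hnorm H (F (Suc n) (F n x) - F n (F n x))) / 2"
      using hnorm_triangle[of "F (Suc n) ?d" "F (Suc n) (F n x) - F n (F n x)"] x d Fv
      by (intro divide_right_mono) simp_all
    also have "\<dots> \<le> (q * (q ^ Suc n * hnorm H x) + q ^ Suc n * (q * hnorm H x)) / 2"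
    proof (intro divide_right_mono add_mono)
      show "hnorm H (F (Suc n) ?d) \<le> q * (q ^ Suc n * hnorm H x)"
        using Fq[OF d, of "Suc n"] Suc.IH[OF x] q by (meson mult_left_mono order_trans)
      show "hnorm H (F (Suc n) (F n x) - F n (F n x)) \<le> q ^ Suc n * (q * hnorm H x)"
        using Suc.IH[OF Fv[OF x]] Fq[OF x, of n] q by (meson mult_left_mono order_trans zero_le_power)
    qed simp
    also have "\<dots> = q ^ Suc (Suc n) * hnorm H x" by simp
    finally show ?case .
  qed
  have "\<exists>l. l \<in> vecs H \<and> (\<lambda>n. hnorm H (F n x - l)) \<longlonglongrightarrow> 0" if x: "x \<in> vecs H" for x
    using geometric_steps_converge[of "\<lambda>n. F n x" q "q * hnorm H x"] Fv[OF x] q step[OF x]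
    by (auto simp: mult_ac)
  then obtain Y where Y: "\<And>x. x \<in> vecs H \<Longrightarrow> Y x \<in> vecs H"
    and lim: "\<And>x. x \<in> vecs H \<Longrightarrow> (\<lambda>n. hnorm H (F n x - Y x)) \<longlonglongrightarrow> 0"
    by metis
  have inn: "(\<lambda>n. hinner H (F n x) y) \<longlonglongrightarrow> hinner H (Y x) y" if "x \<in> vecs H" "y \<in> vecs H" for x y
    using tendsto_inner[of "\<lambda>n. F n x" "Y x" "\<lambda>n. y" y] that Fv Y lim by simp
  have eqI: "u = v" if "u \<in> vecs H" "v \<in> vecs H" "\<And>y. y \<in> vecs H \<Longrightarrow> hinner H u y = hinner H v y" for u v
    using inner_definite[of "u - v"] that by (simp add: inner_diff)
  have Yq: "hnorm H (Y x) \<le> q * hnorm H x" if "x \<in> vecs H" for x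
    using tendsto_hnorm[of "\<lambda>n. F n x" "Y x"] that Fv Y lim Fq
    by (intro LIMSEQ_le_const2[where X = "\<lambda>n. hnorm H (F n x)"]) auto
  have Ysa: "hinner H (Y x) y = hinner H x (Y y)" if xy: "x \<in> vecs H" "y \<in> vecs H" for x y
  proof (rule LIMSEQ_unique[OF inn[OF xy]])
    show "(\<lambda>n. hinner H (F n x) y) \<longlonglongrightarrow> hinner H x (Y y)"
      using tendsto_inner[of "\<lambda>n. x" x "\<lambda>n. F n y" "Y y"] xy Fv Y lim by (simp add: Fsa)
  qed
  \<comment> \<open>A symmetric map is linear: tested against any vector, Y moves to the other side
    of the inner product, where linearity in x is evident.\<close>
  have Yadd: "Y (x + y) = Y x + Y y" if "x \<in> vecs H" "y \<in> vecs H" for x y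
    by (rule eqI) (use that Y Ysa in \<open>simp_all add: inner_add\<close>)
  have Yscale: "Y (hscale H c x) = hscale H c (Y x)" if "x \<in> vecs H" for c x
    by (rule eqI) (use that Y Ysa in \<open>simp_all add: inner_scale\<close>)
  \<comment> \<open>Only pointwise convergence of the iterates is known. Symmetry rewrites
    \<langle>F n (F n x), y\<rangle> as \<langle>F n x, F n y\<rangle>, to which it applies in both
    arguments.\<close>
  have Yfix: "hscale H 2 (Y x) = B x + Y (Y x)" if x: "x \<in> vecs H" for x
  proof (rule eqI)
    fix y assume y: "y \<in> vecs H"
    have "(\<lambda>n. hinner H (hscale H 2 (F (Suc n) x)) y) \<longlonglongrightarrow> 2 * hinner H (Y x) y"
      using LIMSEQ_Suc[OF inn[OF x y]] x y Fv by (simp add: inner_scale tendsto_mult_left)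
    moreover have "hinner H (hscale H 2 (F (Suc n) x)) y = hinner H (B x) y + hinner H (F n x) (F n y)" for n
      using x y Fv Bv by (simp add: FS inner_scale inner_add Fsa)
    moreover have "(\<lambda>n. hinner H (B x) y + hinner H (F n x) (F n y))
        \<longlonglongrightarrow> hinner H (B x) y + hinner H (Y x) (Y y)"
      using x y Fv Y lim by (intro tendsto_intros tendsto_inner) auto
    ultimately have "2 * hinner H (Y x) y = hinner H (B x) y + hinner H (Y x) (Y y)"
      by (simp add: LIMSEQ_unique)
    then show "hinner H (hscale H 2 (Y x)) y = hinner H (B x + Y (Y x)) y"
      using x y Y Bv by (simp add: inner_scale inner_add Ysa)
  qed (use x Y Bv in auto)
  have "bounded_op H Y"
    unfolding bounded_op_def using Y Yadd Yscale Yq by blast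
  then show thesis using Ysa Yq Yfix by (rule that)
qed

text \<open>With B = I - A / c, the iteration yields Y with 2 Y = B + Y^2, so (I - Y)^2 = I - B = A
  / c, and R = sqrt c (I - Y) is a root. The lower bound \<delta> on A is what makes the norm of B
  strictly less than 1.\<close>

lemma positive_sqrt_exists:
  assumes A: "positive_op H A" and \<delta>: "\<delta> > 0"
    and lower: "\<And>x. x \<in> vecs H \<Longrightarrow> \<delta> * (hnorm H x)\<^sup>2 \<le> Re (hinner H (A x) x)"
  shows "\<exists>R. positive_op H R \<and> (\<forall>x\<in>vecs H. R (R x) = A x)"
proof -
  have Ab: "bounded_op H A" using A by (simp add: positive_op_def)
  note Av = bounded_op_vecs[OF Ab]
  obtain C where C: "C > 0" "\<And>x. x \<in> vecs H \<Longrightarrow> hnorm H (A x) \<le> C * hnorm H x"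
    using bounded_op_bound[OF Ab] by blast
  \<comment> \<open>Adding \<delta> to the norm bound C ensures both A \<le> c and q = 1 - \<delta>
    / c = C / (C + \<delta>) in (0, 1).\<close>
  define c where "c = C + \<delta>"
  have c: "c > 0" using C \<delta> by (simp add: c_def)
  have upper: "Re (hinner H (A x) x) \<le> c * (hnorm H x)\<^sup>2" if x: "x \<in> vecs H" for x
  proof -
    have "Re (hinner H (A x) x) \<le> hnorm H (A x) * hnorm H x" using x Av by (intro Re_inner_le) auto
    also have "\<dots> \<le> C * hnorm H x * hnorm H x"
      using C(2)[OF x] x by (intro mult_right_mono) (auto simp: hnorm_nonneg)
    also have "\<dots> \<le> c * (hnorm H x)\<^sup>2"
      using \<delta> by (simp add: c_def power2_eq_square mult_right_mono algebra_simps)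
    finally show ?thesis .
  qed
  define B where "B x = x + hscale H (- of_real (1 / c)) (A x)" for x
  define q where "q = 1 - \<delta> / c"
  have q: "0 \<le> q" "q < 1" using C \<delta> by (auto simp: q_def c_def field_simps)
  have Bb: "bounded_op H B"
    unfolding B_def by (intro bounded_op_add bounded_op_id bounded_op_scale Ab)
  have Bform: "hinner H (B x) x = of_real ((hnorm H x)\<^sup>2 - Re (hinner H (A x) x) / c)"
    if x: "x \<in> vecs H" for x
  proof -
    obtain r where "hinner H (A x) x = of_real r"
      using A x by (auto simp: positive_op_def elim!: nonneg_Reals_cases)
    then show ?thesis using x Av by (simp add: B_def inner_diff inner_scale inner_self)
  qed
  have Bpos: "positive_op H B"
    unfolding positive_op_def using Bb upper c
    by (auto simp: Bform complex_nonneg_Reals_iff field_simps)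
  have Bq: "hnorm H (B x) \<le> q * hnorm H x" if x: "x \<in> vecs H" for x
  proof (rule positive_op_norm_le[OF Bpos x])
    fix u assume u: "u \<in> vecs H"
    have "\<delta> * (hnorm H u)\<^sup>2 / c \<le> Re (hinner H (A u) u) / c"
      using lower[OF u] c by (intro divide_right_mono) auto
    then show "Re (hinner H (B u) u) \<le> q * (hnorm H u)\<^sup>2"
      using u by (simp add: Bform q_def left_diff_distrib)
  qed
  obtain Y where Yb: "bounded_op H Y"
    and Ysa: "\<And>x y. \<lbrakk>x \<in> vecs H; y \<in> vecs H\<rbrakk> \<Longrightarrow> hinner H (Y x) y = hinner H x (Y y)"
    and Yq: "\<And>x. x \<in> vecs H \<Longrightarrow> hnorm H (Y x) \<le> q * hnorm H x"
    and Yfix: "\<And>x. x \<in> vecs H \<Longrightarrow> hscale H 2 (Y x) = B x + Y (Y x)"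
    using sqrt_iteration[OF Bb positive_op_selfadjoint[OF Bpos] q Bq] by blast
  note Yv = bounded_op_vecs[OF Yb]
  define R where "R x = hscale H (of_real (sqrt c)) (x + hscale H (- 1) (Y x))" for x
  have Rb: "bounded_op H R"
    unfolding R_def by (intro bounded_op_scale bounded_op_add bounded_op_id Yb)
  have "hinner H (R x) x \<in> \<real>\<^sub>\<ge>\<^sub>0" if x: "x \<in> vecs H" for x
  proof -
    have "hinner H (Y x) x = cnj (hinner H (Y x) x)"
      using Ysa[OF x x] inner_cnj[OF x Yv[OF x]] by simp
    then have im: "Im (hinner H (Y x) x) = 0" by (simp add: complex_eq_iff)
    have "Re (hinner H (Y x) x) \<le> hnorm H (Y x) * hnorm H x" using x Yv by (intro Re_inner_le) auto
    also have "\<dots> \<le> q * hnorm H x * hnorm H x"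
      using Yq[OF x] x by (intro mult_right_mono) (auto simp: hnorm_nonneg)
    also have "\<dots> \<le> 1 * (hnorm H x)\<^sup>2"
      unfolding power2_eq_square mult.assoc using q by (intro mult_right_mono) auto
    finally have "Re (hinner H (Y x) x) \<le> (hnorm H x)\<^sup>2" by simp
    then show ?thesis using x Yv im c
      by (simp add: R_def inner_scale inner_diff inner_self complex_nonneg_Reals_iff)
  qed
  then have "positive_op H R" using Rb by (simp add: positive_op_def)
  moreover have "R (R x) = A x" if x: "x \<in> vecs H" for x
  proof -
    have sq: "complex_of_real (sqrt c) * complex_of_real (sqrt c) = of_real c"
      using c by (simp flip: of_real_mult)
    have R: "R u = hscale H (of_real (sqrt c)) (u - Y u)" for u by (simp add: R_def)
    have "R (R x) = hscale H (of_real c) (x - Y x - Y (x - Y x))"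
      unfolding R using x Yv
      by (simp add: bounded_op_scale_eq[OF Yb] scale_right_diff_distrib[symmetric] sq del: scale_right_diff_distrib)
    also have "x - Y x - Y (x - Y x) = x - (hscale H 2 (Y x) - Y (Y x))"
      using x Yv scale_left_distrib[of 1 1 "Y x"] by (simp add: bounded_op_diff_eq[OF Yb])
    also have "\<dots> = x - B x" using Yfix[OF x] by simp
    also have "\<dots> = hscale H (of_real (1 / c)) (A x)" by (simp add: B_def)
    finally show ?thesis using c by (simp flip: of_real_mult)
  qed
  ultimately show ?thesis by blast
qed

text \<open>The form of S at x is the form of A at S x, which gives positivity. The lower bound 1 /
  C comes from Cauchy-Schwarz in the form of A for S x and x, because \<langle>A (S x), x\<rangle>
  is the squared norm of x and \<langle>A x, x\<rangle> is at most C times it.\<close>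

lemma positive_inverse_op:
  assumes A: "positive_op H A" and inv: "is_inverse_op H A S"
  shows "positive_op H S"
    and "\<exists>\<delta>>0. \<forall>x\<in>vecs H. \<delta> * (hnorm H x)\<^sup>2 \<le> Re (hinner H (S x) x)"
proof -
  have Ab: "bounded_op H A" and Sb: "bounded_op H S" and AS: "\<And>x. x \<in> vecs H \<Longrightarrow> A (S x) = x"
    using A inv by (auto simp: positive_op_def is_inverse_op_def)
  note Sv = bounded_op_vecs[OF Sb] and Av = bounded_op_vecs[OF Ab]
  have form: "hinner H (S x) x = hinner H (A (S x)) (S x)" if x: "x \<in> vecs H" for x
    using positive_op_selfadjoint[OF A, of "S x" "S x"] x Sv AS by simp
  then show "positive_op H S"
    using A Sb Sv by (simp add: positive_op_def)
  obtain C where C: "C > 0" "\<And>x. x \<in> vecs H \<Longrightarrow> hnorm H (A x) \<le> C * hnorm H x"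
    using bounded_op_bound[OF Ab] by blast
  have "(1 / C) * (hnorm H x)\<^sup>2 \<le> Re (hinner H (S x) x)" if x: "x \<in> vecs H" for x
  proof (cases "x = 0")
    case True
    then show ?thesis using form[OF x] A Sv[OF x]
      by (auto simp: positive_op_def complex_nonneg_Reals_iff)
  next
    case False
    then have n: "hnorm H x > 0" using hnorm_eq_0_iff[OF x] hnorm_nonneg[OF x] by linarith
    have "((hnorm H x)\<^sup>2)\<^sup>2 = (norm (hinner H (A (S x)) x))\<^sup>2"
      using x AS by (simp add: inner_self norm_power)
    also have "\<dots> \<le> Re (hinner H (A (S x)) (S x)) * Re (hinner H (A x) x)"
      using A Sv[OF x] x by (rule positive_op_Cauchy_Schwarz)
    also have "\<dots> \<le> Re (hinner H (A (S x)) (S x)) * (C * (hnorm H x)\<^sup>2)"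
    proof (rule mult_left_mono)
      have "Re (hinner H (A x) x) \<le> hnorm H (A x) * hnorm H x" using x Av by (intro Re_inner_le) auto
      also have "\<dots> \<le> C * hnorm H x * hnorm H x"
        using C(2)[OF x] x by (intro mult_right_mono) (auto simp: hnorm_nonneg)
      finally show "Re (hinner H (A x) x) \<le> C * (hnorm H x)\<^sup>2" by (simp add: power2_eq_square)
      show "0 \<le> Re (hinner H (A (S x)) (S x))"
        using A Sv[OF x] by (auto simp: positive_op_def complex_nonneg_Reals_iff)
    qed
    finally have "(hnorm H x)\<^sup>2 * (hnorm H x)\<^sup>2 \<le> (C * Re (hinner H (S x) x)) * (hnorm H x)\<^sup>2"
      using form[OF x] by (simp add: power2_eq_square mult_ac)
    then have "(hnorm H x)\<^sup>2 \<le> C * Re (hinner H (S x) x)"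
      by (rule mult_right_le_imp_le) (use n in simp)
    then show ?thesis using C by (simp add: field_simps)
  qed
  then show "\<exists>\<delta>>0. \<forall>x\<in>vecs H. \<delta> * (hnorm H x)\<^sup>2 \<le> Re (hinner H (S x) x)"
    using C by (intro exI[of _ "1 / C"]) auto
qed

text \<open>Collects what is later used about \<open>sqrt_op H (inverse_op H A)\<close>. The
  existence results above make the \<open>SOME\<close> choices meaningful, and every chosen root R
  of S = A^(-1) satisfies these identities.\<close>

lemma sqrt_inverse_op:
  assumes A: "positive_op H A" and inv: "invertible_op H A"
  defines "R \<equiv> sqrt_op H (inverse_op H A)"
  shows "positive_op H R"
    and "x \<in> vecs H \<Longrightarrow> R (A (R x)) = x"
    and "x \<in> vecs H \<Longrightarrow> \<exists>y\<in>vecs H. x = R y"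
proof -
  define S where "S = inverse_op H A"
  have S: "is_inverse_op H A S"
    using inv someI_ex[of "is_inverse_op H A"]
    unfolding S_def inverse_op_def invertible_op_def by blast
  have Ab: "bounded_op H A" using A by (simp add: positive_op_def)
  note Av = bounded_op_vecs[OF Ab]
  from positive_inverse_op[OF A S] have "\<exists>R. positive_op H R \<and> (\<forall>x\<in>vecs H. R (R x) = S x)"
    using positive_sqrt_exists by blast
  then have R: "positive_op H R \<and> (\<forall>x\<in>vecs H. R (R x) = S x)"
    unfolding R_def sqrt_op_def S_def by (rule someI_ex)
  then show "positive_op H R" ..
  have Rv: "R u \<in> vecs H" if "u \<in> vecs H" for u
    using R that by (auto simp: positive_op_def bounded_op_vecs)
  have SA: "S (A u) = u" and AS: "A (S u) = u" and Sv: "S u \<in> vecs H" if "u \<in> vecs H" for u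
    using S that by (auto simp: is_inverse_op_def bounded_op_vecs)
  {
    assume x: "x \<in> vecs H"
    \<comment> \<open>S is R composed with R, so it commutes with R. This turns S (R (A (R x))) into
      S x, and applying A cancels S.\<close>
    have "S (R w) = R (S w)" if "w \<in> vecs H" for w using R Rv that by metis
    then have "S (R (A (R x))) = R (S (A (R x)))" using x Rv Av by blast
    also have "\<dots> = S x" using R x Rv SA by simp
    finally show "R (A (R x)) = x" using x Rv Av AS by metis
    have "x = R (R (A x))" using R x Av SA by simp
    then show "\<exists>y\<in>vecs H. x = R y" using x Rv Av by blast
  }
qed

end

section \<open>Trigonometric polynomials of an operator\<close>

text \<open>The n-th Fourier coefficient of p + conj q on the circle. Both conditions hold at n = 0,
  giving the constant term p(0) + conj (q(0)).\<close>

definition trig_coeff :: "complex poly \<Rightarrow> complex poly \<Rightarrow> int \<Rightarrow> complex" where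
  "trig_coeff p q n = (if n \<ge> 0 then coeff p (nat n) else 0)
     + (if n \<le> 0 then cnj (coeff q (nat (- n))) else 0)"

lemma sum_symmetric_interval:
  fixes f g :: "nat \<Rightarrow> 'b::comm_monoid_add"
  shows "(\<Sum>n\<in>{- int d..int d}. (if n \<ge> 0 then f (nat n) else 0) + (if n \<le> 0 then g (nat (- n)) else 0))
    = (\<Sum>i\<le>d. f i) + (\<Sum>i\<le>d. g i)"
proof -
  have "(\<Sum>n\<in>{- int d..int d}. if n \<ge> 0 then f (nat n) else 0) = (\<Sum>n\<in>{0..int d}. f (nat n))"
    by (intro sum.mono_neutral_cong_right) auto
  also have "\<dots> = (\<Sum>i\<le>d. f i)"
    by (rule sum.reindex_bij_witness[of _ int nat]) auto
  finally have f: "(\<Sum>n\<in>{- int d..int d}. if n \<ge> 0 then f (nat n) else 0) = (\<Sum>i\<le>d. f i)" .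
  have "(\<Sum>n\<in>{- int d..int d}. if n \<le> 0 then g (nat (- n)) else 0) = (\<Sum>n\<in>{- int d..0}. g (nat (- n)))"
    by (intro sum.mono_neutral_cong_right) auto
  also have "\<dots> = (\<Sum>i\<le>d. g i)"
    by (rule sum.reindex_bij_witness[of _ "\<lambda>i. - int i" "\<lambda>n. nat (- n)"]) auto
  finally show ?thesis by (simp add: sum.distrib f)
qed

lemma poly_eq_sum_le:
  fixes p :: "complex poly"
  assumes "degree p \<le> d"
  shows "poly p z = (\<Sum>i\<le>d. coeff p i * z ^ i)"
  unfolding poly_altdef using assms
  by (intro sum.mono_neutral_left) (auto simp: coeff_eq_0)

lemma cnj_powi_circle: "z \<in> circle \<Longrightarrow> cnj (z powi n) = z powi (- n)"
proof -
  assume "z \<in> circle"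
  then have "z * cnj z = 1" by (simp add: complex_norm_square[symmetric])
  then have "cnj z = inverse z" by (simp add: inverse_unique)
  then show ?thesis by (simp add: power_int_minus power_int_inverse)
qed

lemma trig_fun_eq_sum:
  assumes z: "z \<in> circle" and d: "degree p \<le> d" "degree q \<le> d"
  shows "trig_fun p q z = (\<Sum>n\<in>{- int d..int d}. trig_coeff p q n * z powi n)"
proof -
  have "(\<Sum>n\<in>{- int d..int d}. trig_coeff p q n * z powi n)
      = (\<Sum>n\<in>{- int d..int d}. (if n \<ge> 0 then coeff p (nat n) * z ^ nat n else 0)
          + (if n \<le> 0 then cnj (coeff q (nat (- n)) * z ^ nat (- n)) else 0))"
  proof (rule sum.cong[OF refl])
    fix n
    have "z powi n = cnj (z ^ nat (- n))" if "n \<le> 0"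
      using cnj_powi_circle[OF z, of "- n"] that by (simp add: power_int_def)
    then show "trig_coeff p q n * z powi n = (if n \<ge> 0 then coeff p (nat n) * z ^ nat n else 0)
          + (if n \<le> 0 then cnj (coeff q (nat (- n)) * z ^ nat (- n)) else 0)"
      by (auto simp: trig_coeff_def power_int_def algebra_simps)
  qed
  also have "\<dots> = poly p z + cnj (poly q z)"
    by (subst sum_symmetric_interval) (simp add: poly_eq_sum_le[OF d(1)] poly_eq_sum_le[OF d(2)])
  finally show ?thesis using z by (simp add: trig_fun_def)
qed

lemma trig_coeff_exists:
  obtains p q where "degree p \<le> d" "degree q \<le> d"
    "\<And>n. n \<in> {- int d..int d} \<Longrightarrow> trig_coeff p q n = c n"
proof -
  \<comment> \<open>The sum for q starts at degree 1, so the coefficient \<open>c 0\<close> is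
    carried by p alone and is not counted twice.\<close>
  define p q where "p = (\<Sum>i\<le>d. monom (c (int i)) i)"
    and "q = (\<Sum>i\<in>{1..d}. monom (cnj (c (- int i))) i)"
  have p: "coeff p i = (if i \<le> d then c (int i) else 0)"
    and q: "coeff q i = (if 1 \<le> i \<and> i \<le> d then cnj (c (- int i)) else 0)" for i
    by (auto simp: p_def q_def coeff_sum sum.delta)
  have "degree p \<le> d" "degree q \<le> d" by (auto intro!: degree_le simp: p q)
  moreover have "trig_coeff p q n = c n" if "n \<in> {- int d..int d}" for n
    using that by (auto simp: trig_coeff_def p q nat_le_iff)
  ultimately show thesis by (rule that)
qed

lemma trig_fun_add: "(\<lambda>z\<in>circle. trig_fun p q z + trig_fun p' q' z) = trig_fun (p + p') (q + q')"
  by (auto simp: trig_fun_def fun_eq_iff restrict_def)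

lemma trig_fun_scale: "(\<lambda>z\<in>circle. c * trig_fun p q z) = trig_fun (smult c p) (smult (cnj c) q)"
  by (auto simp: trig_fun_def fun_eq_iff restrict_def algebra_simps)

text \<open>The family \<open>S\<^sub>n\<close> of the overview. Having A instead of the identity at
  n = 0 absorbs the correction term with A - I in the definition of \<phi>.\<close>

definition toeplitz_op :: "'a::ab_group_add hspace \<Rightarrow> ('a \<Rightarrow> 'a) \<Rightarrow> ('a \<Rightarrow> 'a) \<Rightarrow> int \<Rightarrow> 'a \<Rightarrow> 'a" where
  "toeplitz_op H A T n =
     (if n = 0 then A else if n > 0 then T ^^ nat n else hadj H (T ^^ nat (- n)))"

context complex_hilbert_space
begin

lemma bounded_op_hadj:
  assumes T: "bounded_op H T"
  shows "bounded_op H (hadj H T)"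
proof -
  note Tv = bounded_op_vecs[OF T] and adj = hadj_spec[OF T]
  obtain C where C: "C > 0" "\<And>x. x \<in> vecs H \<Longrightarrow> hnorm H (T x) \<le> C * hnorm H x"
    using bounded_op_bound[OF T] by blast
  have "hnorm H (hadj H T y) \<le> C * hnorm H y" if y: "y \<in> vecs H" for y
  proof (cases "hnorm H (hadj H T y) = 0")
    case False
    let ?z = "hadj H T y"
    have z: "?z \<in> vecs H" using adj(1)[OF y] .
    have "hnorm H ?z * hnorm H ?z = Re (hinner H (T ?z) y)"
      using adj(2)[OF y z] z by (simp add: inner_self power2_eq_square)
    also have "\<dots> \<le> hnorm H (T ?z) * hnorm H y" using z y Tv by (intro Re_inner_le) auto
    also have "\<dots> \<le> C * hnorm H ?z * hnorm H y"
      using C(2)[OF z] y by (intro mult_right_mono) (auto simp: hnorm_nonneg)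
    finally have "hnorm H ?z * hnorm H ?z \<le> hnorm H ?z * (C * hnorm H y)" by (simp add: mult_ac)
    moreover have "hnorm H ?z > 0" using False hnorm_nonneg[OF z] by linarith
    ultimately show ?thesis by simp
  qed (use C y hnorm_nonneg in simp)
  moreover have "hadj H T (x + y) = hadj H T x + hadj H T y" if "x \<in> vecs H" "y \<in> vecs H" for x y
    by (rule hadj_eqI[OF T]) (use that adj Tv in \<open>simp_all add: inner_add_right\<close>)
  moreover have "hadj H T (hscale H c x) = hscale H c (hadj H T x)" if "x \<in> vecs H" for c x
    by (rule hadj_eqI[OF T]) (use that adj Tv in \<open>simp_all add: inner_scale_right\<close>)
  ultimately show ?thesis unfolding bounded_op_def using adj(1) by blast
qed

lemma bounded_op_cong:
  assumes "\<And>x. x \<in> vecs H \<Longrightarrow> S x = T x"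
  shows "bounded_op H S \<longleftrightarrow> bounded_op H T"
  using assms unfolding bounded_op_def by simp

lemma inner_hadj_left:
  assumes T: "bounded_op H T" and x: "x \<in> vecs H" and y: "y \<in> vecs H"
  shows "hinner H (hadj H T x) y = hinner H x (T y)"
  using hadj_spec[OF T x] inner_cnj[of "hadj H T x" y] inner_cnj[of x "T y"] x y
    bounded_op_vecs[OF T y] by simp

lemma bounded_op_toeplitz_op:
  "bounded_op H A \<Longrightarrow> bounded_op H T \<Longrightarrow> bounded_op H (toeplitz_op H A T n)"
  by (simp add: toeplitz_op_def bounded_op_hadj bounded_op_funpow)

lemma inner_toeplitz_op_left:
  assumes A: "positive_op H A" and T: "bounded_op H T" and xy: "x \<in> vecs H" "y \<in> vecs H"
  shows "hinner H (toeplitz_op H A T n x) y = hinner H x (toeplitz_op H A T (- n) y)"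
  using positive_op_selfadjoint[OF A xy] inner_hadj_left[OF bounded_op_funpow[OF T] xy]
    hadj_spec(2)[OF bounded_op_funpow[OF T] xy(2,1)]
  by (simp add: toeplitz_op_def)

lemma inner_poly_op:
  assumes T: "bounded_op H T" and xy: "x \<in> vecs H" "y \<in> vecs H" and d: "degree p \<le> d"
  shows "hinner H (poly_op H p T x) y = (\<Sum>i\<le>d. coeff p i * hinner H ((T ^^ i) x) y)"
proof -
  have "hinner H (poly_op H p T x) y = (\<Sum>i\<le>degree p. coeff p i * hinner H ((T ^^ i) x) y)"
    unfolding poly_op_def using xy bounded_op_vecs[OF bounded_op_funpow[OF T]]
    by (simp add: inner_sum_left inner_scale)
  also have "\<dots> = (\<Sum>i\<le>d. coeff p i * hinner H ((T ^^ i) x) y)"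
    using d by (intro sum.mono_neutral_left) (auto simp: coeff_eq_0)
  finally show ?thesis .
qed

text \<open>Turns statements about \<open>phi_A\<close> into scalar ones that are linear in the
  Fourier coefficients. The bound d is arbitrary so that several functions can be expanded over one
  index range.\<close>

lemma inner_phi_A:
  assumes A: "bounded_op H A" and T: "bounded_op H T" and xy: "x \<in> vecs H" "y \<in> vecs H"
    and d: "degree p \<le> d" "degree q \<le> d"
  shows "hinner H (phi_A H A T (trig_fun p q) x) y
    = (\<Sum>n\<in>{- int d..int d}. trig_coeff p q n * hinner H (toeplitz_op H A T n x) y)"
proof -
  note v = bounded_op_vecs[OF A] bounded_op_vecs[OF bounded_op_poly_op[OF T]]
    bounded_op_vecs[OF bounded_op_hadj[OF bounded_op_poly_op[OF T]]]
    bounded_op_vecs[OF bounded_op_funpow[OF T]]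
  let ?a = "hinner H (A x) y"
  \<comment> \<open>Replacing the zeroth power by A in a one-sided sum costs
    \<open>c 0 * (?a - u 0)\<close>. Summed over the two sides this is exactly the A - I term of
    \<open>phi_A\<close>.\<close>
  have shift: "(\<Sum>i\<le>d. c i * (if i = 0 then ?a else u i)) = (\<Sum>i\<le>d. c i * u i) + c 0 * (?a - u 0)"
    for c u :: "nat \<Rightarrow> complex"
  proof -
    have "(\<Sum>i\<le>d. c i * (if i = 0 then ?a else u i))
        = (\<Sum>i\<le>d. c i * u i + (if i = 0 then c 0 * (?a - u 0) else 0))"
      by (intro sum.cong) (auto simp: algebra_simps)
    then show ?thesis by (simp add: sum.distrib)
  qed
  have "(\<Sum>n\<in>{- int d..int d}. trig_coeff p q n * hinner H (toeplitz_op H A T n x) y)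
      = (\<Sum>n\<in>{- int d..int d}.
          (if n \<ge> 0 then coeff p (nat n) * (if nat n = 0 then ?a else hinner H ((T ^^ nat n) x) y) else 0)
        + (if n \<le> 0 then cnj (coeff q (nat (- n)))
             * (if nat (- n) = 0 then ?a else hinner H x ((T ^^ nat (- n)) y)) else 0))"
    by (intro sum.cong refl)
      (auto simp: trig_coeff_def toeplitz_op_def algebra_simps inner_hadj_left bounded_op_funpow T xy)
  also have "\<dots> = (\<Sum>i\<le>d. coeff p i * hinner H ((T ^^ i) x) y)
      + (\<Sum>i\<le>d. cnj (coeff q i) * hinner H x ((T ^^ i) y))
      + (coeff p 0 + cnj (coeff q 0)) * (?a - hinner H x y)"
    by (subst sum_symmetric_interval) (simp only: shift, simp add: algebra_simps)
  also have "(\<Sum>i\<le>d. cnj (coeff q i) * hinner H x ((T ^^ i) y))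
      = cnj (\<Sum>i\<le>d. coeff q i * hinner H ((T ^^ i) y) x)"
    using xy v by (simp add: inner_cnj[of x])
  also have "\<dots> = hinner H x (poly_op H q T y)"
    using inner_poly_op[OF T xy(2,1) d(2)] xy v by (simp add: inner_cnj[of x])
  finally show ?thesis
    using xy v d inner_hadj_left[OF bounded_op_poly_op[OF T] xy, of q]
    by (simp add: phi_A_trig_fun[OF T] inner_add inner_diff inner_scale inner_poly_op[OF T, symmetric]
        poly_0_coeff_0)
qed

lemma bounded_op_phi_A:
  assumes A: "bounded_op H A" and T: "bounded_op H T" and f: "f \<in> trig_system"
  shows "bounded_op H (phi_A H A T f)"
proof -
  obtain p q where pq: "f = trig_fun p q" using f by (auto simp: trig_system_def)
  have "bounded_op H (\<lambda>x. poly_op H p T x + hadj H (poly_op H q T) x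
       + hscale H (poly p 0 + cnj (poly q 0)) (A x + hscale H (- 1) x))"
    using T A by (intro bounded_op_add bounded_op_scale bounded_op_id bounded_op_poly_op bounded_op_hadj)
  then show ?thesis
    using bounded_op_cong[of "phi_A H A T f"] by (simp add: pq phi_A_trig_fun[OF T])
qed

text \<open>\<open>phi_A\<close> picks representing polynomials by choice, so linearity is read off
  from the coefficient formula, with one degree bound common to all polynomials involved.\<close>

lemma op_linear_on_phi_A:
  assumes A: "bounded_op H A" and T: "bounded_op H T"
  shows "op_linear_on trig_system H (phi_A H A T)"
proof -
  let ?\<phi> = "phi_A H A T"
  have v: "?\<phi> (trig_fun p q) x \<in> vecs H" if "x \<in> vecs H" for p q x
    using bounded_op_phi_A[OF A T] that by (auto simp: trig_system_def intro: bounded_op_vecs)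
  have eqI: "u = w" if "u \<in> vecs H" "w \<in> vecs H" "\<And>y. y \<in> vecs H \<Longrightarrow> hinner H u y = hinner H w y" for u w
    using inner_definite[of "u - w"] that by (simp add: inner_diff)
  have "?\<phi> (trig_fun (p + p') (q + q')) x = ?\<phi> (trig_fun p q) x + ?\<phi> (trig_fun p' q') x"
    if x: "x \<in> vecs H" for p q p' q' x
  proof (rule eqI)
    fix y assume y: "y \<in> vecs H"
    define d where "d = Max {degree p, degree q, degree p', degree q'}"
    have d: "degree p \<le> d" "degree q \<le> d" "degree p' \<le> d" "degree q' \<le> d"
      by (auto simp: d_def)
    moreover from d have "degree (p + p') \<le> d" "degree (q + q') \<le> d" by (auto intro: degree_add_le)
    moreover have "trig_coeff (p + p') (q + q') n = trig_coeff p q n + trig_coeff p' q' n" for n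
      by (simp add: trig_coeff_def)
    ultimately show "hinner H (?\<phi> (trig_fun (p + p') (q + q')) x) y
        = hinner H (?\<phi> (trig_fun p q) x + ?\<phi> (trig_fun p' q') x) y"
      using x y v by (simp add: inner_add inner_phi_A[OF A T, of _ _ _ d] distrib_right sum.distrib)
  qed (use x v in auto)
  moreover have "?\<phi> (trig_fun (smult c p) (smult (cnj c) q)) x = hscale H c (?\<phi> (trig_fun p q) x)"
    if x: "x \<in> vecs H" for p q x c
  proof (rule eqI)
    fix y assume y: "y \<in> vecs H"
    define d where "d = max (degree p) (degree q)"
    have d: "degree p \<le> d" "degree q \<le> d" by (auto simp: d_def)
    moreover from d have "degree (smult c p) \<le> d" "degree (smult (cnj c) q) \<le> d"
      by (auto intro: order_trans[OF degree_smult_le])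
    moreover have "trig_coeff (smult c p) (smult (cnj c) q) n = c * trig_coeff p q n" for n
      by (simp add: trig_coeff_def algebra_simps)
    ultimately show "hinner H (?\<phi> (trig_fun (smult c p) (smult (cnj c) q)) x) y
        = hinner H (hscale H c (?\<phi> (trig_fun p q) x)) y"
      using x y v by (simp add: inner_scale inner_phi_A[OF A T, of _ _ _ d] mult.assoc sum_distrib_left)
  qed (use x v in auto)
  ultimately show ?thesis
    unfolding op_linear_on_def using bounded_op_phi_A[OF A T]
    by (auto simp: trig_system_def trig_fun_add trig_fun_scale)
qed

lemma unitary_op_inner:
  assumes "unitary_op H U" "x \<in> vecs H" "y \<in> vecs H"
  shows "hinner H (U x) (U y) = hinner H x y"
  using assms hadj_spec(2)[of U "U y" x] by (simp add: unitary_op_def bounded_op_vecs)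

lemma unitary_op_funpow_inner:
  assumes U: "unitary_op H U" and xy: "x \<in> vecs H" "y \<in> vecs H"
  shows "hinner H ((U ^^ n) x) ((U ^^ n) y) = hinner H x y"
proof (induction n)
  case (Suc n)
  have "bounded_op H U" using U by (simp add: unitary_op_def)
  from bounded_op_vecs[OF bounded_op_funpow[OF this]] show ?case
    using Suc U xy by (simp add: unitary_op_inner)
qed simp

end

section \<open>From a unitary dilation to positivity of the map\<close>

text \<open>For the array \<open>trig_coeff p q n * a m\<close> the sum in
  \<open>fejer_mean_nonneg\<close> splits into the value of the function at \<omega> times the
  positive definite form of a at \<omega>, a product of two nonnegative numbers.\<close>

lemma trig_system_sum_nonneg_of_positive_definite:
  assumes f: "\<And>z. z \<in> circle \<Longrightarrow> trig_fun p q z \<in> \<real>\<^sub>\<ge>\<^sub>0" and d: "degree p \<le> d" "degree q \<le> d"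
    and a: "\<And>L \<omega>. \<omega> \<in> circle \<Longrightarrow>
      (\<Sum>j<L. \<Sum>k<L. \<omega> powi (int k - int j) * a (int j - int k)) \<in> \<real>\<^sub>\<ge>\<^sub>0"
  shows "(\<Sum>n\<in>{- int d..int d}. trig_coeff p q n * a n) \<in> \<real>\<^sub>\<ge>\<^sub>0"
proof (rule fejer_mean_nonneg[where e = "\<lambda>n. n" and \<beta> = "\<lambda>n m. trig_coeff p q n * a m"])
  fix L :: nat and \<omega> :: complex assume \<omega>: "\<omega> \<in> circle"
  then have "\<omega> \<noteq> 0" by auto
  then have "\<omega> powi (n - (int j - int k)) = \<omega> powi n * \<omega> powi (int k - int j)" for n j k
    using power_int_add[of \<omega> n "int k - int j"] by (simp add: algebra_simps)
  then have "(\<Sum>n\<in>{- int d..int d}. \<Sum>j<L. \<Sum>k<L.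
        \<omega> powi (n - (int j - int k)) * (trig_coeff p q n * a (int j - int k)))
      = trig_fun p q \<omega> * (\<Sum>j<L. \<Sum>k<L. \<omega> powi (int k - int j) * a (int j - int k))"
    unfolding trig_fun_eq_sum[OF \<omega> d] sum_distrib_right
    by (simp add: sum_distrib_left mult_ac)
  also have "\<dots> \<in> \<real>\<^sub>\<ge>\<^sub>0" using f a \<omega> by (intro nonneg_Reals_mult_I)
  finally show "(\<Sum>n\<in>{- int d..int d}. \<Sum>j<L. \<Sum>k<L.
      \<omega> powi (n - (int j - int k)) * (trig_coeff p q n * a (int j - int k))) \<in> \<real>\<^sub>\<ge>\<^sub>0" .
qed simp

context complex_hilbert_space
begin

text \<open>The vector z is \<open>J\<^sup>* k\<close>. Since \<open>hadj\<close> is defined for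
  operators within one space, this adjoint is taken from the Riesz representation directly.\<close>

lemma hadj_isometric_embedding:
  assumes K: "complex_hilbert_space K" and J: "isometric_embedding H K J" and k: "k \<in> vecs K"
  obtains z where "z \<in> vecs H" "\<And>x. x \<in> vecs H \<Longrightarrow> hinner K (J x) k = hinner H x z"
proof -
  interpret K: complex_hilbert_space K by fact
  have "hnorm K (J x) = hnorm H x" if "x \<in> vecs H" for x
    using J that by (simp add: isometric_embedding_def hnorm_def)
  then have "norm (hinner K (J x) k) \<le> hnorm K k * hnorm H x" if "x \<in> vecs H" for x
    using K.norm_inner_le[of "J x" k] J k that by (simp add: isometric_embedding_def mult.commute)
  then have "\<exists>z\<in>vecs H. \<forall>x\<in>vecs H. hinner K (J x) k = hinner H x z"
    using J k by (intro riesz_representation)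
      (auto simp: isometric_embedding_def K.inner_add K.inner_scale)
  then show thesis using that by blast
qed

text \<open>The projection onto the range of J is \<open>J J\<^sup>*\<close>. As
  \<open>orth_proj\<close> is a choice, uniqueness is proved too: two candidates differ by a vector
  in the range of J that is orthogonal to itself.\<close>

lemma orth_proj_isometric_embedding:
  assumes K: "complex_hilbert_space K" and J: "isometric_embedding H K J"
    and k: "k \<in> vecs K" and z: "z \<in> vecs H"
    and eq: "\<And>x. x \<in> vecs H \<Longrightarrow> hinner K (J x) k = hinner H x z"
  shows "orth_proj K (J ` vecs H) k = J z"
proof -
  interpret K: complex_hilbert_space K by fact
  have Jv: "J x \<in> vecs K" if "x \<in> vecs H" for x using J that by (simp add: isometric_embedding_def)
  have perp: "hinner K (k - J z) (J x) = 0" if "x \<in> vecs H" for x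
    using eq[OF that] that J z k Jv K.inner_cnj[of k "J x"] inner_cnj[of z x]
    by (simp add: K.inner_diff isometric_embedding_def)
  define P where "P m \<longleftrightarrow> m \<in> J ` vecs H \<and> (\<forall>w\<in>J ` vecs H. hinner K (k - m) w = 0)" for m
  have "P (J z)" using perp z by (simp add: P_def)
  moreover have "m = J z" if "P m" for m
  proof -
    obtain u where u: "u \<in> vecs H" "m = J u" using \<open>P m\<close> by (auto simp: P_def)
    have "J (u - z + z) = J (u - z) + J z"
      using J u z vecs_diff[of u z] unfolding isometric_embedding_def by blast
    then have "J (u - z) = J u - J z" by simp
    moreover have "hinner K (k - J u) (J (u - z)) = 0"
      using \<open>P m\<close> u z by (simp add: P_def)
    ultimately have "hinner K (J u - J z) (J u - J z) = 0"
      using perp[of "u - z"] u z k Jv by (simp add: K.inner_diff)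
    then show ?thesis using K.inner_definite[of "J u - J z"] u z Jv by simp
  qed
  ultimately have "(SOME m. P m) = J z" by (rule some_equality)
  then show ?thesis by (simp add: orth_proj_def P_def)
qed

lemma positive_map_of_C_A_class:
  assumes A: "positive_op H A" and inv: "invertible_op H A" and T: "bounded_op H T"
    and C: "C_A_class TYPE('k::ab_group_add) H A T"
  shows "positive_map trig_system H (phi_A H A T)"
proof -
  have Ab: "bounded_op H A" using A by (simp add: positive_op_def)
  define R where "R = sqrt_op H (inverse_op H A)"
  note R = sqrt_inverse_op[OF A inv, folded R_def]
  have Rb: "bounded_op H R" using R(1) by (simp add: positive_op_def)
  obtain K :: "'k hspace" and J U where K: "complex_hilbert_space K"
    and J: "isometric_embedding H K J" and U: "unitary_op K U"
    and dil: "\<And>n x. n \<ge> 1 \<Longrightarrow> x \<in> vecs H \<Longrightarrow>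
      J (R ((T ^^ n) (R x))) = orth_proj K (J ` vecs H) ((U ^^ n) (J x))"
    using C unfolding C_A_class_def Let_def R_def by blast
  interpret K: complex_hilbert_space K by fact
  have Ub: "bounded_op K U" using U by (simp add: unitary_op_def)
  note v = bounded_op_vecs[OF Rb] bounded_op_vecs[OF Ab] bounded_op_vecs[OF bounded_op_funpow[OF T]]
    K.bounded_op_vecs[OF K.bounded_op_funpow[OF Ub]]
  have Jv: "J x \<in> vecs K" and Jin: "hinner K (J x) (J w) = hinner H x w"
    if "x \<in> vecs H" "w \<in> vecs H" for x w
    using J that by (simp_all add: isometric_embedding_def)
  \<comment> \<open>Here z is \<open>J\<^sup>*\<close> applied to the n-th power of U at J y. The
    dilation equation identifies R T^n R y with z under J, and symmetry of R moves the outer R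
    across.\<close>
  have power: "hinner H ((T ^^ n) (R y)) (R y) = hinner K ((U ^^ n) (J y)) (J y)"
    if n: "n \<ge> 1" and y: "y \<in> vecs H" for n y
  proof -
    obtain z where z: "z \<in> vecs H" "\<And>x. x \<in> vecs H \<Longrightarrow> hinner K (J x) ((U ^^ n) (J y)) = hinner H x z"
      using hadj_isometric_embedding[OF K J, of "(U ^^ n) (J y)"] v Jv[OF y y] by blast
    have "J (R ((T ^^ n) (R y))) = J z"
      using dil[OF n y] orth_proj_isometric_embedding[OF K J _ z(1,2)] v Jv[OF y y] by simp
    moreover have "hinner H ((T ^^ n) (R y)) (R y) = hinner H (R ((T ^^ n) (R y))) y"
      using positive_op_selfadjoint[OF R(1)] v y by simp
    moreover have "hinner H (R ((T ^^ n) (R y))) y = hinner K (J (R ((T ^^ n) (R y)))) (J y)"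
      using Jin v y by simp
    moreover have "hinner K (J z) (J y) = hinner K ((U ^^ n) (J y)) (J y)"
      using Jin[OF z(1) y] z(2)[OF y] K.inner_cnj[of "(U ^^ n) (J y)" "J y"] inner_cnj[OF z(1) y] v Jv y z(1)
      by simp
    ultimately show ?thesis by simp
  qed
  have "hinner H (phi_A H A T f x) x \<in> \<real>\<^sub>\<ge>\<^sub>0"
    if f: "f \<in> trig_system" "\<And>z. z \<in> circle \<Longrightarrow> f z \<in> \<real>\<^sub>\<ge>\<^sub>0" and x: "x \<in> vecs H" for f x
  proof -
    obtain p q where pq: "f = trig_fun p q" using f by (auto simp: trig_system_def)
    define d where "d = max (degree p) (degree q)"
    have d: "degree p \<le> d" "degree q \<le> d" by (auto simp: d_def)
    obtain y where y: "y \<in> vecs H" and xy: "x = R y" using R(3)[OF x] by blast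
    let ?a = "\<lambda>n. hinner H (toeplitz_op H A T n x) x"
    have Jy: "J y \<in> vecs K" using Jv y by blast
    \<comment> \<open>The dilation equation covers only n \<ge> 1. At n = 0 the operator is A, and R
      A R = I supplies the missing value \<langle>y, y\<rangle>.\<close>
    have nonneg_pow: "?a (int n) = hinner K ((U ^^ n) (J y)) (J y)" for n
    proof (cases "n = 0")
      case True
      have "hinner H (A (R y)) (R y) = hinner H (R (A (R y))) y"
        using positive_op_selfadjoint[OF R(1)] v y by simp
      then show ?thesis using True R(2) y Jin by (simp add: toeplitz_op_def xy)
    next
      case False
      then show ?thesis using power[of n y] y by (simp add: toeplitz_op_def xy)
    qed
    have neg_pow: "?a (- n) = cnj (?a n)" for n
      using inner_toeplitz_op_left[OF A T x x, of n] inner_cnj[OF x, of "toeplitz_op H A T (- n) x"]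
        bounded_op_vecs[OF bounded_op_toeplitz_op[OF Ab T] x] x
      by simp
    \<comment> \<open>The k-th power of U preserves inner products, so applying it to both arguments
      turns exponent j - k into the pair (j, k); for j < k conjugate symmetry is used.\<close>
    have diff: "?a (int j - int k) = hinner K ((U ^^ j) (J y)) ((U ^^ k) (J y))" for j k
    proof -
      have *: "?a (int j - int k) = hinner K ((U ^^ j) (J y)) ((U ^^ k) (J y))" if "k \<le> j" for j k
      proof -
        have "(U ^^ j) (J y) = (U ^^ k) ((U ^^ (j - k)) (J y))"
          using that by (simp flip: funpow_add comp_apply[of "U ^^ k"])
        then show ?thesis
          using nonneg_pow[of "j - k"] that K.unitary_op_funpow_inner[OF U] v Jy by (simp add: of_nat_diff)
      qed
      show ?thesis
      proof (cases "k \<le> j")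
        case False
        then have "?a (int k - int j) = hinner K ((U ^^ k) (J y)) ((U ^^ j) (J y))"
          by (intro *) simp
        then show ?thesis
          using neg_pow[of "int k - int j"] K.inner_cnj[of "(U ^^ j) (J y)"] v Jy by simp
      qed (rule *)
    qed
    have "(\<Sum>n\<in>{- int d..int d}. trig_coeff p q n * ?a n) \<in> \<real>\<^sub>\<ge>\<^sub>0"
    proof (rule trig_system_sum_nonneg_of_positive_definite[OF _ d])
      show "trig_fun p q z \<in> \<real>\<^sub>\<ge>\<^sub>0" if "z \<in> circle" for z using f(2)[OF that] by (simp add: pq)
      fix L :: nat and \<omega> :: complex assume \<omega>: "\<omega> \<in> circle"
      \<comment> \<open>The positive definite form at \<omega> is the squared norm of this
        vector.\<close>
      define w where "w = (\<Sum>j<L. hscale K (\<omega> powi (- int j)) ((U ^^ j) (J y)))"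
      have "\<omega> \<noteq> 0" using \<omega> by auto
      then have pw: "\<omega> powi (int k - int j) = \<omega> powi (- int j) * cnj (\<omega> powi (- int k))" for j k
        using power_int_add[of \<omega> "- int j" "int k"] by (simp add: cnj_powi_circle[OF \<omega>] algebra_simps del: complex_cnj_power_int)
      have wv: "w \<in> vecs K" unfolding w_def using v Jy
        by (intro K.subspace_sum[OF K.subspace_vecs]) simp
      have "hinner K w w = (\<Sum>j<L. hinner K (hscale K (\<omega> powi (- int j)) ((U ^^ j) (J y))) w)"
        using v Jy wv by (subst w_def) (intro K.inner_sum_left, auto)
      also have "\<dots> = (\<Sum>j<L. \<Sum>k<L. \<omega> powi (- int j) * cnj (\<omega> powi (- int k)) * ?a (int j - int k))"
        unfolding w_def diff using v Jy
        by (simp add: K.inner_sum_right K.inner_scale K.inner_scale_right mult_ac del: complex_cnj_power_int)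
      also have "\<dots> = (\<Sum>j<L. \<Sum>k<L. \<omega> powi (int k - int j) * ?a (int j - int k))"
        by (simp only: pw)
      finally show "(\<Sum>j<L. \<Sum>k<L. \<omega> powi (int k - int j) * ?a (int j - int k)) \<in> \<real>\<^sub>\<ge>\<^sub>0"
        using K.inner_nonneg[OF wv] by simp
    qed
    then show ?thesis by (simp add: pq inner_phi_A[OF Ab T x x d])
  qed
  then show ?thesis
    unfolding positive_map_def positive_op_def
    using op_linear_on_phi_A[OF Ab T] bounded_op_phi_A[OF Ab T] by blast
qed

section \<open>From positivity of the map to a positive definite operator kernel\<close>

text \<open>For each \<omega> on the circle, \<phi> is applied to the Fejer kernel centred at
  \<omega>, and its quadratic form is evaluated at a vector that also depends on \<omega>. Averaging
  the result over \<omega> isolates the kernel sum.\<close>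

lemma toeplitz_kernel_nonneg:
  assumes A: "bounded_op H A" and T: "bounded_op H T"
    and pos: "positive_map trig_system H (phi_A H A T)"
    and I: "finite I" and h: "\<And>m. m \<in> I \<Longrightarrow> h m \<in> vecs H"
  shows "(\<Sum>m\<in>I. \<Sum>n\<in>I. hinner H (toeplitz_op H A T (m - n) (h m)) (h n)) \<in> \<real>\<^sub>\<ge>\<^sub>0"
proof -
  note Sb = bounded_op_toeplitz_op[OF A T]
  note Sv = bounded_op_vecs[OF Sb]
  \<comment> \<open>The two pair abstractions are kept apart so that unification with
    \<open>fejer_mean_nonneg\<close> reads off \<beta> and the frequency
    \<open>e (m, m') = m - m'\<close>.\<close>
  have "(\<Sum>i\<in>I \<times> I. (\<lambda>(m, m') n. hinner H (toeplitz_op H A T n (h m)) (h m')) i ((\<lambda>(m, m'). m - m') i)) \<in> \<real>\<^sub>\<ge>\<^sub>0"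
  proof (rule fejer_mean_nonneg)
    fix L :: nat and \<omega> :: complex assume \<omega>: "\<omega> \<in> circle"
    then have \<omega>0: "\<omega> \<noteq> 0" by auto
    \<comment> \<open>Fourier coefficients of the double sum of (z / \<omega>)^(j - k) over j, k <
      L. All differences are below L in absolute value, so polynomials of degree at most L represent
      it.\<close>
    define c where "c n = (\<Sum>j<L. \<Sum>k<L. if int j - int k = n then \<omega> powi (- n) else 0)" for n
    obtain p q where d: "degree p \<le> L" "degree q \<le> L"
      and pq: "\<And>n. n \<in> {- int L..int L} \<Longrightarrow> trig_coeff p q n = c n"
      using trig_coeff_exists[of L c] by blast
    have fourier: "(\<Sum>n\<in>{- int L..int L}. trig_coeff p q n * g n)
        = (\<Sum>j<L. \<Sum>k<L. \<omega> powi (int k - int j) * g (int j - int k))" for g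
    proof -
      have "(\<Sum>n\<in>{- int L..int L}. trig_coeff p q n * g n)
          = (\<Sum>n\<in>{- int L..int L}. \<Sum>j<L. \<Sum>k<L. if int j - int k = n then \<omega> powi (- n) * g n else 0)"
        by (intro sum.cong refl) (simp add: pq c_def sum_distrib_right if_distrib[of "\<lambda>u. u * _"] cong: if_cong)
      also have "\<dots> = (\<Sum>j<L. \<Sum>k<L. \<Sum>n\<in>{- int L..int L}. if int j - int k = n then \<omega> powi (- n) * g n else 0)"
        by (subst sum.swap, rule sum.cong[OF refl], subst sum.swap) simp
      also have "\<dots> = (\<Sum>j<L. \<Sum>k<L. \<omega> powi (int k - int j) * g (int j - int k))"
        by (intro sum.cong refl) (auto simp: sum.delta')
      finally show ?thesis .
    qed
    have "trig_fun p q z \<in> \<real>\<^sub>\<ge>\<^sub>0" if z: "z \<in> circle" for z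
    proof -
      have z0: "z \<noteq> 0" using z by auto
      \<comment> \<open>On the circle the Fejer kernel is the squared modulus of s, because
        conjugation inverts both z and \<omega>.\<close>
      define s where "s = (\<Sum>j<L. \<omega> powi (- int j) * z powi (int j))"
      have "trig_fun p q z = (\<Sum>j<L. \<Sum>k<L. \<omega> powi (int k - int j) * z powi (int j - int k))"
        by (simp only: trig_fun_eq_sum[OF z d] fourier)
      also have "\<dots> = (\<Sum>j<L. \<Sum>k<L. (\<omega> powi (- int j) * z powi (int j)) * cnj (\<omega> powi (- int k) * z powi (int k)))"
      proof (intro sum.cong refl)
        fix j k
        show "\<omega> powi (int k - int j) * z powi (int j - int k)
            = \<omega> powi (- int j) * z powi (int j) * cnj (\<omega> powi (- int k) * z powi (int k))"
          using power_int_add[of \<omega> "int k" "- int j"] power_int_add[of z "int j" "- int k"] z0 \<omega>0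
          by (simp add: cnj_powi_circle[OF \<omega>] cnj_powi_circle[OF z] del: complex_cnj_power_int power_int_of_nat)
      qed
      also have "\<dots> = s * cnj s" by (simp only: s_def cnj_sum sum_product)
      finally show ?thesis by (simp add: complex_norm_square[symmetric])
    qed
    then have phi_pos: "hinner H (phi_A H A T (trig_fun p q) x) x \<in> \<real>\<^sub>\<ge>\<^sub>0" if "x \<in> vecs H" for x
      using pos that unfolding positive_map_def positive_op_def trig_system_def by blast
    \<comment> \<open>These weights attach \<omega>^(m - m') to \<langle>S n (h m), h m'\<rangle>,
      so that the average over \<omega> selects n = m - m'.\<close>
    define x where "x = (\<Sum>m\<in>I. hscale H (\<omega> powi m) (h m))"
    have x: "x \<in> vecs H" unfolding x_def using h by (intro subspace_sum[OF subspace_vecs]) simp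
    have form: "hinner H (toeplitz_op H A T n x) x
        = (\<Sum>m\<in>I. \<Sum>m'\<in>I. \<omega> powi (m - m') * hinner H (toeplitz_op H A T n (h m)) (h m'))" for n
    proof -
      have sum_op: "toeplitz_op H A T n (\<Sum>m\<in>I. hscale H (\<omega> powi m) (h m))
          = (\<Sum>m\<in>I. hscale H (\<omega> powi m) (toeplitz_op H A T n (h m)))"
        using I h
      proof (induction I rule: finite_induct)
        case empty
        then show ?case using bounded_op_scale_eq[OF Sb, of 0 n 0] by simp
      next
        case (insert m F)
        have "(\<Sum>m\<in>F. hscale H (\<omega> powi m) (h m)) \<in> vecs H"
          using insert by (intro subspace_sum[OF subspace_vecs]) simp
        then show ?case using insert
          by (simp add: bounded_op_add_eq[OF Sb] bounded_op_scale_eq[OF Sb])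
      qed
      have pw: "\<omega> powi (m - m') = \<omega> powi m * cnj (\<omega> powi m')" for m m'
        using power_int_add[of \<omega> m "- m'"] \<omega>0 by (simp add: cnj_powi_circle[OF \<omega>] del: complex_cnj_power_int)
      have "hinner H (toeplitz_op H A T n x) x = (\<Sum>m\<in>I. hinner H (hscale H (\<omega> powi m) (toeplitz_op H A T n (h m))) x)"
        unfolding x_def[THEN arg_cong[of _ _ "toeplitz_op H A T n"], unfolded sum_op] using h Sv x
        by (intro inner_sum_left) auto
      also have "\<dots> = (\<Sum>m\<in>I. \<Sum>m'\<in>I. \<omega> powi m * cnj (\<omega> powi m') * hinner H (toeplitz_op H A T n (h m)) (h m'))"
        unfolding x_def using h Sv
        by (simp add: inner_sum_right inner_scale inner_scale_right mult_ac del: complex_cnj_power_int)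
      finally show ?thesis by (simp only: pw)
    qed
    have "(\<Sum>i\<in>I \<times> I. \<Sum>j<L. \<Sum>k<L. \<omega> powi ((\<lambda>(m, m'). m - m') i - (int j - int k))
          * (\<lambda>(m, m') n. hinner H (toeplitz_op H A T n (h m)) (h m')) i (int j - int k))
        = (\<Sum>j<L. \<Sum>k<L. \<Sum>i\<in>I \<times> I. \<omega> powi ((\<lambda>(m, m'). m - m') i - (int j - int k))
          * (\<lambda>(m, m') n. hinner H (toeplitz_op H A T n (h m)) (h m')) i (int j - int k))"
      by (subst sum.swap, rule sum.cong[OF refl], subst sum.swap) simp
    also have "\<dots> = (\<Sum>j<L. \<Sum>k<L. \<omega> powi (int k - int j) * hinner H (toeplitz_op H A T (int j - int k) x) x)"
    proof (intro sum.cong refl)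
      fix j k
      have pw: "\<omega> powi (m - m' - (int j - int k)) = \<omega> powi (int k - int j) * \<omega> powi (m - m')" for m m'
        using power_int_add[of \<omega> "int k - int j" "m - m'"] \<omega>0 by (simp add: algebra_simps)
      show "(\<Sum>i\<in>I \<times> I. \<omega> powi ((\<lambda>(m, m'). m - m') i - (int j - int k))
          * (\<lambda>(m, m') n. hinner H (toeplitz_op H A T n (h m)) (h m')) i (int j - int k))
        = \<omega> powi (int k - int j) * hinner H (toeplitz_op H A T (int j - int k) x) x"
        by (simp add: form pw sum.cartesian_product sum_distrib_left case_prod_unfold mult.assoc)
    qed
    also have "\<dots> = hinner H (phi_A H A T (trig_fun p q) x) x"
      by (simp only: inner_phi_A[OF A T x x d] fourier)
    also have "\<dots> \<in> \<real>\<^sub>\<ge>\<^sub>0" using x by (rule phi_pos)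
    finally show "(\<Sum>i\<in>I \<times> I. \<Sum>j<L. \<Sum>k<L. \<omega> powi ((\<lambda>(m, m'). m - m') i - (int j - int k))
          * (\<lambda>(m, m') n. hinner H (toeplitz_op H A T n (h m)) (h m')) i (int j - int k)) \<in> \<real>\<^sub>\<ge>\<^sub>0" .
  qed (use I in simp)
  then show ?thesis by (simp add: sum.cartesian_product case_prod_unfold)
qed

end

section \<open>Completion of function spaces\<close>

text \<open>A semi-inner product space whose vectors act as \<open>H\<close>-valued functions through \<open>ev\<close> has a
  completion that again consists of functions: the pointwise limits of Cauchy sequences. Assumption
  \<open>ev_weak\<close> makes the inner product of such limits independent of the sequences.\<close>

locale function_completion = pre: semi_inner_space V + H: complex_hilbert_space H
  for V :: "'v::ab_group_add hspace" and H :: "'a::ab_group_add hspace" +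
  fixes ev :: "'v \<Rightarrow> 'i \<Rightarrow> 'a" and C :: real
  assumes ev_vecs: "v \<in> vecs V \<Longrightarrow> ev v i \<in> vecs H"
    and ev_add: "v \<in> vecs V \<Longrightarrow> w \<in> vecs V \<Longrightarrow> ev (v + w) i = ev v i + ev w i"
    and ev_scale: "v \<in> vecs V \<Longrightarrow> ev (hscale V c v) i = hscale H c (ev v i)"
    and ev_bound: "v \<in> vecs V \<Longrightarrow> hnorm H (ev v i) \<le> C * hnorm V v"
    and ev_weak: "\<lbrakk>w \<in> vecs V; \<And>k. X k \<in> vecs V; \<And>i. (\<lambda>k::nat. hnorm H (ev (X k) i)) \<longlonglongrightarrow> 0\<rbrakk>
      \<Longrightarrow> (\<lambda>k. hinner V (X k) w) \<longlonglongrightarrow> 0"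
begin

definition cauchy :: "(nat \<Rightarrow> 'v) \<Rightarrow> bool" where
  "cauchy X \<longleftrightarrow> (\<forall>k. X k \<in> vecs V) \<and>
     (\<forall>e>0. \<exists>N. \<forall>m\<ge>N. \<forall>n\<ge>N. hnorm V (X m - X n) < e)"

definition approx :: "(nat \<Rightarrow> 'v) \<Rightarrow> ('i \<Rightarrow> 'a) \<Rightarrow> bool" where
  "approx X g \<longleftrightarrow> cauchy X \<and> (\<forall>i. g i \<in> vecs H \<and> (\<lambda>k. hnorm H (ev (X k) i - g i)) \<longlonglongrightarrow> 0)"

definition rep :: "('i \<Rightarrow> 'a) \<Rightarrow> nat \<Rightarrow> 'v" where
  "rep g = (SOME X. approx X g)"

text \<open>The inner product uses chosen representatives; \<open>tendsto_inner_completion\<close>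
  shows that every pair of approximating sequences has the same limit.\<close>

definition completion :: "('i \<Rightarrow> 'a) hspace" where
  "completion = \<lparr>vecs = {g. \<exists>X. approx X g}, hscale = (\<lambda>c g i. hscale H c (g i)),
     hinner = (\<lambda>f g. lim (\<lambda>k. hinner V (rep f k) (rep g k)))\<rparr>"

lemma ev_diff: "v \<in> vecs V \<Longrightarrow> w \<in> vecs V \<Longrightarrow> ev (v - w) i = ev v i - ev w i"
  using ev_add[of "v - w" w i] by simp

lemma cauchy_vecs: "cauchy X \<Longrightarrow> X k \<in> vecs V"
  by (simp add: cauchy_def)

lemma approx_vecs: "approx X g \<Longrightarrow> X k \<in> vecs V" and approx_val: "approx X g \<Longrightarrow> g i \<in> vecs H"
  by (auto simp: approx_def cauchy_def)

lemma cauchy_bounded: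
  assumes "cauchy X"
  obtains B where "B > 0" "\<And>k. hnorm V (X k) \<le> B"
proof -
  obtain N where N: "\<And>m n. m \<ge> N \<Longrightarrow> n \<ge> N \<Longrightarrow> hnorm V (X m - X n) < 1"
    using assms unfolding cauchy_def by (metis zero_less_one)
  define B where "B = Max ((\<lambda>k. hnorm V (X k)) ` {..N}) + 1"
  have small: "hnorm V (X k) \<le> B - 1" if "k \<le> N" for k
    using that unfolding B_def by (auto intro!: Max_ge)
  have "hnorm V (X k) \<le> B" for k
  proof (cases "k \<le> N")
    case False
    then show ?thesis
      using N[of k N] pre.hnorm_triangle_rev[of "X k" "X N"] small[of N] assms
      by (simp add: cauchy_vecs)
  qed (use small[of k] in simp)
  moreover have "B > 0" using small[of 0] pre.hnorm_nonneg[OF cauchy_vecs[OF assms], of 0] by linarith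
  ultimately show thesis using that by blast
qed

lemma cauchy_inner_convergent:
  assumes X: "cauchy X" and Y: "cauchy Y"
  shows "convergent (\<lambda>k. hinner V (X k) (Y k))"
proof -
  obtain B where B: "B > 0" "\<And>k. hnorm V (X k) \<le> B" using cauchy_bounded[OF X] by blast
  obtain D where D: "D > 0" "\<And>k. hnorm V (Y k) \<le> D" using cauchy_bounded[OF Y] by blast
  note v = cauchy_vecs[OF X] cauchy_vecs[OF Y]
  have bound: "norm (hinner V (X m) (Y m) - hinner V (X n) (Y n))
      \<le> hnorm V (X m - X n) * D + B * hnorm V (Y m - Y n)" for m n
  proof -
    have "hinner V (X m) (Y m) - hinner V (X n) (Y n)
        = hinner V (X m - X n) (Y m) + hinner V (X n) (Y m - Y n)"
      using v by (simp add: pre.inner_diff pre.inner_diff_right)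
    also have "norm \<dots> \<le> norm (hinner V (X m - X n) (Y m)) + norm (hinner V (X n) (Y m - Y n))"
      by (rule norm_triangle_ineq)
    also have "\<dots> \<le> hnorm V (X m - X n) * hnorm V (Y m) + hnorm V (X n) * hnorm V (Y m - Y n)"
      using v by (intro add_mono pre.norm_inner_le) auto
    also have "\<dots> \<le> hnorm V (X m - X n) * D + B * hnorm V (Y m - Y n)"
      using v B D by (intro add_mono mult_left_mono mult_right_mono) auto
    finally show ?thesis .
  qed
  have "Cauchy (\<lambda>k. hinner V (X k) (Y k))"
  proof (rule metric_CauchyI)
    fix e :: real assume e: "e > 0"
    obtain M where M: "\<And>m n. m \<ge> M \<Longrightarrow> n \<ge> M \<Longrightarrow> hnorm V (X m - X n) < e / (2 * D)"
      using X e D unfolding cauchy_def by (metis divide_pos_pos mult_pos_pos zero_less_numeral)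
    obtain N where N: "\<And>m n. m \<ge> N \<Longrightarrow> n \<ge> N \<Longrightarrow> hnorm V (Y m - Y n) < e / (2 * B)"
      using Y e B unfolding cauchy_def by (metis divide_pos_pos mult_pos_pos zero_less_numeral)
    have "dist (hinner V (X m) (Y m)) (hinner V (X n) (Y n)) < e"
      if "m \<ge> max M N" "n \<ge> max M N" for m n
    proof -
      have "hnorm V (X m - X n) * D + B * hnorm V (Y m - Y n) < e / (2 * D) * D + B * (e / (2 * B))"
        using M[of m n] N[of m n] that B D
        by (intro add_strict_mono mult_strict_right_mono mult_strict_left_mono) auto
      also have "\<dots> = e" using B D by simp
      finally show ?thesis using bound[of m n] by (simp add: dist_norm)
    qed
    then show "\<exists>M. \<forall>m\<ge>M. \<forall>n\<ge>M. dist (hinner V (X m) (Y m)) (hinner V (X n) (Y n)) < e" by blast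
  qed
  then show ?thesis by (rule Cauchy_convergent)
qed

lemma cauchy_add:
  assumes "cauchy X" "cauchy Y"
  shows "cauchy (\<lambda>k. X k + Y k)"
  unfolding cauchy_def
proof (intro conjI allI impI)
  note v = cauchy_vecs[OF assms(1)] cauchy_vecs[OF assms(2)]
  show "X k + Y k \<in> vecs V" for k using v by simp
  fix e :: real assume "e > 0"
  then have "e / 2 > 0" by simp
  then obtain M N where M: "\<And>m n. m \<ge> M \<Longrightarrow> n \<ge> M \<Longrightarrow> hnorm V (X m - X n) < e / 2"
    and N: "\<And>m n. m \<ge> N \<Longrightarrow> n \<ge> N \<Longrightarrow> hnorm V (Y m - Y n) < e / 2"
    using assms unfolding cauchy_def by metis
  have "hnorm V (X m + Y m - (X n + Y n)) < e" if "m \<ge> max M N" "n \<ge> max M N" for m n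
    using pre.hnorm_triangle[of "X m - X n" "Y m - Y n"] M[of m n] N[of m n] that v
    by (simp add: add_diff_add)
  then show "\<exists>N. \<forall>m\<ge>N. \<forall>n\<ge>N. hnorm V (X m + Y m - (X n + Y n)) < e" by blast
qed

lemma cauchy_scale:
  assumes "cauchy X"
  shows "cauchy (\<lambda>k. hscale V c (X k))"
  unfolding cauchy_def
proof (intro conjI allI impI)
  show "hscale V c (X k) \<in> vecs V" for k using cauchy_vecs[OF assms] by simp
  fix e :: real assume e: "e > 0"
  have p: "norm c + 1 > 0" by (simp add: add_nonneg_pos)
  then obtain N where N: "\<And>m n. m \<ge> N \<Longrightarrow> n \<ge> N \<Longrightarrow> hnorm V (X m - X n) < e / (norm c + 1)"
    using assms e unfolding cauchy_def by (metis divide_pos_pos)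
  have "hnorm V (hscale V c (X m) - hscale V c (X n)) < e" if mn: "m \<ge> N" "n \<ge> N" for m n
  proof -
    have d: "X m - X n \<in> vecs V" using cauchy_vecs[OF assms] by simp
    have "hnorm V (hscale V c (X m) - hscale V c (X n)) = norm c * hnorm V (X m - X n)"
      using pre.hnorm_scale[OF d, of c] by (simp add: pre.scale_right_diff_distrib)
    also have "\<dots> \<le> (norm c + 1) * hnorm V (X m - X n)" using d by (intro mult_right_mono) auto
    also have "\<dots> < e" using N[OF mn] p by (simp add: pos_less_divide_eq mult.commute)
    finally show ?thesis .
  qed
  then show "\<exists>N. \<forall>m\<ge>N. \<forall>n\<ge>N. hnorm V (hscale V c (X m) - hscale V c (X n)) < e" by blast
qed

lemma approx_add:
  assumes "approx X f" "approx Y g"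
  shows "approx (\<lambda>k. X k + Y k) (f + g)"
  unfolding approx_def
proof (intro conjI allI)
  show "cauchy (\<lambda>k. X k + Y k)" using assms by (intro cauchy_add) (auto simp: approx_def)
  fix i
  note v = approx_vecs[OF assms(1)] approx_vecs[OF assms(2)] approx_val[OF assms(1)] approx_val[OF assms(2)]
  show "(f + g) i \<in> vecs H" using v by simp
  show "(\<lambda>k. hnorm H (ev (X k + Y k) i - (f + g) i)) \<longlonglongrightarrow> 0"
  proof (rule tendsto_sandwich)
    show "\<forall>\<^sub>F k in sequentially. 0 \<le> hnorm H (ev (X k + Y k) i - (f + g) i)"
      using v ev_vecs by (intro always_eventually) (simp add: H.hnorm_nonneg)
    show "\<forall>\<^sub>F k in sequentially. hnorm H (ev (X k + Y k) i - (f + g) i)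
        \<le> hnorm H (ev (X k) i - f i) + hnorm H (ev (Y k) i - g i)"
    proof (intro always_eventually allI)
      fix k
      show "hnorm H (ev (X k + Y k) i - (f + g) i)
        \<le> hnorm H (ev (X k) i - f i) + hnorm H (ev (Y k) i - g i)"
        using v ev_vecs H.hnorm_triangle[of "ev (X k) i - f i" "ev (Y k) i - g i"]
        by (simp add: ev_add add_diff_add)
    qed
    show "(\<lambda>k. hnorm H (ev (X k) i - f i) + hnorm H (ev (Y k) i - g i)) \<longlonglongrightarrow> 0"
      using assms by (intro tendsto_add_zero) (auto simp: approx_def)
  qed simp
qed

lemma approx_scale:
  assumes "approx X f"
  shows "approx (\<lambda>k. hscale V c (X k)) (\<lambda>i. hscale H c (f i))"
  unfolding approx_def
proof (intro conjI allI)
  show "cauchy (\<lambda>k. hscale V c (X k))" using assms by (intro cauchy_scale) (auto simp: approx_def)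
  fix i
  note v = approx_vecs[OF assms] approx_val[OF assms]
  show "hscale H c (f i) \<in> vecs H" using v by simp
  have "hnorm H (ev (hscale V c (X k)) i - hscale H c (f i)) = norm c * hnorm H (ev (X k) i - f i)" for k
    using v ev_vecs H.hnorm_scale[of "ev (X k) i - f i" c]
    by (simp add: ev_scale H.scale_right_diff_distrib)
  then show "(\<lambda>k. hnorm H (ev (hscale V c (X k)) i - hscale H c (f i))) \<longlonglongrightarrow> 0"
    using assms by (auto simp: approx_def intro!: tendsto_mult_right_zero)
qed

lemma approx_diff:
  assumes "approx X f" "approx Y g"
  shows "approx (\<lambda>k. X k - Y k) (f - g)"
proof -
  have "approx (\<lambda>k. X k + hscale V (- 1) (Y k)) (f + (\<lambda>i. hscale H (- 1) (g i)))"
    using assms by (intro approx_add approx_scale)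
  moreover have "f + (\<lambda>i. hscale H (- 1) (g i)) = f - g" by (simp add: fun_eq_iff)
  moreover have "(\<lambda>k. X k + hscale V (- 1) (Y k)) = (\<lambda>k. X k - Y k)" by (simp add: fun_eq_iff)
  ultimately show ?thesis by (simp only:)
qed

lemma approx_ev: "v \<in> vecs V \<Longrightarrow> approx (\<lambda>k. v) (ev v)"
  using pre.hnorm_scale[of v 0] by (simp add: approx_def cauchy_def ev_vecs)

text \<open>A Cauchy sequence that vanishes pointwise vanishes in norm. The squared norm of X k is
  \<langle>X k, X N\<rangle> + \<langle>X k, X k - X N\<rangle>: for fixed N the first term tends to
  0 by \<open>ev_weak\<close>, and the second is small because X is bounded and Cauchy.\<close>

lemma approx_zero_tendsto:
  assumes X: "approx X 0"
  shows "(\<lambda>k. hnorm V (X k)) \<longlonglongrightarrow> 0"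
proof -
  note v = approx_vecs[OF X]
  have cX: "cauchy X" using X by (simp add: approx_def)
  obtain B where B: "B > 0" "\<And>k. hnorm V (X k) \<le> B" using cauchy_bounded[OF cX] by blast
  have "(\<lambda>k. (hnorm V (X k))\<^sup>2) \<longlonglongrightarrow> 0"
  proof (rule LIMSEQ_I)
    fix e :: real assume e: "e > 0"
    then have "e / (2 * B) > 0" using B by simp
    then obtain N where N: "\<And>m n. m \<ge> N \<Longrightarrow> n \<ge> N \<Longrightarrow> hnorm V (X m - X n) < e / (2 * B)"
      using cX unfolding cauchy_def by blast
    have "(\<lambda>k. hinner V (X k) (X N)) \<longlonglongrightarrow> 0"
      using X v by (intro ev_weak) (auto simp: approx_def)
    from LIMSEQ_D[OF this, of "e / 2"] e obtain M
      where M: "\<And>k. k \<ge> M \<Longrightarrow> norm (hinner V (X k) (X N)) < e / 2"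
      unfolding diff_zero by (metis half_gt_zero)
    have "norm ((hnorm V (X k))\<^sup>2 - 0) < e" if "k \<ge> max M N" for k
    proof -
      have "(hnorm V (X k))\<^sup>2 = norm (hinner V (X k) (X N) + hinner V (X k) (X k - X N))"
        using v by (simp add: pre.inner_diff_right pre.inner_self norm_power)
      also have "\<dots> \<le> norm (hinner V (X k) (X N)) + norm (hinner V (X k) (X k - X N))"
        by (rule norm_triangle_ineq)
      also have "norm (hinner V (X k) (X k - X N)) \<le> hnorm V (X k) * hnorm V (X k - X N)"
        using v by (intro pre.norm_inner_le) auto
      also have "\<dots> \<le> B * (e / (2 * B))"
        using N[of k N] that B v by (intro mult_mono) (auto intro: less_imp_le)
      also have "B * (e / (2 * B)) = e / 2" using B by simp
      finally show ?thesis using M[of k] that by simp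
    qed
    then show "\<exists>no. \<forall>k\<ge>no. norm ((hnorm V (X k))\<^sup>2 - 0) < e" by blast
  qed
  then have "(\<lambda>k. sqrt ((hnorm V (X k))\<^sup>2)) \<longlonglongrightarrow> sqrt 0" by (rule tendsto_real_sqrt)
  then show ?thesis using v by simp
qed

text \<open>Two sequences approximating the same function differ by one approximating 0, hence by a
  norm-null sequence, which bounded inner products do not see in the limit.\<close>

lemma tendsto_inner_completion:
  assumes X: "approx X f" and Y: "approx Y g"
  shows "(\<lambda>k. hinner V (X k) (Y k)) \<longlonglongrightarrow> hinner completion f g"
proof -
  have rf: "approx (rep f) f" and rg: "approx (rep g) g"
    unfolding rep_def by (rule someI[of "\<lambda>X. approx X f", OF X], rule someI[of "\<lambda>X. approx X g", OF Y])
  note v = approx_vecs[OF X] approx_vecs[OF Y] approx_vecs[OF rf] approx_vecs[OF rg]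
  have cauchy: "cauchy Y" "cauchy (rep f)" "cauchy (rep g)" using Y rf rg by (auto simp: approx_def)
  have lim: "(\<lambda>k. hinner V (rep f k) (rep g k)) \<longlonglongrightarrow> hinner completion f g"
    using cauchy_inner_convergent[OF cauchy(2,3)] by (simp add: completion_def convergent_LIMSEQ_iff)
  obtain D where D: "\<And>k. hnorm V (Y k) \<le> D" using cauchy_bounded[OF cauchy(1)] by blast
  obtain B where B: "\<And>k. hnorm V (rep f k) \<le> B" using cauchy_bounded[OF cauchy(2)] by blast
  have dX: "(\<lambda>k. hnorm V (X k - rep f k)) \<longlonglongrightarrow> 0" and dY: "(\<lambda>k. hnorm V (Y k - rep g k)) \<longlonglongrightarrow> 0"
    using approx_diff[OF X rf] approx_diff[OF Y rg] by (auto intro: approx_zero_tendsto)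
  have "(\<lambda>k. hinner V (X k) (Y k) - hinner V (rep f k) (rep g k)) \<longlonglongrightarrow> 0"
  proof (rule Lim_null_comparison)
    show "\<forall>\<^sub>F k in sequentially. norm (hinner V (X k) (Y k) - hinner V (rep f k) (rep g k))
        \<le> hnorm V (X k - rep f k) * D + B * hnorm V (Y k - rep g k)"
    proof (intro always_eventually allI)
      fix k
      have "hinner V (X k) (Y k) - hinner V (rep f k) (rep g k)
          = hinner V (X k - rep f k) (Y k) + hinner V (rep f k) (Y k - rep g k)"
        using v by (simp add: pre.inner_diff pre.inner_diff_right)
      also have "norm \<dots> \<le> norm (hinner V (X k - rep f k) (Y k)) + norm (hinner V (rep f k) (Y k - rep g k))"
        by (rule norm_triangle_ineq)
      also have "\<dots> \<le> hnorm V (X k - rep f k) * hnorm V (Y k) + hnorm V (rep f k) * hnorm V (Y k - rep g k)"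
        using v by (intro add_mono pre.norm_inner_le) auto
      also have "\<dots> \<le> hnorm V (X k - rep f k) * D + B * hnorm V (Y k - rep g k)"
        using v B D by (intro add_mono mult_left_mono mult_right_mono) auto
      finally show "norm (hinner V (X k) (Y k) - hinner V (rep f k) (rep g k))
        \<le> hnorm V (X k - rep f k) * D + B * hnorm V (Y k - rep g k)" .
    qed
    show "(\<lambda>k. hnorm V (X k - rep f k) * D + B * hnorm V (Y k - rep g k)) \<longlonglongrightarrow> 0"
      using dX dY by (intro tendsto_add_zero tendsto_mult_left_zero tendsto_mult_right_zero)
  qed
  from tendsto_add[OF this lim] show ?thesis by simp
qed

lemma completion_vecsE:
  assumes "g \<in> vecs completion"
  obtains X where "approx X g"
  using assms by (auto simp: completion_def)

lemma completion_vecsI: "approx X g \<Longrightarrow> g \<in> vecs completion"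
  by (auto simp: completion_def)

lemma hscale_completion: "hscale completion c g = (\<lambda>i. hscale H c (g i))"
  by (simp add: completion_def)

lemma ev_in_completion: "v \<in> vecs V \<Longrightarrow> ev v \<in> vecs completion"
  using approx_ev completion_vecsI by blast

lemma inner_ev: "v \<in> vecs V \<Longrightarrow> w \<in> vecs V \<Longrightarrow> hinner completion (ev v) (ev w) = hinner V v w"
  using tendsto_inner_completion[OF approx_ev approx_ev, of v w] by (simp add: LIMSEQ_const_iff)

lemma tendsto_hnorm_completion:
  "approx X g \<Longrightarrow> (\<lambda>k. hnorm V (X k)) \<longlonglongrightarrow> hnorm completion g"
  unfolding hnorm_def by (intro tendsto_intros tendsto_inner_completion)

lemma hnorm_val_le:
  assumes "g \<in> vecs completion"
  shows "hnorm H (g i) \<le> C * hnorm completion g"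
proof -
  obtain X where X: "approx X g" using completion_vecsE[OF assms] .
  have "(\<lambda>k. hnorm H (ev (X k) i)) \<longlonglongrightarrow> hnorm H (g i)"
    using X by (intro H.tendsto_hnorm) (auto simp: approx_def cauchy_def ev_vecs)
  moreover have "(\<lambda>k. C * hnorm V (X k)) \<longlonglongrightarrow> C * hnorm completion g"
    using tendsto_hnorm_completion[OF X] by (rule tendsto_mult_left)
  ultimately show ?thesis
    by (rule LIMSEQ_le) (use ev_bound approx_vecs[OF X] in blast)
qed

lemma vector_space_completion: "vector_space (hscale completion)"
  by unfold_locales (simp_all add: hscale_completion fun_eq_iff H.scale_right_distrib H.scale_left_distrib)

lemma semi_inner_space_completion: "semi_inner_space completion"
proof -
  interpret KV: vector_space "hscale completion" by (rule vector_space_completion)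
  have ev0: "ev 0 = 0" using ev_scale[of 0 0] by (simp add: fun_eq_iff)
  show ?thesis
  proof (intro semi_inner_space.intro semi_inner_space_axioms.intro vector_space_completion)
    show "KV.subspace (vecs completion)"
      unfolding KV.subspace_def hscale_completion
    proof (intro conjI ballI allI)
      show "0 \<in> vecs completion" using ev_in_completion[of 0] by (simp add: ev0)
      fix f assume "f \<in> vecs completion"
      then obtain X where X: "approx X f" by (rule completion_vecsE)
      show "(\<lambda>i. hscale H c (f i)) \<in> vecs completion" for c
        by (rule completion_vecsI[OF approx_scale[OF X]])
      fix g assume "g \<in> vecs completion"
      then obtain Y where Y: "approx Y g" by (rule completion_vecsE)
      show "f + g \<in> vecs completion" by (rule completion_vecsI[OF approx_add[OF X Y]])
    qed
  next
    fix f g h assume "f \<in> vecs completion" "g \<in> vecs completion" "h \<in> vecs completion"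
    then obtain X Y Z where XYZ: "approx X f" "approx Y g" "approx Z h"
      by (meson completion_vecsE)
    have "(\<lambda>k. hinner V (X k + Y k) (Z k)) \<longlonglongrightarrow> hinner completion f h + hinner completion g h"
      using tendsto_add[OF tendsto_inner_completion[OF XYZ(1,3)] tendsto_inner_completion[OF XYZ(2,3)]]
      by (simp add: pre.inner_add XYZ[THEN approx_vecs])
    then show "hinner completion (f + g) h = hinner completion f h + hinner completion g h"
      using tendsto_inner_completion[OF approx_add[OF XYZ(1,2)] XYZ(3)] LIMSEQ_unique by blast
  next
    fix f g c assume "f \<in> vecs completion" "g \<in> vecs completion"
    then obtain X Y where XY: "approx X f" "approx Y g"
      by (meson completion_vecsE)
    have "(\<lambda>k. hinner V (hscale V c (X k)) (Y k)) \<longlonglongrightarrow> c * hinner completion f g"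
      using tendsto_mult_left[OF tendsto_inner_completion[OF XY]]
      by (simp add: pre.inner_scale XY[THEN approx_vecs])
    then show "hinner completion (hscale completion c f) g = c * hinner completion f g"
      unfolding hscale_completion
      using tendsto_inner_completion[OF approx_scale[OF XY(1)] XY(2)] LIMSEQ_unique by blast
  next
    fix f g assume "f \<in> vecs completion" "g \<in> vecs completion"
    then obtain X Y where XY: "approx X f" "approx Y g"
      by (meson completion_vecsE)
    have "hinner V (X k) (Y k) = cnj (hinner V (Y k) (X k))" for k
      using XY by (intro pre.inner_cnj approx_vecs)
    then have "(\<lambda>k. hinner V (X k) (Y k)) \<longlonglongrightarrow> cnj (hinner completion g f)"
      using tendsto_cnj[OF tendsto_inner_completion[OF XY(2,1)]] by simp
    then show "hinner completion f g = cnj (hinner completion g f)"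
      using tendsto_inner_completion[OF XY] LIMSEQ_unique by blast
  next
    fix f assume "f \<in> vecs completion"
    then obtain X where X: "approx X f" by (rule completion_vecsE)
    show "hinner completion f f \<in> \<real>\<^sub>\<ge>\<^sub>0"
      by (rule closed_sequentially[OF closed_nonneg_Reals_complex _ tendsto_inner_completion[OF X X]])
        (use pre.inner_nonneg approx_vecs[OF X] in blast)
  qed
qed

text \<open>Definiteness holds because norm 0 forces all values to be 0. For completeness, each X n
  is replaced by some \<open>ev (v n)\<close> within 1 / (n + 1); then v is Cauchy in the original
  space, and its pointwise limit is the limit of X.\<close>

lemma complex_hilbert_space_completion: "complex_hilbert_space completion"
proof -
  interpret K: semi_inner_space completion by (rule semi_inner_space_completion)
  show ?thesis
  proof (intro complex_hilbert_space.intro complex_hilbert_space_axioms.intro vector_space_completion)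
    fix g assume g: "g \<in> vecs completion" and "hinner completion g g = 0"
    then have "hnorm completion g = 0" by (simp add: hnorm_def)
    moreover obtain X where "approx X g" using completion_vecsE[OF g] .
    ultimately show "g = 0"
      using hnorm_val_le[OF g] H.hnorm_nonneg H.hnorm_eq_0_iff approx_val
      by (metis (no_types, lifting) antisym ext mult_zero_right zero_fun_apply)
  next
    fix X :: "nat \<Rightarrow> 'i \<Rightarrow> 'a" assume X: "\<And>n. X n \<in> vecs completion"
      and cX: "\<And>e. e > 0 \<Longrightarrow> \<exists>N. \<forall>m\<ge>N. \<forall>n\<ge>N. hnorm completion (X m - X n) < e"
    \<comment> \<open>For fixed n the function \<open>ev (Y n) - g\<close> is approximated by
      \<open>Y n - Y k\<close> in k, so its norm is a limit of norms that the Cauchy condition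
      bounds.\<close>
    have near: "(\<lambda>n. hnorm completion (ev (Y n) - g)) \<longlonglongrightarrow> 0" if Y: "approx Y g" for Y g
    proof (rule LIMSEQ_I)
      fix e :: real assume e: "e > 0"
      then have "e / 2 > 0" by simp
      then obtain N where N: "\<And>m n. m \<ge> N \<Longrightarrow> n \<ge> N \<Longrightarrow> hnorm V (Y m - Y n) < e / 2"
        using Y unfolding approx_def cauchy_def by blast
      have "norm (hnorm completion (ev (Y n) - g) - 0) < e" if n: "n \<ge> N" for n
      proof -
        have ap: "approx (\<lambda>k. Y n - Y k) (ev (Y n) - g)"
          using approx_diff[OF approx_ev Y] approx_vecs[OF Y] by blast
        have "hnorm completion (ev (Y n) - g) \<le> e / 2"
          by (rule LIMSEQ_le_const2[OF tendsto_hnorm_completion[OF ap]])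
            (use N[OF n] less_imp_le in blast)
        then show ?thesis using e K.hnorm_nonneg[OF completion_vecsI[OF ap]] by simp
      qed
      then show "\<exists>no. \<forall>n\<ge>no. norm (hnorm completion (ev (Y n) - g) - 0) < e" by blast
    qed
    have "\<exists>v. v \<in> vecs V \<and> hnorm completion (ev v - X n) < 1 / (real n + 1)" for n
    proof -
      obtain Y where Y: "approx Y (X n)" using completion_vecsE[OF X] .
      have "0 < 1 / (real n + 1)" by simp
      from order_tendstoD(2)[OF near[OF Y] this] obtain k
        where "hnorm completion (ev (Y k) - X n) < 1 / (real n + 1)"
        by (auto simp: eventually_sequentially)
      then show ?thesis using approx_vecs[OF Y] by blast
    qed
    then obtain v where v: "\<And>n. v n \<in> vecs V"
      and vX: "\<And>n. hnorm completion (ev (v n) - X n) < 1 / (real n + 1)"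
      by metis
    note evK = ev_in_completion[OF v]
    have small: "(\<lambda>n. 1 / (real n + 1)) \<longlonglongrightarrow> 0"
      using LIMSEQ_inverse_real_of_nat by (simp add: inverse_eq_divide add.commute)
    have cv: "cauchy v"
      unfolding cauchy_def
    proof (intro conjI allI impI v)
      fix e :: real assume e: "e > 0"
      obtain M where M: "\<And>m n. m \<ge> M \<Longrightarrow> n \<ge> M \<Longrightarrow> hnorm completion (X m - X n) < e / 3"
        using cX[of "e / 3"] e by auto
      obtain N where N: "\<And>n. n \<ge> N \<Longrightarrow> 1 / (real n + 1) < e / 3"
        using order_tendstoD(2)[OF small, of "e / 3"] e by (auto simp: eventually_sequentially)
      have "hnorm V (v m - v n) < e" if mn: "m \<ge> max M N" "n \<ge> max M N" for m n
      proof -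
        have "ev (v m - v n) = ev (v m) - ev (v n)" using v by (simp add: fun_eq_iff ev_diff)
        then have "hnorm V (v m - v n) = hnorm completion (ev (v m) - ev (v n))"
          using inner_ev[of "v m - v n" "v m - v n"] v by (simp add: hnorm_def)
        also have "\<dots> \<le> hnorm completion (ev (v m) - X m) + hnorm completion (X m - ev (v n))"
          using X evK by (intro K.hnorm_triangle_diff)
        also have "hnorm completion (X m - ev (v n))
            \<le> hnorm completion (X m - X n) + hnorm completion (X n - ev (v n))"
          using X evK by (intro K.hnorm_triangle_diff)
        finally show ?thesis
          using M[of m n] N[of m] N[of n] vX[of m] vX[of n] mn K.hnorm_minus_commute[OF X evK, of n n]
          by linarith
      qed
      then show "\<exists>N. \<forall>m\<ge>N. \<forall>n\<ge>N. hnorm V (v m - v n) < e" by blast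
    qed
    have "\<exists>l. l \<in> vecs H \<and> (\<lambda>n. hnorm H (ev (v n) i - l)) \<longlonglongrightarrow> 0" for i
    proof -
      have "\<exists>l\<in>vecs H. (\<lambda>n. hnorm H (ev (v n) i - l)) \<longlonglongrightarrow> 0"
      proof (rule H.complete)
        fix e :: real assume e: "e > 0"
        \<comment> \<open>The locale does not fix the sign of C; a strictly positive bound is wanted
          as a divisor.\<close>
        define D where "D = \<bar>C\<bar> + 1"
        have D: "D > 0" by (simp add: D_def)
        then obtain N where N: "\<And>m n. m \<ge> N \<Longrightarrow> n \<ge> N \<Longrightarrow> hnorm V (v m - v n) < e / D"
          using cv e unfolding cauchy_def by (metis divide_pos_pos)
        have "hnorm H (ev (v m) i - ev (v n) i) < e" if "m \<ge> N" "n \<ge> N" for m n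
        proof -
          have "hnorm H (ev (v m) i - ev (v n) i) \<le> C * hnorm V (v m - v n)"
            using ev_bound[of "v m - v n" i] v by (simp add: ev_diff)
          also have "\<dots> \<le> D * hnorm V (v m - v n)"
            using v by (intro mult_right_mono) (auto simp: D_def)
          also have "\<dots> < e" using N[OF that] D by (simp add: pos_less_divide_eq mult.commute)
          finally show ?thesis .
        qed
        then show "\<exists>N. \<forall>m\<ge>N. \<forall>n\<ge>N. hnorm H (ev (v m) i - ev (v n) i) < e" by blast
      qed (use v ev_vecs in blast)
      then show ?thesis by blast
    qed
    then obtain g where "\<And>i. g i \<in> vecs H" "\<And>i. (\<lambda>n. hnorm H (ev (v n) i - g i)) \<longlonglongrightarrow> 0"
      by metis
    then have g: "approx v g" using cv by (simp add: approx_def)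
    have "(\<lambda>n. hnorm completion (X n - g)) \<longlonglongrightarrow> 0"
    proof (rule Lim_null_comparison)
      show "\<forall>\<^sub>F n in sequentially. norm (hnorm completion (X n - g))
          \<le> 1 / (real n + 1) + hnorm completion (ev (v n) - g)"
      proof (intro always_eventually allI)
        fix n
        show "norm (hnorm completion (X n - g)) \<le> 1 / (real n + 1) + hnorm completion (ev (v n) - g)"
          using K.hnorm_triangle_diff[OF X evK completion_vecsI[OF g], of n n] vX[of n]
            K.hnorm_minus_commute[OF X evK, of n n] K.hnorm_nonneg[of "X n - g"] X completion_vecsI[OF g]
          by simp
      qed
      show "(\<lambda>n. 1 / (real n + 1) + hnorm completion (ev (v n) - g)) \<longlonglongrightarrow> 0"
        using small near[OF g] by (rule tendsto_add_zero)
    qed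
    then show "\<exists>l\<in>vecs completion. (\<lambda>n. hnorm completion (X n - l)) \<longlonglongrightarrow> 0"
      using completion_vecsI[OF g] by blast
  qed (use K.subspace_vecs K.inner_add K.inner_scale K.inner_cnj K.inner_nonneg in blast)+
qed

end

section \<open>Unitary dilations of positive definite Toeplitz kernels\<close>

text \<open>The normalised operators \<open>R S\<^sub>n R\<close> in abstract form. Nonnegativity
  provides the semi-inner product, dependence on m - n alone makes the shift isometric, and
  \<open>kernel_0\<close> makes the embedding of H isometric.\<close>

locale toeplitz_kernel = complex_hilbert_space H
  for H :: "'a::ab_group_add hspace" +
  fixes \<kappa> :: "int \<Rightarrow> 'a \<Rightarrow> 'a"
  assumes kernel_bounded: "bounded_op H (\<kappa> n)"
    and kernel_adjoint: "\<lbrakk>x \<in> vecs H; y \<in> vecs H\<rbrakk> \<Longrightarrow> hinner H (\<kappa> n x) y = hinner H x (\<kappa> (- n) y)"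
    and kernel_nonneg: "\<lbrakk>finite I; \<And>m. m \<in> I \<Longrightarrow> h m \<in> vecs H\<rbrakk>
      \<Longrightarrow> (\<Sum>m\<in>I. \<Sum>n\<in>I. hinner H (\<kappa> (m - n) (h m)) (h n)) \<in> \<real>\<^sub>\<ge>\<^sub>0"
    and kernel_0: "x \<in> vecs H \<Longrightarrow> \<kappa> 0 x = x"
begin

definition supp :: "(int \<Rightarrow> 'a) \<Rightarrow> int set" where
  "supp h = {n. h n \<noteq> 0}"

text \<open>The reproducing kernel function of the family h: its value at n represents the
  functional x \<mapsto> \<langle>h, \<open>single n x\<close>\<rangle>.\<close>

definition ksum :: "(int \<Rightarrow> 'a) \<Rightarrow> int \<Rightarrow> 'a" where
  "ksum h n = (\<Sum>m\<in>supp h. \<kappa> (m - n) (h m))"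

text \<open>Writing the form through \<open>ksum h\<close> shows that it sees h only by that
  function: null vectors are those with \<open>ksum h = 0\<close>, and weak convergence can be
  tested pointwise.\<close>

definition pre_space :: "(int \<Rightarrow> 'a) hspace" where
  "pre_space = \<lparr>vecs = {h. finite (supp h) \<and> (\<forall>n. h n \<in> vecs H)},
     hscale = (\<lambda>c h n. hscale H c (h n)),
     hinner = (\<lambda>h h'. \<Sum>n\<in>supp h'. hinner H (ksum h n) (h' n))\<rparr>"

definition single :: "int \<Rightarrow> 'a \<Rightarrow> int \<Rightarrow> 'a" where
  "single i x = (\<lambda>n. if n = i then x else 0)"

definition shift :: "int \<Rightarrow> (int \<Rightarrow> 'a) \<Rightarrow> int \<Rightarrow> 'a" where
  "shift s g = (\<lambda>n. g (n - s))"

lemmas kernel_vecs = bounded_op_vecs[OF kernel_bounded]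

lemma kernel_zero [simp]: "\<kappa> n 0 = 0"
  using bounded_op_scale_eq[OF kernel_bounded, of 0 n 0] by simp

lemma pre_space_iff: "h \<in> vecs pre_space \<longleftrightarrow> finite (supp h) \<and> (\<forall>n. h n \<in> vecs H)"
  by (simp add: pre_space_def)

lemma hscale_pre_space: "hscale pre_space c h = (\<lambda>n. hscale H c (h n))"
  by (simp add: pre_space_def)

lemma inner_pre_space: "hinner pre_space h h' = (\<Sum>n\<in>supp h'. hinner H (ksum h n) (h' n))"
  by (simp add: pre_space_def)

lemma ksum_superset:
  assumes "finite I" "supp h \<subseteq> I"
  shows "ksum h n = (\<Sum>m\<in>I. \<kappa> (m - n) (h m))"
  unfolding ksum_def using assms by (intro sum.mono_neutral_left) (auto simp: supp_def)

lemma ksum_vecs: "h \<in> vecs pre_space \<Longrightarrow> ksum h n \<in> vecs H"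
  unfolding ksum_def by (intro subspace_sum[OF subspace_vecs] kernel_vecs) (simp add: pre_space_iff)

lemma ksum_add:
  assumes "h \<in> vecs pre_space" "h' \<in> vecs pre_space"
  shows "ksum (h + h') n = ksum h n + ksum h' n"
proof -
  have I: "finite (supp h \<union> supp h')" using assms by (simp add: pre_space_iff)
  have "supp (h + h') \<subseteq> supp h \<union> supp h'" by (auto simp: supp_def)
  from ksum_superset[OF I this, of n] show ?thesis
    using assms ksum_superset[OF I, of h n] ksum_superset[OF I, of h' n]
    by (simp add: pre_space_iff bounded_op_add_eq[OF kernel_bounded] sum.distrib)
qed

lemma ksum_scale:
  assumes "h \<in> vecs pre_space"
  shows "ksum (hscale pre_space c h) n = hscale H c (ksum h n)"
proof -
  have I: "finite (supp h)" using assms by (simp add: pre_space_iff)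
  have "supp (hscale pre_space c h) \<subseteq> supp h" by (auto simp: supp_def hscale_pre_space)
  from ksum_superset[OF I this, of n] show ?thesis
    using assms unfolding ksum_def
    by (simp add: pre_space_iff hscale_pre_space bounded_op_scale_eq[OF kernel_bounded] scale_sum_right)
qed

lemma inner_pre_space_sum:
  assumes "h \<in> vecs pre_space" "h' \<in> vecs pre_space"
  shows "hinner pre_space h h' = (\<Sum>n\<in>supp h'. \<Sum>m\<in>supp h. hinner H (\<kappa> (m - n) (h m)) (h' n))"
  using assms unfolding inner_pre_space ksum_def
  by (intro sum.cong refl inner_sum_left) (auto simp: pre_space_iff kernel_vecs)

lemma semi_inner_space_pre_space: "semi_inner_space pre_space"
proof -
  interpret P: vector_space "hscale pre_space"
    by unfold_locales (simp_all add: hscale_pre_space fun_eq_iff scale_right_distrib scale_left_distrib)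
  show ?thesis
  proof (intro semi_inner_space.intro semi_inner_space_axioms.intro P.vector_space_axioms)
    have "finite (supp (h + h'))" if "finite (supp h)" "finite (supp h')" for h h'
      by (rule finite_subset[of _ "supp h \<union> supp h'"]) (use that in \<open>auto simp: supp_def\<close>)
    moreover have "finite (supp (\<lambda>n. hscale H c (h n)))" if "finite (supp h)" for h c
      by (rule finite_subset[OF _ that]) (auto simp: supp_def)
    moreover have "supp 0 = {}" by (simp add: supp_def)
    ultimately show "P.subspace (vecs pre_space)"
      by (auto simp: P.subspace_def pre_space_iff hscale_pre_space)
  next
    fix f g h assume "f \<in> vecs pre_space" "g \<in> vecs pre_space" "h \<in> vecs pre_space"
    then show "hinner pre_space (f + g) h = hinner pre_space f h + hinner pre_space g h"
      by (simp add: inner_pre_space ksum_add ksum_vecs inner_add pre_space_iff[of h] sum.distrib)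
  next
    fix f g c assume "f \<in> vecs pre_space" "g \<in> vecs pre_space"
    then show "hinner pre_space (hscale pre_space c f) g = c * hinner pre_space f g"
      by (simp add: inner_pre_space ksum_scale ksum_vecs inner_scale pre_space_iff[of g] sum_distrib_left)
  next
    fix f g assume fg: "f \<in> vecs pre_space" "g \<in> vecs pre_space"
    have "hinner H (\<kappa> (m - n) (f m)) (g n) = cnj (hinner H (\<kappa> (n - m) (g n)) (f m))" for m n
      using kernel_adjoint[of "f m" "g n" "m - n"] inner_cnj[of "f m" "\<kappa> (n - m) (g n)"] fg
      by (simp add: pre_space_iff kernel_vecs)
    then show "hinner pre_space f g = cnj (hinner pre_space g f)"
      unfolding inner_pre_space_sum[OF fg] inner_pre_space_sum[OF fg(2,1)] cnj_sum
      by (subst sum.swap) simp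
  next
    fix f assume f: "f \<in> vecs pre_space"
    have "(\<Sum>m\<in>supp f. \<Sum>n\<in>supp f. hinner H (\<kappa> (m - n) (f m)) (f n)) \<in> \<real>\<^sub>\<ge>\<^sub>0"
      using f by (intro kernel_nonneg) (auto simp: pre_space_iff)
    then show "hinner pre_space f f \<in> \<real>\<^sub>\<ge>\<^sub>0"
      unfolding inner_pre_space_sum[OF f f] by (subst sum.swap)
  qed
qed

lemma single_vecs: "x \<in> vecs H \<Longrightarrow> single i x \<in> vecs pre_space"
  by (auto simp: pre_space_iff single_def supp_def)

lemma supp_single: "supp (single i x) = (if x = 0 then {} else {i})"
  by (auto simp: supp_def single_def)

lemma inner_single_right: "h \<in> vecs pre_space \<Longrightarrow> x \<in> vecs H
    \<Longrightarrow> hinner pre_space h (single i x) = hinner H (ksum h i) x"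
  using inner_cnj[of "ksum h i" 0] ksum_vecs[of h i]
  by (auto simp: inner_pre_space supp_single) (simp add: single_def)

lemma ksum_single: "ksum (single i x) n = \<kappa> (i - n) x"
  by (simp add: ksum_def supp_single) (simp add: single_def)

text \<open>Pairing h with \<open>single i y\<close> for y = \<open>ksum h i\<close> gives the
  squared norm of y. The constant is 1 because \<open>kernel_0\<close> makes \<open>single i\<close>
  norm preserving.\<close>

lemma ksum_bound:
  assumes h: "h \<in> vecs pre_space"
  shows "hnorm H (ksum h i) \<le> 1 * hnorm pre_space h"
proof -
  interpret P: semi_inner_space pre_space by (rule semi_inner_space_pre_space)
  let ?y = "ksum h i"
  have y: "?y \<in> vecs H" using h by (rule ksum_vecs)
  have "hinner pre_space (single i ?y) (single i ?y) = hinner H ?y ?y"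
    using y by (simp add: inner_single_right single_vecs ksum_single kernel_0)
  then have n: "hnorm pre_space (single i ?y) = hnorm H ?y" by (simp add: hnorm_def)
  have "hnorm H ?y * hnorm H ?y = norm (hinner pre_space h (single i ?y))"
    using h y by (simp add: inner_single_right inner_self norm_power power2_eq_square norm_mult)
  also have "\<dots> \<le> hnorm pre_space h * hnorm H ?y"
    using P.norm_inner_le[OF h single_vecs[OF y], of i] by (simp add: n)
  finally show ?thesis
    using hnorm_nonneg[OF y] P.hnorm_nonneg[OF h] by (cases "hnorm H ?y = 0") auto
qed

sublocale GNS: function_completion pre_space H ksum 1
proof -
  \<comment> \<open>Against a fixed w the form is a finite sum over the support of w, so pointwise
    convergence of \<open>ksum (X k)\<close> suffices.\<close>
  have weak: "(\<lambda>k. hinner pre_space (X k) w) \<longlonglongrightarrow> 0"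
    if w: "w \<in> vecs pre_space" and X: "\<And>k. X k \<in> vecs pre_space"
    and lim: "\<And>i. (\<lambda>k::nat. hnorm H (ksum (X k) i)) \<longlonglongrightarrow> 0" for w X
  proof -
  have "(\<lambda>k. hinner H (ksum (X k) n) (w n)) \<longlonglongrightarrow> hinner H 0 (w n)" for n
    using w X lim by (intro tendsto_inner) (auto simp: ksum_vecs pre_space_iff)
  then have "(\<lambda>k. hinner H (ksum (X k) n) (w n)) \<longlonglongrightarrow> 0" for n
    using w by (simp add: pre_space_iff)
  then show ?thesis
    unfolding inner_pre_space by (intro tendsto_null_sum)
  qed
  show "function_completion pre_space H ksum 1"
    by (intro function_completion.intro function_completion_axioms.intro
        semi_inner_space_pre_space complex_hilbert_space_axioms
        ksum_vecs ksum_add ksum_scale ksum_bound weak)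
qed

abbreviation dilation_space :: "(int \<Rightarrow> 'a) hspace" where
  "dilation_space \<equiv> GNS.completion"

lemma dilation_space_hilbert: "complex_hilbert_space dilation_space"
  by (rule GNS.complex_hilbert_space_completion)

section \<open>The bilateral shift and the compression of its powers\<close>

lemma supp_shift: "supp (shift s h) = (\<lambda>n. n + s) ` supp h"
proof -
  have "n \<in> (\<lambda>n. n + s) ` supp h" if "n \<in> supp (shift s h)" for n
    using that by (intro image_eqI[of _ _ "n - s"]) (auto simp: supp_def shift_def)
  then show ?thesis by (auto simp: supp_def shift_def)
qed

lemma shift_vecs: "h \<in> vecs pre_space \<Longrightarrow> shift s h \<in> vecs pre_space"
  by (auto simp: pre_space_iff supp_shift) (simp add: shift_def)

text \<open>The Toeplitz property: the kernel depends on m - n only, so translating the family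
  translates its kernel function.\<close>

lemma ksum_shift: "ksum (shift s h) = shift s (ksum h)"
proof
  fix n
  show "ksum (shift s h) n = shift s (ksum h) n"
    unfolding ksum_def supp_shift
    by (subst sum.reindex) (auto simp: shift_def ksum_def algebra_simps)
qed

lemma inner_shift: "hinner pre_space (shift s h) (shift s h') = hinner pre_space h h'"
  unfolding inner_pre_space supp_shift ksum_shift
  by (subst sum.reindex) (auto simp: shift_def)

lemma shift_diff: "shift s (f - g) = shift s f - shift s g"
  by (simp add: shift_def fun_eq_iff)

lemma shift_shift: "shift s (shift t g) = shift (s + t) g"
  by (simp add: shift_def algebra_simps)

lemma shift_funpow: "(shift 1 ^^ n) g = shift (int n) g"
  by (induction n) (simp_all add: shift_shift, simp add: shift_def)

lemma approx_shift:
  assumes "GNS.approx X g"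
  shows "GNS.approx (\<lambda>k. shift s (X k)) (shift s g)"
proof -
  have "hnorm pre_space (shift s f - shift s h) = hnorm pre_space (f - h)" for f h
    by (simp only: hnorm_def inner_shift flip: shift_diff)
  then have "GNS.cauchy (\<lambda>k. shift s (X k))"
    using assms unfolding GNS.approx_def GNS.cauchy_def by (simp add: shift_vecs)
  then show ?thesis
    using assms by (simp add: GNS.approx_def ksum_shift) (simp add: shift_def)
qed

lemma shift_completion: "g \<in> vecs dilation_space \<Longrightarrow> shift s g \<in> vecs dilation_space"
  using approx_shift by (meson GNS.completion_vecsE GNS.completion_vecsI)

lemma inner_shift_completion:
  assumes "f \<in> vecs dilation_space" "g \<in> vecs dilation_space"
  shows "hinner dilation_space (shift s f) (shift s g) = hinner dilation_space f g"
proof -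
  obtain X Y where XY: "GNS.approx X f" "GNS.approx Y g" using assms by (meson GNS.completion_vecsE)
  show ?thesis
    using GNS.tendsto_inner_completion[OF approx_shift[OF XY(1), of s] approx_shift[OF XY(2), of s]]
      GNS.tendsto_inner_completion[OF XY] by (simp add: inner_shift LIMSEQ_unique)
qed

text \<open>Translations of all of \<open>int\<close> are invertible and preserve the inner product,
  so the adjoint of \<open>shift 1\<close> is \<open>shift (- 1)\<close>.\<close>

lemma unitary_shift: "unitary_op dilation_space (shift 1)"
proof -
  interpret K: complex_hilbert_space dilation_space by (rule dilation_space_hilbert)
  have "hnorm dilation_space (shift 1 g) \<le> 1 * hnorm dilation_space g" if "g \<in> vecs dilation_space" for g
    using inner_shift_completion[OF that that] by (simp add: hnorm_def)
  moreover have "shift 1 (f + g) = shift 1 f + shift 1 g" for f g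
    by (simp add: shift_def fun_eq_iff)
  moreover have "shift 1 (hscale dilation_space c f) = hscale dilation_space c (shift 1 f)" for c f
    by (simp add: shift_def GNS.hscale_completion)
  ultimately have b: "bounded_op dilation_space (shift 1)"
    unfolding bounded_op_def using shift_completion by blast
  have "hadj dilation_space (shift 1) g = shift (- 1) g" if "g \<in> vecs dilation_space" for g
  proof (rule K.hadj_eqI[OF b that shift_completion[OF that]])
    fix f assume f: "f \<in> vecs dilation_space"
    show "hinner dilation_space (shift 1 f) g = hinner dilation_space f (shift (- 1) g)"
      using inner_shift_completion[OF shift_completion[OF f, of 1] that, of "- 1"]
      by (simp add: shift_shift) (simp add: shift_def)
  qed
  then show ?thesis
    using b shift_completion by (simp add: unitary_op_def shift_shift) (simp add: shift_def)
qed

text \<open>H sits in the dilation space as the functions n \<mapsto> \<kappa> (- n) x.\<close>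

lemma isometric_embedding_single:
  "isometric_embedding H dilation_space (\<lambda>x. ksum (single 0 x))"
  unfolding isometric_embedding_def
proof (intro conjI ballI allI)
  fix x assume x: "x \<in> vecs H"
  show "ksum (single 0 x) \<in> vecs dilation_space"
    using x by (intro GNS.ev_in_completion single_vecs)
  show "ksum (single 0 (hscale H c x)) = hscale dilation_space c (ksum (single 0 x))" for c
    using x by (simp add: fun_eq_iff ksum_single GNS.hscale_completion bounded_op_scale_eq[OF kernel_bounded])
  fix y assume y: "y \<in> vecs H"
  show "ksum (single 0 (x + y)) = ksum (single 0 x) + ksum (single 0 y)"
    using x y by (simp add: fun_eq_iff ksum_single bounded_op_add_eq[OF kernel_bounded])
  show "hinner dilation_space (ksum (single 0 x)) (ksum (single 0 y)) = hinner H x y"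
    using x y by (simp add: GNS.inner_ev single_vecs inner_single_right ksum_single kernel_0)
qed

text \<open>The n-th power of the shift sends \<open>single 0 x\<close> to
  \<open>single n x\<close>, whose inner product with \<open>single 0 y\<close> is a kernel value.
  So the compression of that power to H is \<kappa> n.\<close>

lemma orth_proj_shift:
  assumes x: "x \<in> vecs H"
  shows "orth_proj dilation_space ((\<lambda>x. ksum (single 0 x)) ` vecs H)
      ((shift 1 ^^ n) (ksum (single 0 x))) = ksum (single 0 (\<kappa> (int n) x))"
proof (rule orth_proj_isometric_embedding[OF dilation_space_hilbert isometric_embedding_single])
  show "(shift 1 ^^ n) (ksum (single 0 x)) \<in> vecs dilation_space"
    using x by (simp add: shift_funpow shift_completion GNS.ev_in_completion single_vecs)
  show "\<kappa> (int n) x \<in> vecs H" using x by (rule kernel_vecs)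
  fix y assume y: "y \<in> vecs H"
  have "shift (int n) (single 0 x) = single (int n) x" by (auto simp: shift_def single_def)
  then have "hinner dilation_space (ksum (single 0 y)) ((shift 1 ^^ n) (ksum (single 0 x)))
      = hinner dilation_space (ksum (single 0 y)) (ksum (single (int n) x))"
    by (simp add: shift_funpow flip: ksum_shift)
  also have "\<dots> = hinner H (\<kappa> (- int n) y) x"
    using x y by (simp add: GNS.inner_ev single_vecs inner_single_right ksum_single)
  also have "\<dots> = hinner H y (\<kappa> (int n) x)" using kernel_adjoint[OF y x, of "- int n"] by simp
  finally show "hinner dilation_space (ksum (single 0 y)) ((shift 1 ^^ n) (ksum (single 0 x)))
      = hinner H y (\<kappa> (int n) x)" .
qed

end

lemma (in complex_hilbert_space) C_A_class_of_positive_map: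
  assumes A: "positive_op H A" and inv: "invertible_op H A" and T: "bounded_op H T"
    and pos: "positive_map trig_system H (phi_A H A T)"
  shows "C_A_class TYPE(int \<Rightarrow> 'a) H A T"
proof -
  have Ab: "bounded_op H A" using A by (simp add: positive_op_def)
  define R where "R = sqrt_op H (inverse_op H A)"
  note R = sqrt_inverse_op[OF A inv, folded R_def]
  have Rb: "bounded_op H R" using R(1) by (simp add: positive_op_def)
  note Sb = bounded_op_toeplitz_op[OF Ab T]
  note v = bounded_op_vecs[OF Rb] bounded_op_vecs[OF Sb]
  \<comment> \<open>Conjugation by R turns the value A at n = 0 into R A R = I, as
    \<open>kernel_0\<close> demands.\<close>
  define \<kappa> where "\<kappa> n x = R (toeplitz_op H A T n (R x))" for n x
  interpret toeplitz_kernel H \<kappa>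
  proof
    show "bounded_op H (\<kappa> n)" for n
      unfolding \<kappa>_def using bounded_op_compose[OF Rb bounded_op_compose[OF Sb Rb]] .
    show "hinner H (\<kappa> n x) y = hinner H x (\<kappa> (- n) y)" if "x \<in> vecs H" "y \<in> vecs H" for n x y
      using that v by (simp add: \<kappa>_def positive_op_selfadjoint[OF R(1)] inner_toeplitz_op_left[OF A T])
    show "(\<Sum>m\<in>I. \<Sum>n\<in>I. hinner H (\<kappa> (m - n) (h m)) (h n)) \<in> \<real>\<^sub>\<ge>\<^sub>0"
      if "finite I" "\<And>m. m \<in> I \<Longrightarrow> h m \<in> vecs H" for I h
      \<comment> \<open>Symmetry moves the outer R to the second argument, leaving the kernel of S
        at the vectors R (h m).\<close>
      using toeplitz_kernel_nonneg[OF Ab T pos that(1), of "\<lambda>m. R (h m)"] that v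
      by (simp add: \<kappa>_def positive_op_selfadjoint[OF R(1)] cong: sum.cong)
    show "\<kappa> 0 x = x" if "x \<in> vecs H" for x using R(2)[OF that] by (simp add: \<kappa>_def toeplitz_op_def)
  qed
  have "\<kappa> (int n) x = R ((T ^^ n) (R x))" if "n \<ge> 1" for n x
    using that by (simp add: \<kappa>_def toeplitz_op_def)
  then have "\<forall>n\<ge>1. \<forall>x\<in>vecs H. ksum (single 0 (R ((T ^^ n) (R x))))
      = orth_proj dilation_space ((\<lambda>x. ksum (single 0 x)) ` vecs H) ((shift 1 ^^ n) (ksum (single 0 x)))"
    using orth_proj_shift by simp
  then show ?thesis
    unfolding C_A_class_def Let_def R_def[symmetric]
    using dilation_space_hilbert isometric_embedding_single unitary_shift by blast
qed

text \<open>The second conjunct shows that the type \<open>int => 'a\<close> restricts nothing: a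
  dilation with vectors of any type \<open>'k\<close> forces positivity, and positivity returns a
  dilation over \<open>int => 'a\<close>.\<close>

theorem theorem4p4:
  fixes H :: "'a::ab_group_add hspace" and A T :: "'a \<Rightarrow> 'a"
  assumes "complex_hilbert_space H"
    and "positive_op H A" and "invertible_op H A"
    and "bounded_op H T"
  shows "(positive_map trig_system H (phi_A H A T) \<longleftrightarrow> C_A_class TYPE(int \<Rightarrow> 'a) H A T)
    \<and> (C_A_class TYPE('k::ab_group_add) H A T \<longrightarrow> positive_map trig_system H (phi_A H A T))"
  using complex_hilbert_space.C_A_class_of_positive_map[OF assms]
    complex_hilbert_space.positive_map_of_C_A_class[OF assms, where 'k = "int \<Rightarrow> 'a"]
    complex_hilbert_space.positive_map_of_C_A_class[OF assms, where 'k = 'k]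
  by blast

end
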